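(* Let $F$ be a fixed graph with $\chi(F)=r+1\ge3$ and $a(F)>1$. Uniformly for integers $\Delta$ with $\lceil \frac{r-1}{r}n\rceil\le\Delta\le n-1$, the following hold as $n\to\infty$. (i) There exists an $F$-free graph $J_\Delta\in\mathcal J^{a(F)-1}_{n,\Delta,r,=}$ such that $d_{\mathrm{edit}}(J_\Delta,T(n,r))=O_F(n)$, and consequently $e(J_\Delta)=t(n,r)+O_F(n)$ and $\rho(J_\Delta)=\rho(T(n,r))+O_F(\sqrt n)$. (ii) $\mathrm{ex}_F(n,\Delta)=t(n,r)+o(n^2)$ and $\mathrm{spex}_F(n,\Delta)=\rho(T(n,r))+o(n)$. (iii) Let $\mathfrak G_{n,\Delta}(F)$ be the family of all $n$-vertex $F$-free graphs $G$ with $\Delta(G)=\Delta$. Every graph in $\mathfrak G_{n,\Delta}(F)$ attaining $\mathrm{ex}_F(n,\Delta)$ and every graph in $\mathfrak G_{n,\Delta}(F)$ attaining $\mathrm{spex}_F(n,\Delta)$ is at edit distance $o(n^2)$ from $T(n,r)$.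
   Context: All graphs are finite, simple and undirected. A graph is $F$-free if it contains no copy of $F$ as a (not necessarily induced) subgraph. $e(G)$ is the number of edges, $\Delta(G)$ the maximum degree, $\chi$ the chromatic number, and $\rho(G)$ the adjacency spectral radius. $T(n,r)$ is the balanced complete $r$-partite graph on $n$ vertices and $t(n,r)=e(T(n,r))$. For a graph $F$ with $\chi(F)=r+1\ge3$, $a(F):=\min\{|I|: I\subseteq V(F)\text{ is independent and }\chi(F-I)\le r\}$. $\mathrm{ex}_F(n,\Delta)$ and $\mathrm{spex}_F(n,\Delta)$ are respectively the maximum of $e(G)$ and of $\rho(G)$ over $G\in\mathfrak G_{n,\Delta}(F)$. For $t\ge1$, $\mathcal J^t_{n,\Delta,r}$ is the family of $n$-vertex graphs $J$ for which there is an independent set $X\subseteq V(J)$ with $|X|\le t$ such that $J-X=T(n-|X|,r)$ and the edges from $X$ to $V(J)\setminus X$ are arbitrary subject to $\Delta(J)\le\Delta$; and $\mathcal J^t_{n,\Delta,r,=}:=\{J\in\mathcal J^t_{n,\Delta,r}:\Delta(J)=\Delta\}$. For two $n$-vertex graphs $G,H$, $d_{\mathrm{edit}}(G,H):=\min_{\phi}|E(G)\mathbin{\triangle}\phi(E(H))|$ over all bijections $\phi:V(H)\to V(G)$, where $\phi(E(H))=\{\phi(x)\phi(y):xy\in E(H)\}$; "edit distance" means $d_{\mathrm{edit}}$. "Uniformly" means that the implied constants and $o(\cdot)$ terms depend only on $F$ and $n$, not on $\Delta$. *)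

theory Defs
  imports
    "HOL-Library.Landau_Symbols"
    "Jordan_Normal_Form.Spectral_Radius"
begin

datatype 'a graph = Graph (verts: "'a set") (edges: "'a set set")

definition simple_graph :: "'a graph \<Rightarrow> bool" where
  "simple_graph G \<longleftrightarrow> finite (verts G) \<and> (\<forall>e\<in>edges G. e \<subseteq> verts G \<and> card e = 2)"

definition num_edges :: "'a graph \<Rightarrow> nat" where
  "num_edges G = card (edges G)"

definition vdegree :: "'a graph \<Rightarrow> 'a \<Rightarrow> nat" where
  "vdegree G v = card {e \<in> edges G. v \<in> e}"

definition max_degree :: "'a graph \<Rightarrow> nat" where
  "max_degree G = Max (vdegree G ` verts G)"

definition delete_verts :: "'a graph \<Rightarrow> 'a set \<Rightarrow> 'a graph" where
  "delete_verts G X = Graph (verts G - X) {e \<in> edges G. e \<inter> X = {}}"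

definition independent_set :: "'a graph \<Rightarrow> 'a set \<Rightarrow> bool" where
  "independent_set G X \<longleftrightarrow> X \<subseteq> verts G \<and> (\<forall>e\<in>edges G. \<not> e \<subseteq> X)"

definition graph_iso :: "'a graph \<Rightarrow> 'b graph \<Rightarrow> bool" where
  "graph_iso G H \<longleftrightarrow> (\<exists>f. bij_betw f (verts G) (verts H) \<and> (`) f ` edges G = edges H)"

definition contains_copy :: "'a graph \<Rightarrow> 'b graph \<Rightarrow> bool" where
  "contains_copy G F \<longleftrightarrow>
     (\<exists>f. inj_on f (verts F) \<and> f ` verts F \<subseteq> verts G \<and> (\<forall>e\<in>edges F. f ` e \<in> edges G))"

definition free_of :: "'b graph \<Rightarrow> 'a graph \<Rightarrow> bool" where
  "free_of F G \<longleftrightarrow> \<not> contains_copy G F"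

definition proper_colouring :: "'a graph \<Rightarrow> nat \<Rightarrow> ('a \<Rightarrow> nat) \<Rightarrow> bool" where
  "proper_colouring G k c \<longleftrightarrow>
     c ` verts G \<subseteq> {..<k} \<and> (\<forall>x y. {x, y} \<in> edges G \<longrightarrow> c x \<noteq> c y)"

definition chromatic_number :: "'a graph \<Rightarrow> nat" where
  "chromatic_number G = (LEAST k. \<exists>c. proper_colouring G k c)"

text \<open>The parameter \<open>a(F)\<close>; with \<open>\<chi>(F) = r + 1\<close>, the bound \<open>\<chi>(F) - 1\<close> below is \<open>r\<close>.\<close>

definition a_param :: "'a graph \<Rightarrow> nat" where
  "a_param F = Min (card ` {I. independent_set F I \<and>
     chromatic_number (delete_verts F I) \<le> chromatic_number F - 1})"

text \<open>The rows and columns are indexed by the increasing enumeration of the vertex set; for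
  vertex set \<open>{..<n}\<close> this enumeration is the identity.\<close>

definition adjacency_mat :: "nat graph \<Rightarrow> complex mat" where
  "adjacency_mat G =
     (let n = card (verts G); vs = sorted_list_of_set (verts G)
      in mat n n (\<lambda>(i, j). if {vs ! i, vs ! j} \<in> edges G then 1 else 0))"

definition graph_spectral_radius :: "nat graph \<Rightarrow> real" where
  "graph_spectral_radius G = spectral_radius (adjacency_mat G)"

text \<open>The residue classes modulo \<open>r\<close> split \<open>{..<n}\<close> into \<open>r\<close> parts whose sizes differ by at
  most one.\<close>

definition turan_graph :: "nat \<Rightarrow> nat \<Rightarrow> nat graph" where
  "turan_graph n r = Graph {..<n} {{x, y} | x y. x < n \<and> y < n \<and> x mod r \<noteq> y mod r}"

definition turan_number :: "nat \<Rightarrow> nat \<Rightarrow> nat" where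
  "turan_number n r = num_edges (turan_graph n r)"

text \<open>As usual, an \<open>n\<close>-vertex graph is represented on the vertex set \<open>{..<n}\<close>.\<close>

definition nvertex_graph :: "nat \<Rightarrow> nat graph \<Rightarrow> bool" where
  "nvertex_graph n G \<longleftrightarrow> simple_graph G \<and> verts G = {..<n}"

definition free_family :: "'b graph \<Rightarrow> nat \<Rightarrow> nat \<Rightarrow> nat graph set" where
  "free_family F n \<Delta> = {G. nvertex_graph n G \<and> free_of F G \<and> max_degree G = \<Delta>}"

text \<open>Both maxima range over finite families; they are unspecified when the family is empty.\<close>

definition ex_num :: "'b graph \<Rightarrow> nat \<Rightarrow> nat \<Rightarrow> nat" where
  "ex_num F n \<Delta> = Max (num_edges ` free_family F n \<Delta>)"

definition spex_num :: "'b graph \<Rightarrow> nat \<Rightarrow> nat \<Rightarrow> real" where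
  "spex_num F n \<Delta> = Max (graph_spectral_radius ` free_family F n \<Delta>)"

definition J_family :: "nat \<Rightarrow> nat \<Rightarrow> nat \<Rightarrow> nat \<Rightarrow> nat graph set" where
  "J_family t n \<Delta> r = {J. nvertex_graph n J \<and>
     (\<exists>X. independent_set J X \<and> card X \<le> t \<and>
          graph_iso (delete_verts J X) (turan_graph (n - card X) r)) \<and>
     max_degree J \<le> \<Delta>}"

definition J_family_eq :: "nat \<Rightarrow> nat \<Rightarrow> nat \<Rightarrow> nat \<Rightarrow> nat graph set" where
  "J_family_eq t n \<Delta> r = {J \<in> J_family t n \<Delta> r. max_degree J = \<Delta>}"

definition edit_dist :: "'a graph \<Rightarrow> 'b graph \<Rightarrow> nat" where
  "edit_dist G H =
     Min ((\<lambda>\<phi>. card ((edges G - (`) \<phi> ` edges H) \<union> ((`) \<phi> ` edges H - edges G))) `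
          {\<phi>. bij_betw \<phi> (verts H) (verts G)})"

end

theory Submission
  imports Defs "HOL-Analysis.Convex"
begin

text \<open>
  The graph \<open>J\<close> is the Turan graph together with a star centred at a vertex of a largest part and
  with leaves in the same part. Deleting the centre leaves an \<open>r\<close>-partite graph, so a copy of \<open>F\<close>
  in \<open>J\<close> would give \<open>a(F) \<le> 1\<close>; the star changes the spectral radius by \<open>O(\<surd>n)\<close>.

  For the upper bounds, an \<open>F\<close>-free graph has \<open>o(n\<^bsup>r+1\<^esup>)\<close> cliques of size \<open>r + 1\<close>, since a dense
  set of \<open>(r + 1)\<close>-tuples contains a large box. Hence the Motzkin-Straus inequality holds
  up to \<open>o(1)\<close> for every weighting of the vertices that is not concentrated. Uniform weights
  bound the number of edges. The squares of the entries of an eigenvector give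
  \<open>\<rho>\<^sup>2 \<le> (1 - 1/r + o(1)) 2e\<close>, which also shows that graphs of nearly maximal spectral radius
  have nearly maximally many edges, so that both extremal problems are covered by edge stability.
  For stability, the non-neighbourhoods of the vertices of a typical \<open>r\<close>-clique are the parts.
\<close>

section \<open>Spectral radius and quadratic forms\<close>

text \<open>Uniformity in \<Delta> rests on upper bounds that ignore the maximum degree: they hold
  for every \<open>F\<close>-free graph, and \<Delta> enters only through the starred Turan graph,
  which shows that each family is nonempty and bounds both maxima from below. The number of leaves
  tunes the degree of the centre to the prescribed \<Delta>. The weighted inequality must exclude
  concentrated weights: an \<open>F\<close>-free graph may contain a clique on r + 1 vertices, and
  all the weight spread evenly there gives 1 - 1/(r + 1). If no weight exceeds C/n times the total,
  a surplus \<delta> yields not one such clique but order n^(r + 1) of them. An eigenvector meets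
  the condition because \<rho> x_i is at most the sum of x over the neighbours of i; for unit x this
  gives x_i^2 \<le> n / \<rho>^2, which is O(1/n) once \<rho> is linear in n. The edge bound, the
  scarcity of low degrees and the spectral bound are one inequality read with three
  weightings.\<close>

definition quad_form :: "'a set \<Rightarrow> ('a \<Rightarrow> 'a \<Rightarrow> bool) \<Rightarrow> ('a \<Rightarrow> real) \<Rightarrow> real" where
  "quad_form V E x = (\<Sum>u\<in>V. \<Sum>v\<in>V. of_bool (E u v) * x u * x v)"

abbreviation adj :: "'a graph \<Rightarrow> 'a \<Rightarrow> 'a \<Rightarrow> bool" where
  "adj G u v \<equiv> {u, v} \<in> edges G"

lemma nvertexD:
  assumes "nvertex_graph n G"
  shows "verts G = {..<n}" "finite (edges G)" "\<And>e. e \<in> edges G \<Longrightarrow> e \<subseteq> {..<n} \<and> card e = 2"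
    "\<And>u v. adj G u v \<Longrightarrow> u < n \<and> v < n \<and> u \<noteq> v"
proof -
  show v: "verts G = {..<n}" using assms by (simp add: nvertex_graph_def)
  show e: "\<And>e. e \<in> edges G \<Longrightarrow> e \<subseteq> {..<n} \<and> card e = 2"
    using assms by (auto simp: nvertex_graph_def simple_graph_def)
  have "edges G \<subseteq> Pow {..<n}" using e by blast
  then show "finite (edges G)" by (rule finite_subset) simp
  show "\<And>u v. adj G u v \<Longrightarrow> u < n \<and> v < n \<and> u \<noteq> v"
    using e by fastforce
qed

lemma adjacency_mat_nvertex:
  assumes "nvertex_graph n G"
  shows "adjacency_mat G = mat n n (\<lambda>(i, j). of_bool (adj G i j))"
proof -
  have "sorted_list_of_set {..<n} = [0..<n]"
    by (simp add: lessThan_atLeast0)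
  then show ?thesis
    by (auto simp: adjacency_mat_def nvertexD(1)[OF assms] Let_def intro!: eq_matI)
qed

lemma spectral_radius_scaled_less_1:
  assumes A: "A \<in> carrier_mat n n" and n: "n > 0" and s: "spectral_radius A < s" "s > 0"
  shows "spectral_radius (complex_of_real (1 / s) \<cdot>\<^sub>m A) < 1"
proof -
  let ?B = "complex_of_real (1 / s) \<cdot>\<^sub>m A"
  have B: "?B \<in> carrier_mat n n" using A by simp
  obtain ev where ev: "ev \<in> spectrum ?B" "norm ev = spectral_radius ?B"
    using spectral_radius_mem_max(1)[OF B n] by auto
  then obtain v where v: "v \<in> carrier_vec n" "v \<noteq> 0\<^sub>v n" "?B *\<^sub>v v = ev \<cdot>\<^sub>v v"
    using A by (auto simp: spectrum_def eigenvalue_def eigenvector_def)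
  have "A *\<^sub>v v = (of_real s * ev) \<cdot>\<^sub>v v"
  proof (rule eq_vecI)
    fix i assume "i < dim_vec ((of_real s * ev) \<cdot>\<^sub>v v)"
    then have i: "i < n" using v by simp
    have "(?B *\<^sub>v v) $ i = of_real (1 / s) * (A *\<^sub>v v) $ i"
      using i A v(1) by (auto simp: row_def scalar_prod_def sum_distrib_left mult.assoc)
    then have "of_real (1 / s) * (A *\<^sub>v v) $ i = ev * v $ i" using v i by simp
    then show "(A *\<^sub>v v) $ i = ((of_real s * ev) \<cdot>\<^sub>v v) $ i"
      using i v s(2) by (simp add: field_simps)
  qed (use A v in simp)
  then have "of_real s * ev \<in> spectrum A"
    using A v by (auto simp: spectrum_def eigenvalue_def eigenvector_def intro!: exI[of _ v])
  then have "norm (of_real s * ev) \<le> spectral_radius A"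
    using spectral_radius_mem_max(2)[OF A n] by blast
  moreover have "norm (of_real s * ev) = s * norm ev" using s(2) by (simp add: norm_mult)
  ultimately have "s * norm ev < s * 1" using s by linarith
  then show ?thesis using s(2) ev(2) by (simp only: mult_less_cancel_left_pos)
qed

lemma pow_mat_Suc_left:
  assumes A: "(A :: 'a :: semiring_1 mat) \<in> carrier_mat n n"
  shows "A ^\<^sub>m Suc k = A * A ^\<^sub>m k"
proof (induction k)
  case 0 show ?case using A by simp
next
  case (Suc k)
  have "A ^\<^sub>m Suc (Suc k) = (A * A ^\<^sub>m k) * A" using Suc by simp
  also have "\<dots> = A * (A ^\<^sub>m k * A)"
    using A by (intro assoc_mult_mat) auto
  finally show ?case by simp
qed

text \<open>If the Rayleigh quotient exceeded the spectral radius, rescale so that 1 separates the two: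
  the powers would be bounded, while the moments \<open>x\<^sup>T B\<^sup>k x\<close> at least square when \<open>k\<close> doubles.\<close>

lemma rayleigh_le_spectral_radius:
  fixes a :: "nat \<Rightarrow> nat \<Rightarrow> real"
  assumes sym: "\<And>i j. i < n \<Longrightarrow> j < n \<Longrightarrow> a i j = a j i"
    and x: "(\<Sum>i<n. (x i)\<^sup>2) = 1"
  shows "(\<Sum>i<n. \<Sum>j<n. a i j * x i * x j) \<le> spectral_radius (mat n n (\<lambda>(i, j). of_real (a i j)))"
    (is "?q \<le> spectral_radius ?A")
proof (rule ccontr)
  assume "\<not> ?thesis"
  then obtain s where s: "spectral_radius ?A < s" "s < ?q"
    using dense[of "spectral_radius ?A" ?q] by auto
  have n: "n > 0" using x by (cases n) auto
  have A: "?A \<in> carrier_mat n n" by simp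
  have "0 \<le> spectral_radius ?A"
    using spectral_radius_mem_max(1)[OF A n] by auto
  then have s0: "s > 0" using s by linarith
  define B where "B = complex_of_real (1 / s) \<cdot>\<^sub>m ?A"
  define b where "b i j = a i j / s" for i j
  have B: "B \<in> carrier_mat n n" by (simp add: B_def)
  have B_eq: "B = mat n n (\<lambda>(i, j). of_real (b i j))"
    by (auto simp: B_def b_def)
  have b_sym: "\<And>i j. i < n \<Longrightarrow> j < n \<Longrightarrow> b i j = b j i" using sym by (simp add: b_def)
  \<comment> \<open>By the Jordan normal form bound, spectral radius below 1 gives one entrywise
    bound for all the powers.\<close>
  obtain c where c: "\<And>k. norm_bound (B ^\<^sub>m k) c"
    using spectral_radius_jnf_norm_bound_less_1_upper_triangular[OF B]
      spectral_radius_scaled_less_1[OF A n s(1) s0] by (auto simp: B_def)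
  \<comment> \<open>The iterates B^k x are kept as real functions, where Cauchy-Schwarz applies;
    \<open>u_vec\<close> ties them to the complex powers.\<close>
  define u where "u k = rec_nat x (\<lambda>_ y i. \<Sum>j<n. b i j * y j) k" for k
  have u0: "u 0 = x" and uS: "\<And>k i. u (Suc k) i = (\<Sum>j<n. b i j * u k j)"
    by (simp_all add: u_def)
  define X where "X = vec n (\<lambda>i. complex_of_real (x i))"
  have u_vec: "vec n (\<lambda>i. complex_of_real (u k i)) = B ^\<^sub>m k *\<^sub>v X" for k
  proof (induction k)
    case 0
    show ?case using B by (simp add: u0 X_def)
  next
    case (Suc k)
    have "B ^\<^sub>m Suc k = B * B ^\<^sub>m k" by (rule pow_mat_Suc_left[OF B])
    then have "B ^\<^sub>m Suc k *\<^sub>v X = B *\<^sub>v (B ^\<^sub>m k *\<^sub>v X)"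
      using B by (simp add: X_def assoc_mult_mat_vec[of _ n n _ n])
    also have "\<dots> = B *\<^sub>v vec n (\<lambda>i. complex_of_real (u k i))" using Suc by simp
    also have "\<dots> = vec n (\<lambda>i. complex_of_real (u (Suc k) i))"
      by (rule eq_vecI) (auto simp: B_eq uS scalar_prod_def row_def atLeast0LessThan)
    finally show ?case by simp
  qed
  have u_bd: "\<bar>u k i\<bar> \<le> c * (\<Sum>j<n. \<bar>x j\<bar>)" if "i < n" for k i
  proof -
    have P: "B ^\<^sub>m k \<in> carrier_mat n n" using B by simp
    have "complex_of_real (u k i) = (B ^\<^sub>m k *\<^sub>v X) $ i"
      using u_vec[of k] that by (metis index_vec)
    also have "\<dots> = (\<Sum>j<n. (B ^\<^sub>m k) $$ (i, j) * of_real (x j))"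
      using P B that by (simp add: X_def scalar_prod_def atLeast0LessThan)
    finally have "norm (complex_of_real (u k i)) \<le> (\<Sum>j<n. norm ((B ^\<^sub>m k) $$ (i, j) * of_real (x j)))"
      by (metis norm_sum)
    also have "\<dots> \<le> (\<Sum>j<n. c * \<bar>x j\<bar>)"
      using c[of k, unfolded norm_bound_def carrier_matD[OF P]] that
      by (intro sum_mono) (auto simp: norm_mult intro!: mult_right_mono)
    finally show ?thesis by (simp add: sum_distrib_left)
  qed
  define ip where "ip y z = (\<Sum>i<n. y i * z i)" for y z :: "nat \<Rightarrow> real"
  have ip_swap: "ip (u (Suc k)) (u l) = ip (u k) (u (Suc l))" for k l
  proof -
    have "ip (u (Suc k)) (u l) = (\<Sum>i<n. \<Sum>j<n. b i j * u k j * u l i)"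
      by (simp add: ip_def uS sum_distrib_right)
    also have "\<dots> = (\<Sum>j<n. \<Sum>i<n. b i j * u k j * u l i)" by (rule sum.swap)
    also have "\<dots> = ip (u k) (u (Suc l))"
      unfolding ip_def uS sum_distrib_left
      by (intro sum.cong refl) (simp add: b_sym)
    finally show ?thesis .
  qed
  \<comment> \<open>Symmetry moves one factor of B across the inner product at a time, so only the
    total exponent matters.\<close>
  have ip_add: "ip (u k) (u l) = ip x (u (k + l))" for k l
  proof (induction k arbitrary: l)
    case 0 show ?case by (simp add: u0)
  next
    case (Suc k) then show ?case by (simp add: ip_swap)
  qed
  define m where "m k = ip x (u k)" for k
  have dbl: "(m k)\<^sup>2 \<le> m (2 * k)" for k
  proof -
    have "(m k)\<^sup>2 \<le> (\<Sum>i<n. (x i)\<^sup>2) * (\<Sum>i<n. (u k i)\<^sup>2)"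
      unfolding m_def ip_def by (rule Cauchy_Schwarz_ineq_sum)
    also have "\<dots> = ip (u k) (u k)" unfolding x ip_def by (simp add: power2_eq_square)
    finally show ?thesis by (simp add: ip_add m_def mult_2)
  qed
  have "m 1 = ?q / s"
    by (simp add: m_def ip_def uS u0 b_def sum_distrib_left sum_divide_distrib mult_ac)
  then have m1: "m 1 > 1" using s s0 by simp
  have pow: "(m 1) ^ (2 ^ k) \<le> m (2 ^ k)" for k
  proof (induction k)
    case (Suc k)
    have "(m 1) ^ (2 ^ Suc k) = ((m 1) ^ (2 ^ k))\<^sup>2"
      unfolding power_mult[symmetric] by (simp add: mult.commute)
    also have "\<dots> \<le> (m (2 ^ k))\<^sup>2" using Suc m1 by (intro power_mono) auto
    also have "\<dots> \<le> m (2 * 2 ^ k)" by (rule dbl)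
    finally show ?case by simp
  qed simp
  define M where "M = (\<Sum>i<n. \<bar>x i\<bar> * (c * (\<Sum>j<n. \<bar>x j\<bar>)))"
  have mM: "m k \<le> M" for k
    unfolding m_def ip_def M_def
  proof (rule sum_mono)
    fix i assume "i \<in> {..<n}"
    have "x i * u k i \<le> \<bar>x i\<bar> * \<bar>u k i\<bar>" by (metis abs_ge_self abs_mult)
    also have "\<dots> \<le> \<bar>x i\<bar> * (c * (\<Sum>j<n. \<bar>x j\<bar>))"
      using u_bd \<open>i \<in> _\<close> by (intro mult_left_mono) auto
    finally show "x i * u k i \<le> \<bar>x i\<bar> * (c * (\<Sum>j<n. \<bar>x j\<bar>))" .
  qed
  obtain k where k: "M < m 1 ^ k" using real_arch_pow[OF m1] by blast
  \<comment> \<open>The moments are bounded below only at powers of two; passing from k to 2^k is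
    enough because \<open>m 1\<close> exceeds 1.\<close>
  also have "m 1 ^ k \<le> m 1 ^ (2 ^ k)"
    using m1 by (intro power_increasing) (auto intro: less_imp_le)
  also have "\<dots> \<le> M" using pow mM order_trans by blast
  finally show False by simp
qed

lemma quad_form_le_spectral_radius:
  assumes G: "nvertex_graph n G" and x: "(\<Sum>i<n. (x i)\<^sup>2) = 1"
  shows "quad_form {..<n} (adj G) x \<le> graph_spectral_radius G"
proof -
  have "(\<lambda>(i, j). complex_of_real (of_bool (adj G i j))) = (\<lambda>(i, j). of_bool (adj G i j))"
    by auto
  then show ?thesis
    using rayleigh_le_spectral_radius[of n "\<lambda>i j. of_bool (adj G i j)" x] x
    by (simp add: quad_form_def graph_spectral_radius_def adjacency_mat_nvertex[OF G] insert_commute)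
qed

text \<open>The entrywise absolute value of an eigenvector of maximal modulus replaces the Perron vector.\<close>

lemma spectral_radius_subeigenvector:
  assumes G: "nvertex_graph n G" and n: "n > 0"
  obtains x where "\<And>i. x i \<ge> (0::real)" "(\<Sum>i<n. (x i)\<^sup>2) = 1"
    "\<And>i. i < n \<Longrightarrow> graph_spectral_radius G * x i \<le> (\<Sum>j<n. of_bool (adj G i j) * x j)"
proof -
  define A where "A = adjacency_mat G"
  have A_eq: "A = mat n n (\<lambda>(i, j). of_bool (adj G i j))"
    by (simp add: A_def adjacency_mat_nvertex[OF G])
  then have A: "A \<in> carrier_mat n n" by simp
  obtain ev where ev: "ev \<in> spectrum A" "norm ev = graph_spectral_radius G"
    using spectral_radius_mem_max(1)[OF A n] by (auto simp: graph_spectral_radius_def A_def)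
  then obtain v where v: "v \<in> carrier_vec n" "v \<noteq> 0\<^sub>v n" "A *\<^sub>v v = ev \<cdot>\<^sub>v v"
    using A by (auto simp: spectrum_def eigenvalue_def eigenvector_def)
  define N where "N = (\<Sum>i<n. (norm (v $ i))\<^sup>2)"
  obtain i0 where i0: "i0 < n" "v $ i0 \<noteq> 0"
    using v(1,2) by (metis carrier_vecD eq_vecI index_zero_vec)
  have "0 < (norm (v $ i0))\<^sup>2" using i0 by simp
  also have "\<dots> \<le> N" unfolding N_def using i0 by (intro member_le_sum) auto
  finally have N: "N > 0" .
  define x where "x i = norm (v $ i) / sqrt N" for i
  have "(\<Sum>i<n. (x i)\<^sup>2) = 1"
    using N by (simp add: x_def power_divide sum_divide_distrib[symmetric] N_def[symmetric])
  moreover have "graph_spectral_radius G * x i \<le> (\<Sum>j<n. of_bool (adj G i j) * x j)" if i: "i < n" for i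
  proof -
    have "ev * v $ i = (A *\<^sub>v v) $ i" using v i by simp
    also have "\<dots> = (\<Sum>j<n. of_bool (adj G i j) * v $ j)"
      using i v(1) by (simp add: A_eq scalar_prod_def row_def atLeast0LessThan)
    finally have "norm ev * norm (v $ i) \<le> (\<Sum>j<n. norm (of_bool (adj G i j) * v $ j))"
      by (metis norm_mult norm_sum)
    also have "\<dots> = (\<Sum>j<n. of_bool (adj G i j) * norm (v $ j))"
      by (intro sum.cong refl) (auto simp: norm_mult)
    finally have "norm ev * norm (v $ i) / sqrt N \<le> (\<Sum>j<n. of_bool (adj G i j) * norm (v $ j)) / sqrt N"
      by (rule divide_right_mono) (use N in simp)
    then show ?thesis unfolding ev(2) x_def by (simp only: sum_divide_distrib times_divide_eq_right)
  qed
  moreover have "x i \<ge> 0" for i using N by (simp add: x_def)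
  ultimately show thesis using that by blast
qed

text \<open>Pairing the subeigenvector inequality with x \<ge> 0 gives the last clause. The
  pointwise inequality is exported as well, since it is what bounds single entries of x
  later.\<close>

lemma spectral_radius_le_quad_form:
  assumes G: "nvertex_graph n G" and n: "n > 0"
  obtains x where "\<And>i. x i \<ge> (0::real)" "(\<Sum>i<n. (x i)\<^sup>2) = 1"
    "\<And>i. i < n \<Longrightarrow> graph_spectral_radius G * x i \<le> (\<Sum>j<n. of_bool (adj G i j) * x j)"
    "graph_spectral_radius G \<le> quad_form {..<n} (adj G) x"
proof -
  obtain x where x: "\<And>i. x i \<ge> (0::real)" "(\<Sum>i<n. (x i)\<^sup>2) = 1"
    "\<And>i. i < n \<Longrightarrow> graph_spectral_radius G * x i \<le> (\<Sum>j<n. of_bool (adj G i j) * x j)"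
    using spectral_radius_subeigenvector[OF G n] by blast
  have "graph_spectral_radius G = (\<Sum>i<n. x i * (graph_spectral_radius G * x i))"
    using x(2) by (simp add: power2_eq_square mult_ac flip: sum_distrib_left)
  also have "\<dots> \<le> (\<Sum>i<n. x i * (\<Sum>j<n. of_bool (adj G i j) * x j))"
    using x by (intro sum_mono mult_left_mono) auto
  also have "\<dots> = quad_form {..<n} (adj G) x"
    unfolding quad_form_def sum_distrib_left by (intro sum.cong refl) (simp add: mult_ac)
  finally show thesis using that x by blast
qed

section \<open>Boxes in dense sets of tuples and few cliques\<close>

text \<open>Erdos's theorem on complete k-partite subhypergraphs, for ordered tuples. In the
  induction step a bounded set S of M popular first coordinates is fixed; many tails extend at least
  t of them, and the pigeonhole principle over the subsets of S yields a t-set T whose common tails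
  are still dense. The sides of the box may overlap; disjointness comes later, from the absence of
  loops.\<close>

lemma dense_lists_contain_box:
  fixes \<epsilon> :: real
  assumes "\<epsilon> > 0"
  shows "\<exists>N. \<forall>(V :: 'a set) R. finite V \<and> card V \<ge> N \<and> R \<subseteq> {xs. set xs \<subseteq> V \<and> length xs = k} \<and>
    real (card R) \<ge> \<epsilon> * real (card V) ^ k \<longrightarrow>
    (\<exists>As. length As = k \<and> (\<forall>A\<in>set As. A \<subseteq> V \<and> card A = t) \<and> listset As \<subseteq> R)"
  using assms
proof (induction k arbitrary: \<epsilon>)
  case 0
  show ?case
  proof (intro exI[of _ 0] allI impI, elim conjE)
    fix V :: "'a set" and R
    assume R: "R \<subseteq> {xs. set xs \<subseteq> V \<and> length xs = 0}" "\<epsilon> * real (card V) ^ 0 \<le> real (card R)"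
    then have "R \<noteq> {}" using 0 by auto
    then have "[] \<in> R" using R by fastforce
    then show "\<exists>As. length As = 0 \<and> (\<forall>A\<in>set As. A \<subseteq> V \<and> card A = t) \<and> listset As \<subseteq> R"
      by (intro exI[of _ "[]"]) auto
  qed
next
  case (Suc k)
  \<comment> \<open>With M \<epsilon> \<ge> 4 t, the tails extending fewer than t elements of S
    account for at most half of the M \<epsilon> n^k / 2 incidences.\<close>
  define M where "M = nat \<lceil>4 * real t / \<epsilon>\<rceil> + 1"
  have M: "real M * \<epsilon> \<ge> 4 * real t" "M > 0"
  proof -
    have "4 * real t / \<epsilon> \<le> real M" unfolding M_def by linarith
    then show "real M * \<epsilon> \<ge> 4 * real t" using Suc.prems by (simp add: field_simps)
  qed (simp add: M_def)
  \<comment> \<open>The good tails have density at least \<epsilon>/4 and are distributed over at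
    most 2^M sets T.\<close>
  define \<epsilon>' where "\<epsilon>' = \<epsilon> / (4 * 2 ^ M)"
  have "\<epsilon>' > 0" using Suc.prems by (simp add: \<epsilon>'_def)
  from Suc.IH[OF this] obtain N where N: "\<forall>(V :: 'a set) R. finite V \<and> card V \<ge> N \<and>
      R \<subseteq> {xs. set xs \<subseteq> V \<and> length xs = k} \<and> real (card R) \<ge> \<epsilon>' * real (card V) ^ k \<longrightarrow>
    (\<exists>As. length As = k \<and> (\<forall>A\<in>set As. A \<subseteq> V \<and> card A = t) \<and> listset As \<subseteq> R)" ..
  \<comment> \<open>The second bound makes \<epsilon> n / 2 exceed M, so that there are M popular
    first coordinates to choose.\<close>
  define N' where "N' = max N (nat \<lceil>2 * real M / \<epsilon>\<rceil> + 1)"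
  show ?case
  proof (intro exI[of _ N'] allI impI, elim conjE)
    fix V :: "'a set" and R
    assume V: "finite V" "N' \<le> card V"
      and R: "R \<subseteq> {xs. set xs \<subseteq> V \<and> length xs = Suc k}" "\<epsilon> * real (card V) ^ Suc k \<le> real (card R)"
    define n where "n = card V"
    define L where "L = {xs. set xs \<subseteq> V \<and> length xs = k}"
    have finL: "finite L" unfolding L_def by (rule finite_lists_length_eq[OF V(1)])
    have cardL: "card L = n ^ k" unfolding L_def n_def by (rule card_lists_length_eq[OF V(1)])
    have n: "n \<ge> N" "2 * real M / \<epsilon> < real n"
    proof -
      show "n \<ge> N" using V(2) by (simp add: N'_def n_def)
      have "nat \<lceil>2 * real M / \<epsilon>\<rceil> + 1 \<le> n" using V(2) by (simp add: N'_def n_def)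
      then show "2 * real M / \<epsilon> < real n" by linarith
    qed
    then have nM: "2 * real M < \<epsilon> * real n" using Suc.prems by (simp add: field_simps)
    define Rx where "Rx x = {\<tau>\<in>L. x # \<tau> \<in> R}" for x
    have Rx_le: "card (Rx x) \<le> n ^ k" for x
      unfolding cardL[symmetric] Rx_def by (rule card_mono[OF finL]) auto
    have "R = (\<Union>x\<in>V. (#) x ` Rx x)"
    proof
      show "R \<subseteq> (\<Union>x\<in>V. (#) x ` Rx x)"
      proof
        fix xs assume xs: "xs \<in> R"
        then obtain x \<tau> where "xs = x # \<tau>" "x \<in> V" "\<tau> \<in> L" using R(1) by (cases xs) (auto simp: L_def)
        then show "xs \<in> (\<Union>x\<in>V. (#) x ` Rx x)" using xs by (auto simp: Rx_def)
      qed
    qed (auto simp: Rx_def)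
    then have "card R \<le> (\<Sum>x\<in>V. card ((#) x ` Rx x))"
      using card_UN_le[OF V(1), of "\<lambda>x. (#) x ` Rx x"] by simp
    also have "\<dots> \<le> (\<Sum>x\<in>V. card (Rx x))"
      using finL by (intro sum_mono card_image_le) (simp add: Rx_def)
    finally have R_le: "real (card R) \<le> (\<Sum>x\<in>V. real (card (Rx x)))"
      by (metis of_nat_le_iff of_nat_sum)
    define B where "B = {x\<in>V. real (card (Rx x)) \<ge> \<epsilon> / 2 * real n ^ k}"
    have B: "finite B" "B \<subseteq> V" using V(1) by (auto simp: B_def)
    have "(\<Sum>x\<in>V. real (card (Rx x))) = (\<Sum>x\<in>B. real (card (Rx x))) + (\<Sum>x\<in>V - B. real (card (Rx x)))"
      by (metis B(2) V(1) add.commute sum.subset_diff)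
    also have "\<dots> \<le> (\<Sum>x\<in>B. real n ^ k) + (\<Sum>x\<in>V - B. \<epsilon> / 2 * real n ^ k)"
      using Rx_le by (intro add_mono sum_mono) (auto simp: B_def simp flip: of_nat_power)
    also have "\<dots> \<le> real (card B) * real n ^ k + real n * (\<epsilon> / 2 * real n ^ k)"
    proof -
      have "card (V - B) \<le> n" unfolding n_def by (rule card_mono[OF V(1)]) auto
      then have "real (card (V - B)) * (\<epsilon> / 2 * real n ^ k) \<le> real n * (\<epsilon> / 2 * real n ^ k)"
        using Suc.prems by (intro mult_right_mono) auto
      then show ?thesis by simp
    qed
    finally have "\<epsilon> * real n ^ Suc k \<le> real (card B) * real n ^ k + real n * (\<epsilon> / 2 * real n ^ k)"
      using R R_le by (simp add: n_def)
    then have "(\<epsilon> / 2 * real n) * real n ^ k \<le> real (card B) * real n ^ k" by (simp add: algebra_simps)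
    moreover have n0: "real n > 0" using nM M Suc.prems
      by (metis less_le_trans mult_zero_right not_le of_nat_0_le_iff of_nat_0_less_iff gr0I of_nat_0
            mult_nonneg_nonneg zero_le_numeral less_irrefl)
    ultimately have "\<epsilon> / 2 * real n \<le> real (card B)" by simp
    then have "M \<le> card B" using nM by linarith
    then obtain S where S: "S \<subseteq> B" "card S = M" by (metis obtain_subset_with_card_n)
    have finS: "finite S" using S B finite_subset by blast
    define Nb where "Nb \<tau> = {x\<in>S. x # \<tau> \<in> R}" for \<tau>
    define good where "good = {\<tau>\<in>L. t \<le> card (Nb \<tau>)}"
    have fing: "finite good" using finL by (simp add: good_def)
    have "real M * (\<epsilon> / 2 * real n ^ k) \<le> (\<Sum>x\<in>S. real (card (Rx x)))"
      using S sum_mono[of S "\<lambda>_. \<epsilon> / 2 * real n ^ k" "\<lambda>x. real (card (Rx x))"] by (auto simp: B_def)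
    also have "\<dots> = (\<Sum>x\<in>S. \<Sum>\<tau>\<in>L. of_bool (x # \<tau> \<in> R))"
      using finL by (simp add: Rx_def Int_def)
    also have "\<dots> = (\<Sum>\<tau>\<in>L. \<Sum>x\<in>S. of_bool (x # \<tau> \<in> R))" by (rule sum.swap)
    also have "\<dots> = (\<Sum>\<tau>\<in>L. real (card (Nb \<tau>)))"
      using finS by (simp add: Nb_def Int_def)
    also have "\<dots> = (\<Sum>\<tau>\<in>good. real (card (Nb \<tau>))) + (\<Sum>\<tau>\<in>L - good. real (card (Nb \<tau>)))"
      by (metis (no_types, lifting) add.commute finL good_def mem_Collect_eq subsetI sum.subset_diff)
    also have "\<dots> \<le> (\<Sum>\<tau>\<in>good. real M) + (\<Sum>\<tau>\<in>L - good. real t)"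
    proof (intro add_mono sum_mono)
      fix \<tau>
      have "card (Nb \<tau>) \<le> card S" unfolding Nb_def by (rule card_mono[OF finS]) auto
      then show "real (card (Nb \<tau>)) \<le> real M" using S by simp
    qed (auto simp: good_def)
    also have "\<dots> \<le> real M * real (card good) + real t * real n ^ k"
    proof -
      have "card (L - good) \<le> n ^ k" unfolding cardL[symmetric] by (rule card_mono[OF finL]) auto
      then have "real (card (L - good)) \<le> real n ^ k" by (metis of_nat_le_iff of_nat_power)
      then have "real t * real (card (L - good)) \<le> real t * real n ^ k" by (intro mult_left_mono) auto
      then show ?thesis by (simp add: mult.commute)
    qed
    finally have "real M * (\<epsilon> / 2 * real n ^ k) \<le> real M * real (card good) + real t * real n ^ k" .
    moreover have "real t * real n ^ k \<le> real M * \<epsilon> / 4 * real n ^ k"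
      using M by (intro mult_right_mono) auto
    ultimately have "real M * (\<epsilon> / 4 * real n ^ k) \<le> real M * real (card good)" by (simp add: algebra_simps)
    then have good_ge: "\<epsilon> / 4 * real n ^ k \<le> real (card good)" using M by simp
    define RT where "RT T = {\<tau>\<in>L. \<forall>x\<in>T. x # \<tau> \<in> R}" for T
    define \<T> where "\<T> = {T. T \<subseteq> S \<and> card T = t}"
    have fT: "finite \<T>" "card \<T> \<le> 2 ^ M"
    proof -
      have "\<T> \<subseteq> Pow S" by (auto simp: \<T>_def)
      then show "finite \<T>" "card \<T> \<le> 2 ^ M"
        using finS S card_mono[of "Pow S" \<T>] by (auto simp: card_Pow finite_subset)
    qed
    have "good \<subseteq> (\<Union>T\<in>\<T>. RT T)"
    proof
      fix \<tau> assume "\<tau> \<in> good"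
      then have "\<tau> \<in> L" "t \<le> card (Nb \<tau>)" by (auto simp: good_def)
      then obtain T where "T \<subseteq> Nb \<tau>" "card T = t" by (metis obtain_subset_with_card_n)
      then show "\<tau> \<in> (\<Union>T\<in>\<T>. RT T)" using \<open>\<tau> \<in> L\<close> by (auto simp: \<T>_def RT_def Nb_def)
    qed
    then have "card good \<le> card (\<Union>T\<in>\<T>. RT T)"
      using fT finL by (intro card_mono) (auto simp: RT_def)
    also have "\<dots> \<le> (\<Sum>T\<in>\<T>. card (RT T))" by (rule card_UN_le[OF fT(1)])
    finally have good_le: "real (card good) \<le> (\<Sum>T\<in>\<T>. real (card (RT T)))"
      by (metis of_nat_le_iff of_nat_sum)
    have "\<exists>T\<in>\<T>. \<epsilon>' * real n ^ k \<le> real (card (RT T))"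
    proof (rule ccontr)
      assume "\<not> ?thesis"
      then have less: "\<And>T. T \<in> \<T> \<Longrightarrow> real (card (RT T)) < \<epsilon>' * real n ^ k" by force
      have pos: "\<epsilon> / 4 * real n ^ k > 0" using Suc.prems n0 by simp
      then have "\<T> \<noteq> {}" using good_ge good_le by auto
      then have "(\<Sum>T\<in>\<T>. real (card (RT T))) < (\<Sum>T\<in>\<T>. \<epsilon>' * real n ^ k)"
        using less fT by (intro sum_strict_mono) auto
      also have "\<dots> = real (card \<T>) * (\<epsilon>' * real n ^ k)" by simp
      also have "\<dots> \<le> 2 ^ M * (\<epsilon>' * real n ^ k)"
        using fT(2) \<open>\<epsilon>' > 0\<close> by (intro mult_right_mono) (auto simp flip: of_nat_le_iff)
      also have "\<dots> = \<epsilon> / 4 * real n ^ k" by (simp add: \<epsilon>'_def)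
      finally show False using good_ge good_le by linarith
    qed
    then obtain T where T: "T \<subseteq> S" "card T = t" "\<epsilon>' * real n ^ k \<le> real (card (RT T))"
      by (auto simp: \<T>_def)
    have "RT T \<subseteq> {xs. set xs \<subseteq> V \<and> length xs = k}" by (auto simp: RT_def L_def)
    with V(1) n(1) T(3) have "\<exists>As. length As = k \<and> (\<forall>A\<in>set As. A \<subseteq> V \<and> card A = t) \<and> listset As \<subseteq> RT T"
      by (intro N[rule_format]) (simp add: n_def)
    then obtain As where
      As: "length As = k" "\<forall>A\<in>set As. A \<subseteq> V \<and> card A = t" "listset As \<subseteq> RT T"
      by blast
    show "\<exists>As. length As = Suc k \<and> (\<forall>A\<in>set As. A \<subseteq> V \<and> card A = t) \<and> listset As \<subseteq> R"
      using As T S B by (intro exI[of _ "T # As"]) (auto simp: set_Cons_def RT_def)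
  qed
qed

text \<open>Ordered cliques: for an irreflexive relation the entries are distinct. Lists match the
  box lemma and turn greedy extension into consing.\<close>

definition clique_lists :: "('a \<Rightarrow> 'a \<Rightarrow> bool) \<Rightarrow> 'a set \<Rightarrow> nat \<Rightarrow> 'a list set" where
  "clique_lists E V k = {xs. set xs \<subseteq> V \<and> length xs = k \<and> sorted_wrt E xs}"

lemma finite_clique_lists: "finite V \<Longrightarrow> finite (clique_lists E V k)"
  unfolding clique_lists_def
  by (rule finite_subset[OF _ finite_lists_length_eq[of V k]]) auto

lemma card_clique_lists_ge:
  fixes m :: real
  assumes V: "finite V" and m: "m \<ge> 0"
    and ext: "\<And>s xs. s < k \<Longrightarrow> xs \<in> clique_lists E V s \<Longrightarrow> m \<le> real (card {v\<in>V. \<forall>x\<in>set xs. E v x})"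
  shows "m ^ k \<le> real (card (clique_lists E V k))"
  using ext
proof (induction k)
  case 0
  have "clique_lists E V 0 = {[]}" by (auto simp: clique_lists_def)
  then show ?case by simp
next
  case (Suc k)
  let ?X = "\<lambda>xs. {v\<in>V. \<forall>x\<in>set xs. E v x}"
  have eq: "clique_lists E V (Suc k) = (\<lambda>(xs, v). v # xs) ` (SIGMA xs : clique_lists E V k. ?X xs)" (is "?L = ?R")
  proof
    show "?L \<subseteq> ?R"
    proof
      fix ys assume ys: "ys \<in> ?L"
      then obtain v xs where "ys = v # xs" by (cases ys) (auto simp: clique_lists_def)
      then show "ys \<in> ?R" using ys by (auto simp: clique_lists_def image_iff)
    qed
  qed (auto simp: clique_lists_def)
  have "m ^ Suc k = m ^ k * m" by simp
  also have "\<dots> \<le> real (card (clique_lists E V k)) * m"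
    using Suc.IH Suc.prems m by (intro mult_right_mono) (metis less_SucI)+
  also have "\<dots> \<le> (\<Sum>xs\<in>clique_lists E V k. real (card (?X xs)))"
    using Suc.prems[of k] sum_mono[of "clique_lists E V k" "\<lambda>_. m"] by simp
  also have "\<dots> = real (card (SIGMA xs : clique_lists E V k. ?X xs))"
    using finite_clique_lists[OF V] V by (subst card_SigmaI) auto
  also have "\<dots> = real (card ?L)"
    unfolding eq by (subst card_image) (auto simp: inj_on_def)
  finally show ?case .
qed

section \<open>Colourings of F and copies of F in boxes of cliques\<close>

lemma ex_proper_colouring:
  assumes "simple_graph F"
  shows "\<exists>c. proper_colouring F (chromatic_number F) c"
proof -
  have fin: "finite (verts F)" using assms by (simp add: simple_graph_def)
  obtain f where f: "inj_on f (verts F)" "f ` verts F = {..<card (verts F)}"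
    using ex_bij_betw_finite_nat[OF fin] by (auto simp: bij_betw_def atLeast0LessThan)
  have "proper_colouring F (card (verts F)) f"
    unfolding proper_colouring_def
  proof (intro conjI allI impI)
    fix x y assume "{x, y} \<in> edges F"
    then have "{x, y} \<subseteq> verts F" "card {x, y} = 2" using assms by (auto simp: simple_graph_def)
    then have "x \<in> verts F" "y \<in> verts F" "x \<noteq> y" by auto
    then show "f x \<noteq> f y" by (simp add: inj_on_eq_iff[OF f(1)])
  qed (rule eq_refl[OF f(2)])
  then have "\<exists>c. proper_colouring F (card (verts F)) c" by blast
  \<comment> \<open>An injective numbering of the vertices is a proper colouring, so the
    \<open>LEAST\<close> in \<open>chromatic_number\<close> is attained.\<close>
  then show ?thesis
    unfolding chromatic_number_def by (rule LeastI[of "\<lambda>k. \<exists>c. proper_colouring F k c"])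
qed

lemma chromatic_number_le: "proper_colouring F k c \<Longrightarrow> chromatic_number F \<le> k"
  unfolding chromatic_number_def by (rule Least_le[of "\<lambda>k. \<exists>c. proper_colouring F k c"]) blast

lemma list_all2_in_listset: "list_all2 (\<in>) xs As \<Longrightarrow> xs \<in> listset As"
  by (induction rule: list_all2_induct) (auto simp: set_Cons_def)

text \<open>The box is a blow-up of a complete graph on k vertices: colour class i of F goes
  injectively into side i, and vertices of different sides are adjacent.\<close>

lemma contains_copy_if_box:
  assumes F: "simple_graph F" "chromatic_number F = k"
    and As: "length As = k" "\<And>A. A \<in> set As \<Longrightarrow> A \<subseteq> verts G \<and> card A = Suc (card (verts F))"
      "listset As \<subseteq> clique_lists (adj G) V k"
    and G: "\<And>v. {v} \<notin> edges G"
  shows "contains_copy G F"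
proof -
  have fin: "finite (verts F)" using F by (simp add: simple_graph_def)
  obtain c where c: "proper_colouring F k c" using ex_proper_colouring F by metis
  have Aprop: "As ! i \<subseteq> verts G" "card (As ! i) = Suc (card (verts F))" if "i < k" for i
    using As(1,2) that by auto
  \<comment> \<open>Representatives for the coordinates that do not matter. The \<open>Suc\<close>
    in the size of the sides makes them nonempty even if F has no vertices.\<close>
  define p where "p i = (SOME x. x \<in> As ! i)" for i
  have p: "p i \<in> As ! i" if "i < k" for i
    unfolding p_def using Aprop(2)[OF that] by (metis card.empty nat.simps(3) some_in_eq)
  have adj: "adj G x y" if "i < j" "j < k" "x \<in> As ! i" "y \<in> As ! j" for i j x y
  proof -
    define xs where "xs = (map p [0..<k])[i := x, j := y]"
    have "xs \<in> listset As"
      using that p As(1) by (intro list_all2_in_listset) (auto simp: xs_def list_all2_conv_all_nth nth_list_update)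
    then have "sorted_wrt (adj G) xs" using As(3) by (auto simp: clique_lists_def)
    then have "{xs ! i, xs ! j} \<in> edges G"
      using that by (intro sorted_wrt_nth_less[of "adj G" xs]) (simp_all add: xs_def)
    then show ?thesis using that by (simp add: xs_def)
  qed
  have adj': "adj G x y" if "i \<noteq> j" "i < k" "j < k" "x \<in> As ! i" "y \<in> As ! j" for i j x y
    using that adj[of i j x y] adj[of j i y x] by (cases "i < j") (auto simp: insert_commute)
  have "\<exists>g. inj_on g (verts F) \<and> g ` verts F \<subseteq> As ! i" if "i < k" for i
  proof -
    have "finite (As ! i)" "card (verts F) \<le> card (As ! i)"
      using Aprop(2)[OF that] by (auto intro: card_ge_0_finite)
    then show ?thesis using card_le_inj[OF fin] by blast
  qed
  then obtain g where g: "\<And>i. i < k \<Longrightarrow> inj_on (g i) (verts F) \<and> g i ` verts F \<subseteq> As ! i" by metis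
  define f where "f v = g (c v) v" for v
  have ck: "c v < k" if "v \<in> verts F" for v using c that by (auto simp: proper_colouring_def)
  have fA: "f v \<in> As ! (c v)" if "v \<in> verts F" for v
    using g[OF ck[OF that]] that by (auto simp: f_def)
  have "inj_on f (verts F)"
  proof (rule inj_onI)
    fix u v assume uv: "u \<in> verts F" "v \<in> verts F" "f u = f v"
    have "c u = c v"
    proof (rule ccontr)
      assume "c u \<noteq> c v"
      \<comment> \<open>Two colours sharing an image would put a loop at \<open>f v\<close>.\<close>
      from adj'[OF this ck ck fA fA] uv G[of "f v"] show False by simp
    qed
    then show "u = v" using uv g[OF ck[OF uv(1)]] by (auto simp: f_def dest: inj_onD)
  qed
  moreover have "f ` verts F \<subseteq> verts G" using fA Aprop(1) ck by blast
  moreover have "f ` e \<in> edges G" if e: "e \<in> edges F" for e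
  proof -
    have "e \<subseteq> verts F" "card e = 2" using e F by (auto simp: simple_graph_def)
    then obtain u v where uv: "e = {u, v}" "u \<in> verts F" "v \<in> verts F" by (auto simp: card_2_iff)
    then have "c u \<noteq> c v" using c e by (auto simp: proper_colouring_def)
    from adj'[OF this ck ck fA fA] uv show ?thesis by simp
  qed
  ultimately show ?thesis unfolding contains_copy_def by blast
qed

lemma few_cliques:
  fixes F :: "'f graph"
  assumes F: "simple_graph F" "chromatic_number F = k" and \<beta>: "\<beta> > (0::real)"
  shows "\<exists>N. \<forall>n\<ge>N. \<forall>G. nvertex_graph n G \<and> free_of F G \<longrightarrow>
    real (card (clique_lists (adj G) {..<n} k)) < \<beta> * real n ^ k"
proof -
  obtain N where N: "\<forall>(V :: nat set) R. finite V \<and> card V \<ge> N \<and> R \<subseteq> {xs. set xs \<subseteq> V \<and> length xs = k} \<and>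
    real (card R) \<ge> \<beta> * real (card V) ^ k \<longrightarrow>
    (\<exists>As. length As = k \<and> (\<forall>A\<in>set As. A \<subseteq> V \<and> card A = Suc (card (verts F))) \<and> listset As \<subseteq> R)"
    using dense_lists_contain_box[OF \<beta>, of k "Suc (card (verts F))"] ..
  show ?thesis
  proof (intro exI[of _ N] allI impI, elim conjE, rule ccontr)
    fix n and G :: "nat graph"
    let ?R = "clique_lists (adj G) {..<n} k"
    assume n: "N \<le> n" and G: "nvertex_graph n G" "free_of F G"
      and c: "\<not> real (card ?R) < \<beta> * real n ^ k"
    have "?R \<subseteq> {xs. set xs \<subseteq> {..<n} \<and> length xs = k}" by (auto simp: clique_lists_def)
    with n c have "\<exists>As. length As = k \<and> (\<forall>A\<in>set As. A \<subseteq> {..<n} \<and> card A = Suc (card (verts F))) \<and> listset As \<subseteq> ?R"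
      by (intro N[rule_format]) simp
    then obtain As where As: "length As = k" "\<forall>A\<in>set As. A \<subseteq> {..<n} \<and> card A = Suc (card (verts F))"
      "listset As \<subseteq> ?R" by blast
    have v: "verts G = {..<n}" using G by (simp add: nvertex_graph_def)
    have "{v} \<notin> edges G" for v using G by (fastforce simp: nvertex_graph_def simple_graph_def)
    with As F v have "contains_copy G F" by (intro contains_copy_if_box[where As = As]) auto
    then show False using G by (simp add: free_of_def)
  qed
qed

section \<open>Weighted Erdos-Stone theorem\<close>

text \<open>By symmetry the row and the column of i contribute equally, and without a loop the sum
  may still run over all of S. Used to compare a maximising set with the same set minus one
  vertex.\<close>

lemma quad_form_remove:
  assumes S: "finite S" "i \<in> S" and sym: "\<And>u v. E u v \<Longrightarrow> E v u" and irr: "\<not> E i i"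
  shows "quad_form S E y = quad_form (S - {i}) E y + 2 * y i * (\<Sum>v\<in>S. of_bool (E i v) * y v)"
proof -
  let ?a = "\<lambda>u v. of_bool (E u v) * y u * y v"
  have a_sym: "?a u v = ?a v u" for u v using sym[of u v] sym[of v u] by auto
  have "quad_form S E y = (\<Sum>u\<in>S. ?a u i + (\<Sum>v\<in>S - {i}. ?a u v))"
    unfolding quad_form_def by (intro sum.cong refl sum.remove S)
  also have "\<dots> = (\<Sum>u\<in>S. ?a u i) + (\<Sum>u\<in>S. \<Sum>v\<in>S - {i}. ?a u v)"
    by (rule sum.distrib)
  also have "(\<Sum>u\<in>S. \<Sum>v\<in>S - {i}. ?a u v) = (\<Sum>v\<in>S - {i}. ?a i v) + quad_form (S - {i}) E y"
    unfolding quad_form_def by (rule sum.remove[OF S])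
  also have "(\<Sum>v\<in>S - {i}. ?a i v) = (\<Sum>v\<in>S. ?a i v)"
    using sum.remove[OF S, of "?a i"] irr by simp
  also have "(\<Sum>u\<in>S. ?a u i) = (\<Sum>v\<in>S. ?a i v)" by (intro sum.cong refl a_sym)
  also have "(\<Sum>v\<in>S. ?a i v) = y i * (\<Sum>v\<in>S. of_bool (E i v) * y v)"
    unfolding sum_distrib_left by (intro sum.cong refl) (simp only: mult_ac)
  finally show ?thesis by (simp only: mult_2 distrib_right add_ac)
qed

lemma quad_form_le_sum_sq:
  assumes "\<And>v. v \<in> S \<Longrightarrow> 0 \<le> y v"
  shows "quad_form S E y \<le> (sum y S)\<^sup>2"
proof -
  have "quad_form S E y \<le> (\<Sum>u\<in>S. \<Sum>v\<in>S. y u * y v)"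
    unfolding quad_form_def by (intro sum_mono) (auto simp: assms)
  also have "\<dots> = (sum y S)\<^sup>2" by (simp add: power2_eq_square sum_product)
  finally show ?thesis .
qed

text \<open>A set \<open>S\<close> maximising \<open>quad_form S E y - c (y(S))\<^sup>2\<close> has no vertex of small relative degree,
  so cliques in \<open>S\<close> can be built greedily.\<close>

lemma many_cliques_if_dense:
  fixes y :: "'a \<Rightarrow> real"
  assumes V: "finite V" and sym: "\<And>u v. E u v \<Longrightarrow> E v u" and irr: "\<And>u. \<not> E u u"
    and y: "\<And>v. v \<in> V \<Longrightarrow> 0 \<le> y v" "\<And>v. v \<in> V \<Longrightarrow> y v \<le> w" "sum y V = 1"
    and r: "r \<ge> 1" and \<delta>: "\<delta> > 0" and w: "w > 0" "w \<le> \<delta>\<^sup>2 / 8"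
    and dense: "quad_form V E y \<ge> 1 - 1 / real r + \<delta>"
  shows "(real r * \<delta>\<^sup>2 / (8 * w)) ^ (r + 1) \<le> real (card (clique_lists E V (r + 1)))"
proof -
  \<comment> \<open>Half of the surplus \<delta> is kept back: then f(V) \<ge> \<delta>/2, which
    forces the maximiser to carry weight at least \<delta>/2, while r (1 - c) stays below 1 by r
    \<delta>/2.\<close>
  define c where "c = 1 - 1 / real r + \<delta> / 2"
  define f where "f S = quad_form S E y - c * (sum y S)\<^sup>2" for S
  have "Max (f ` Pow V) \<in> f ` Pow V" using V by (intro Max_in) auto
  then obtain S where S: "S \<subseteq> V" "f S = Max (f ` Pow V)" by auto
  have fmax: "f T \<le> f S" if "T \<subseteq> V" for T using V that by (auto simp: S intro!: Max_ge)
  have finS: "finite S" using S V finite_subset by blast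
  have yS: "0 \<le> y v" "y v \<le> w" if "v \<in> S" for v using y S that by auto
  define s where "s = sum y S"
  have s0: "0 \<le> s" using yS by (auto simp: s_def intro: sum_nonneg)
  have s1: "s \<le> 1" using y(1) S V by (auto simp: s_def y(3)[symmetric] intro!: sum_mono2)
  have "quad_form V E y \<le> 1" using quad_form_le_sum_sq[of V y E] y by simp
  then have \<delta>r: "\<delta> \<le> 1 / real r" using dense by simp
  have "1 / real r \<le> 1" using r by simp
  then have c0: "0 \<le> c" using \<delta> unfolding c_def by linarith
  have c1: "c \<le> 1" using \<delta>r \<delta> by (simp add: c_def)
  have "\<delta> / 2 \<le> f V" using dense by (simp add: f_def c_def y(3))
  also have "\<dots> \<le> f S" using fmax by simp
  also have "\<dots> \<le> s\<^sup>2 - c * s\<^sup>2" using quad_form_le_sum_sq[OF yS(1)] by (simp add: f_def s_def)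
  also have "\<dots> \<le> s\<^sup>2" using c0 by simp
  also have "\<dots> \<le> s" using s0 s1 by (simp add: power2_eq_square mult_left_le)
  finally have s\<delta>: "\<delta> / 2 \<le> s" .
  define d where "d i = (\<Sum>v\<in>S. of_bool (E i v) * y v)" for i
  have deg: "c * s - w \<le> d i" if i: "i \<in> S" "y i > 0" for i
  proof -
    have "f (S - {i}) \<le> f S" using fmax S by blast
    moreover have "sum y (S - {i}) = s - y i" using finS i by (simp add: s_def sum_diff1)
    ultimately have "c * (s\<^sup>2 - (s - y i)\<^sup>2) \<le> 2 * y i * d i"
      using quad_form_remove[of S i E y, OF finS i(1) sym irr] by (simp add: f_def d_def s_def algebra_simps)
    also have "c * (s\<^sup>2 - (s - y i)\<^sup>2) = y i * (c * (2 * s - y i))"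
      by (simp add: power2_eq_square algebra_simps)
    finally have "c * (2 * s - y i) \<le> 2 * d i" using i(2) by (simp add: mult.assoc mult.left_commute[of 2])
    moreover have "c * y i \<le> w" using c0 c1 yS[OF i(1)] by (meson mult_left_le_one_le order_trans)
    ultimately show ?thesis using w by (simp add: algebra_simps)
  qed
  \<comment> \<open>The degree bound needs positive weight; dropping the vertices of weight 0 does
    not change s.\<close>
  define S' where "S' = {i\<in>S. y i > 0}"
  have S': "finite S'" "S' \<subseteq> S" using finS by (auto simp: S'_def)
  have sS': "sum y S' = s"
    unfolding s_def using finS yS(1) by (intro sum.mono_neutral_left) (force simp: S'_def)+
  have "(real r * \<delta>\<^sup>2 / (8 * w)) ^ (r + 1) \<le> real (card (clique_lists E S' (r + 1)))"
  proof (rule card_clique_lists_ge[OF S'(1)])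
    fix t xs assume t: "t < r + 1" "xs \<in> clique_lists E S' t"
    define X where "X = {v\<in>S'. \<forall>x\<in>set xs. E v x}"
    have fX: "finite X" "X \<subseteq> S'" using S' by (auto simp: X_def)
    \<comment> \<open>Union bound by weight: each of the at most r vertices of \<open>xs\<close>
      misses weight at most (1 - c) s + w. Together they leave weight at least r \<delta>^2 / 8 in
      X, hence at least r \<delta>^2 / (8 w) vertices.\<close>
    have "sum y (S' - X) \<le> (\<Sum>v\<in>S' - X. \<Sum>x\<in>set xs. of_bool (\<not> E v x) * y v)"
    proof (rule sum_mono)
      fix v assume v: "v \<in> S' - X"
      then obtain x where x: "x \<in> set xs" "\<not> E v x" by (auto simp: X_def)
      have yv: "0 \<le> y v" using v S' yS(1) by auto
      have "y v = of_bool (\<not> E v x) * y v" using x by simp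
      also have "\<dots> \<le> (\<Sum>x\<in>set xs. of_bool (\<not> E v x) * y v)"
        using x(1) yv by (intro member_le_sum) (auto simp del: sum_of_bool_mult_eq)
      finally show "y v \<le> (\<Sum>x\<in>set xs. of_bool (\<not> E v x) * y v)" .
    qed
    also have "\<dots> \<le> (\<Sum>v\<in>S'. \<Sum>x\<in>set xs. of_bool (\<not> E v x) * y v)"
      using S' yS(1) by (intro sum_mono2 sum_nonneg mult_nonneg_nonneg) auto
    also have "\<dots> = (\<Sum>x\<in>set xs. \<Sum>v\<in>S'. of_bool (\<not> E v x) * y v)" by (rule sum.swap)
    also have "\<dots> \<le> (\<Sum>x\<in>set xs. (1 - c) * s + w)"
    proof (rule sum_mono)
      fix x assume "x \<in> set xs"
      then have x: "x \<in> S" "y x > 0" using t by (auto simp: clique_lists_def S'_def)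
      have "(\<Sum>v\<in>S'. of_bool (\<not> E v x) * y v) \<le> (\<Sum>v\<in>S. of_bool (\<not> E v x) * y v)"
        using finS S' yS(1) by (intro sum_mono2 mult_nonneg_nonneg) auto
      also have "\<dots> = s - d x"
        unfolding s_def d_def sum_subtractf[symmetric] by (intro sum.cong) (auto dest: sym)
      finally show "(\<Sum>v\<in>S'. of_bool (\<not> E v x) * y v) \<le> (1 - c) * s + w"
        using deg[OF x] by (simp add: algebra_simps)
    qed
    also have "\<dots> \<le> real r * ((1 - c) * s + w)"
    proof -
      have "card (set xs) \<le> r" using t card_length[of xs] by (auto simp: clique_lists_def)
      moreover have "0 \<le> (1 - c) * s + w" using c1 s0 w by simp
      ultimately show ?thesis by (simp add: mult_right_mono)
    qed
    finally have "s - sum y X \<le> real r * ((1 - c) * s + w)"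
      using S' fX by (simp add: sum_diff sS')
    moreover have "real r * (1 - c) = 1 - real r * \<delta> / 2" using r by (simp add: c_def field_simps)
    then have "real r * ((1 - c) * s + w) = (1 - real r * \<delta> / 2) * s + real r * w"
      by (simp add: distrib_left flip: mult.assoc)
    ultimately have "real r * \<delta> / 2 * s - real r * w \<le> sum y X" by (simp add: algebra_simps)
    moreover have "real r * \<delta> / 2 * (\<delta> / 2) \<le> real r * \<delta> / 2 * s"
      using s\<delta> \<delta> by (intro mult_left_mono) auto
    moreover have "real r * w \<le> real r * (\<delta>\<^sup>2 / 8)" using w by (intro mult_left_mono) auto
    ultimately have "real r * \<delta>\<^sup>2 / 8 \<le> sum y X"
      by (simp add: power2_eq_square mult_ac)
    also have "\<dots> \<le> real (card X) * w"
      using sum_mono[of X y "\<lambda>_. w"] yS(2) fX S' by auto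
    finally show "real r * \<delta>\<^sup>2 / (8 * w) \<le> real (card {v\<in>S'. \<forall>x\<in>set xs. E v x})"
      using w by (simp add: X_def field_simps)
  qed (use w in simp)
  also have "\<dots> \<le> real (card (clique_lists E V (r + 1)))"
    using S S' finite_clique_lists[OF V] by (auto simp: clique_lists_def intro!: card_mono)
  finally show ?thesis .
qed

lemma quad_form_scale: "quad_form V E (\<lambda>v. a * y v) = a\<^sup>2 * quad_form V E y"
  by (simp only: quad_form_def sum_distrib_left power2_eq_square mult_ac)

text \<open>Motzkin-Straus up to \<delta>, stated homogeneously so that callers need not normalise
  y. The spread condition says that no vertex exceeds C/n of the total weight, which is the w of
  \<open>many_cliques_if_dense\<close>.\<close>

lemma weighted_erdos_stone:
  fixes F :: "'f graph"
  assumes F: "simple_graph F" "chromatic_number F = r + 1" and r: "r \<ge> 1" and \<delta>: "\<delta> > 0" and C: "C > 0"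
  shows "\<exists>N. \<forall>n\<ge>N. \<forall>G y. nvertex_graph n G \<and> free_of F G \<and>
      (\<forall>v<n. 0 \<le> y v \<and> real n * y v \<le> C * sum y {..<n}) \<longrightarrow>
      quad_form {..<n} (adj G) y \<le> (1 - 1 / real r + \<delta>) * (sum y {..<n})\<^sup>2"
proof -
  \<comment> \<open>Exactly the clique density that \<open>many_cliques_if_dense\<close> produces
    for w = C/n, so that it contradicts \<open>few_cliques\<close>.\<close>
  define \<beta> where "\<beta> = (real r * \<delta>\<^sup>2 / (8 * C)) ^ (r + 1)"
  have "\<beta> > 0" using r \<delta> C by (simp add: \<beta>_def)
  then obtain N where N: "\<And>n G. n \<ge> N \<Longrightarrow> nvertex_graph n G \<Longrightarrow> free_of F G \<Longrightarrow>
    real (card (clique_lists (adj G) {..<n} (r + 1))) < \<beta> * real n ^ (r + 1)"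
    using few_cliques[OF F] by blast
  define N' where "N' = max N (nat \<lceil>8 * C / \<delta>\<^sup>2\<rceil> + 1)"
  show ?thesis
  proof (intro exI[of _ N'] allI impI, elim conjE, rule ccontr)
    fix n and G :: "nat graph" and y
    assume n: "N' \<le> n" and G: "nvertex_graph n G" "free_of F G"
      and y: "\<forall>v<n. 0 \<le> y v \<and> real n * y v \<le> C * sum y {..<n}"
      and dense: "\<not> quad_form {..<n} (adj G) y \<le> (1 - 1 / real r + \<delta>) * (sum y {..<n})\<^sup>2"
    define Y where "Y = sum y {..<n}"
    have "nat \<lceil>8 * C / \<delta>\<^sup>2\<rceil> + 1 \<le> n" "N \<le> n" using n by (auto simp: N'_def)
    then have nC: "8 * C / \<delta>\<^sup>2 \<le> real n" and n0: "n > 0" by linarith+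
    have "Y \<ge> 0" using y by (auto simp: Y_def intro: sum_nonneg)
    moreover have "Y \<noteq> 0"
    proof
      assume "Y = 0"
      then have "y v = 0" if "v < n" for v
        using y that n0 by (metis Y_def lessThan_iff finite_lessThan sum_nonneg_eq_0_iff)
      then show False using dense \<open>Y = 0\<close> by (simp add: quad_form_def Y_def)
    qed
    ultimately have Y: "Y > 0" by simp
    have "(real r * \<delta>\<^sup>2 / (8 * (C / real n))) ^ (r + 1) \<le> real (card (clique_lists (adj G) {..<n} (r + 1)))"
    proof (rule many_cliques_if_dense[where y = "\<lambda>v. (1 / Y) * y v"])
      show "(\<Sum>v<n. 1 / Y * y v) = 1" using Y by (simp add: Y_def flip: sum_divide_distrib)
      show "1 - 1 / real r + \<delta> \<le> quad_form {..<n} (adj G) (\<lambda>v. 1 / Y * y v)"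
        unfolding quad_form_scale using dense Y by (simp add: Y_def[symmetric] field_simps)
      show "C / real n \<le> \<delta>\<^sup>2 / 8" using nC n0 \<delta> by (simp add: field_simps)
      show "0 \<le> 1 / Y * y v" if "v \<in> {..<n}" for v using y that Y by simp
      show "1 / Y * y v \<le> C / real n" if "v \<in> {..<n}" for v
        using y that Y n0 by (auto simp: Y_def[symmetric] field_simps)
      show "\<not> adj G u u" for u using nvertexD(4)[OF G(1), of u u] by blast
      show "adj G v u" if "adj G u v" for u v using that by (simp only: insert_commute)
    qed (use n0 C r \<delta> in auto)
    also have "\<dots> < \<beta> * real n ^ (r + 1)" using N[OF \<open>N \<le> n\<close> G] .
    also have "\<dots> = (real r * \<delta>\<^sup>2 / (8 * (C / real n))) ^ (r + 1)"
      unfolding \<beta>_def power_mult_distrib[symmetric] using n0 C by simp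
    finally show False by simp
  qed
qed

section \<open>Edges and spectral radius of \<open>F\<close>-free graphs\<close>

lemma quad_form_one:
  assumes G: "nvertex_graph n G"
  shows "quad_form {..<n} (adj G) (\<lambda>_. 1) = 2 * real (num_edges G)"
proof -
  let ?B = "\<lambda>e. {p. {fst p, snd p} = e}"
  have B: "finite (?B e) \<and> card (?B e) = 2" if e: "e \<in> edges G" for e
  proof -
    obtain a b where ab: "e = {a, b}" "a \<noteq> b" using nvertexD(3)[OF G e] by (auto simp: card_2_iff)
    then have "?B e = {(a, b), (b, a)}" by (auto simp: doubleton_eq_iff)
    then show ?thesis using ab by simp
  qed
  have "quad_form {..<n} (adj G) (\<lambda>_. 1) = (\<Sum>p\<in>{..<n} \<times> {..<n}. of_bool (adj G (fst p) (snd p)))"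
    unfolding quad_form_def by (simp add: sum.cartesian_product case_prod_beta del: sum_of_bool_eq)
  also have "\<dots> = real (card ({..<n} \<times> {..<n} \<inter> {p. adj G (fst p) (snd p)}))"
    by simp
  also have "{..<n} \<times> {..<n} \<inter> {p. adj G (fst p) (snd p)} = (\<Union>e\<in>edges G. ?B e)"
    using nvertexD(4)[OF G] by auto
  also have "card \<dots> = (\<Sum>e\<in>edges G. card (?B e))"
    using B nvertexD(2)[OF G] by (intro card_UN_disjoint) auto
  also have "\<dots> = 2 * num_edges G" using B by (simp add: num_edges_def)
  finally show ?thesis by simp
qed

lemma edges_upper:
  fixes F :: "'f graph"
  assumes F: "simple_graph F" "chromatic_number F = r + 1" and r: "r \<ge> 1" and \<delta>: "\<delta> > 0"
  shows "\<exists>N. \<forall>n\<ge>N. \<forall>G. nvertex_graph n G \<and> free_of F G \<longrightarrow>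
      2 * real (num_edges G) \<le> (1 - 1 / real r + \<delta>) * real n ^ 2"
proof -
  obtain N where N: "\<forall>n\<ge>N. \<forall>G y. nvertex_graph n G \<and> free_of F G \<and>
      (\<forall>v<n. 0 \<le> y v \<and> real n * y v \<le> 1 * sum y {..<n}) \<longrightarrow>
      quad_form {..<n} (adj G) y \<le> (1 - 1 / real r + \<delta>) * (sum y {..<n})\<^sup>2"
    using weighted_erdos_stone[OF F r \<delta>, of 1] by auto
  have "2 * real (num_edges G) \<le> (1 - 1 / real r + \<delta>) * real n ^ 2"
    if "N \<le> n" "nvertex_graph n G" "free_of F G" for n G
    using N[rule_format, OF that(1), of G "\<lambda>_. 1"] that by (simp add: quad_form_one)
  then show ?thesis by blast
qed

text \<open>Weighting the vertices by \<open>x\<^sup>2\<close> and applying Cauchy-Schwarz bounds the spectral radius by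
  the number of edges; the eigenvector is spread out enough as soon as the spectral radius is
  linear in \<open>n\<close>.\<close>

lemma spectral_radius_sq_le_edges:
  fixes F :: "'f graph"
  assumes F: "simple_graph F" "chromatic_number F = r + 1" and r: "r \<ge> 1" and \<delta>: "\<delta> > 0"
  shows "\<exists>N. \<forall>n\<ge>N. \<forall>G. nvertex_graph n G \<and> free_of F G \<longrightarrow>
      graph_spectral_radius G \<le> \<delta> * real n \<or>
      (graph_spectral_radius G)\<^sup>2 \<le> (1 - 1 / real r + \<delta>) * (2 * real (num_edges G))"
proof -
  \<comment> \<open>The spread constant for the weights x_i^2: n x_i^2 \<le> n^2 / \<rho>^2 \<le>
    1/\<delta>^2 once \<rho> > \<delta> n.\<close>
  have "1 / \<delta>\<^sup>2 > 0" using \<delta> by simp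
  from weighted_erdos_stone[OF F r \<delta> this]
  obtain N where N: "\<forall>n\<ge>N. \<forall>G y. nvertex_graph n G \<and> free_of F G \<and>
      (\<forall>v<n. 0 \<le> y v \<and> real n * y v \<le> 1 / \<delta>\<^sup>2 * sum y {..<n}) \<longrightarrow>
      quad_form {..<n} (adj G) y \<le> (1 - 1 / real r + \<delta>) * (sum y {..<n})\<^sup>2" ..
  show ?thesis
  proof (intro exI[of _ "max N 1"] allI impI, elim conjE)
    fix n and G :: "nat graph"
    assume n: "max N 1 \<le> n" and G: "nvertex_graph n G" "free_of F G"
    then have n0: "n > 0" "N \<le> n" by auto
    define \<rho> where "\<rho> = graph_spectral_radius G"
    obtain x where x: "\<And>i. x i \<ge> (0::real)" "(\<Sum>i<n. (x i)\<^sup>2) = 1"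
      "\<And>i. i < n \<Longrightarrow> \<rho> * x i \<le> (\<Sum>j<n. of_bool (adj G i j) * x j)"
      "\<rho> \<le> quad_form {..<n} (adj G) x"
      unfolding \<rho>_def using spectral_radius_le_quad_form[OF G(1) n0(1)] by blast
    show "graph_spectral_radius G \<le> \<delta> * real n \<or>
      (graph_spectral_radius G)\<^sup>2 \<le> (1 - 1 / real r + \<delta>) * (2 * real (num_edges G))"
    proof (cases "graph_spectral_radius G \<le> \<delta> * real n")
      case False
      then have \<rho>: "\<delta> * real n < \<rho>" by (simp add: \<rho>_def)
      have \<rho>0: "0 < \<rho>" using \<rho> \<delta> n0 by (smt (verit) mult_nonneg_nonneg of_nat_0_le_iff)
      define y where "y i = (x i)\<^sup>2" for i
      have sumy: "sum y {..<n} = 1" using x(2) by (simp add: y_def)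
      have y0: "0 \<le> y i" for i by (simp add: y_def)
      have y_le: "real n * y i \<le> 1 / \<delta>\<^sup>2" if i: "i < n" for i
      proof -
        have "(\<rho> * x i)\<^sup>2 \<le> (\<Sum>j<n. of_bool (adj G i j) * x j)\<^sup>2"
          using x(1)[of i] x(3)[OF i] \<rho>0 by (intro power_mono) auto
        also have "\<dots> \<le> (\<Sum>j<n. (of_bool (adj G i j))\<^sup>2) * (\<Sum>j<n. (x j)\<^sup>2)"
          by (rule Cauchy_Schwarz_ineq_sum)
        also have "\<dots> \<le> real n"
        proof -
          have "(\<Sum>j<n. (of_bool (adj G i j))\<^sup>2) \<le> (\<Sum>j<n. 1 :: real)" by (intro sum_mono) auto
          then show ?thesis by (simp only: x(2)) simp
        qed
        finally have "\<rho>\<^sup>2 * y i \<le> real n" by (simp add: y_def power_mult_distrib)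
        moreover have "(\<delta> * real n)\<^sup>2 * y i \<le> \<rho>\<^sup>2 * y i"
          using \<rho> \<delta> by (intro mult_right_mono power_mono) (auto simp: y_def)
        ultimately have "real n * (\<delta>\<^sup>2 * (real n * y i)) \<le> real n * 1"
          by (simp add: power2_eq_square mult_ac)
        then have "\<delta>\<^sup>2 * (real n * y i) \<le> 1" using n0 by (simp only: mult_le_cancel_left)
        then show ?thesis using \<delta> by (simp add: field_simps)
      qed
      have qy: "quad_form {..<n} (adj G) y \<le> 1 - 1 / real r + \<delta>"
        using N[rule_format, OF n0(2), of G y] G y_le y0 by (simp add: sumy)
      let ?P = "{..<n} \<times> {..<n}"
      let ?a = "\<lambda>p. of_bool (adj G (fst p) (snd p)) :: real"
      have "\<rho>\<^sup>2 \<le> (quad_form {..<n} (adj G) x)\<^sup>2" using x(4) \<rho>0 by (intro power_mono) auto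
      \<comment> \<open>The indicator is idempotent and is written twice: Cauchy-Schwarz then leaves
        2e in one factor and the form of the squares x_i^2 in the other.\<close>
      also have "quad_form {..<n} (adj G) x = (\<Sum>p\<in>?P. ?a p * (?a p * x (fst p) * x (snd p)))"
        unfolding quad_form_def sum.cartesian_product by (intro sum.cong) auto
      also have "\<dots>\<^sup>2 \<le> (\<Sum>p\<in>?P. (?a p)\<^sup>2) * (\<Sum>p\<in>?P. (?a p * x (fst p) * x (snd p))\<^sup>2)"
        by (rule Cauchy_Schwarz_ineq_sum)
      also have "(\<Sum>p\<in>?P. (?a p)\<^sup>2) = quad_form {..<n} (adj G) (\<lambda>_. 1)"
        unfolding quad_form_def sum.cartesian_product by (intro sum.cong) auto
      also have "\<dots> = 2 * real (num_edges G)" by (rule quad_form_one[OF G(1)])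
      also have "(\<Sum>p\<in>?P. (?a p * x (fst p) * x (snd p))\<^sup>2) = quad_form {..<n} (adj G) y"
        unfolding quad_form_def sum.cartesian_product
        by (intro sum.cong) (auto simp: y_def power_mult_distrib)
      also have "2 * real (num_edges G) * quad_form {..<n} (adj G) y
          \<le> 2 * real (num_edges G) * (1 - 1 / real r + \<delta>)"
        using qy by (intro mult_left_mono) auto
      finally show ?thesis by (simp add: \<rho>_def mult.commute)
    qed simp
  qed
qed

text \<open>Inserting the edge bound into the bound on \<rho>^2 makes the right-hand side the square
  of p n. The alternative \<rho> \<le> \<delta> n is covered by \<delta> \<le> p.\<close>

lemma spectral_radius_upper:
  fixes F :: "'f graph"
  assumes F: "simple_graph F" "chromatic_number F = r + 1" and r: "r \<ge> 1" and \<delta>: "\<delta> > 0"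
  shows "\<exists>N. \<forall>n\<ge>N. \<forall>G. nvertex_graph n G \<and> free_of F G \<longrightarrow>
      graph_spectral_radius G \<le> (1 - 1 / real r + \<delta>) * real n"
proof -
  define p where "p = 1 - 1 / real r + \<delta>"
  have "1 / real r \<le> 1" using r by simp
  then have p: "\<delta> \<le> p" unfolding p_def by linarith
  obtain N1 where N1: "\<forall>n\<ge>N1. \<forall>G. nvertex_graph n G \<and> free_of F G \<longrightarrow>
      2 * real (num_edges G) \<le> (1 - 1 / real r + \<delta>) * real n ^ 2"
    using edges_upper[OF F r \<delta>] ..
  obtain N2 where N2: "\<forall>n\<ge>N2. \<forall>G. nvertex_graph n G \<and> free_of F G \<longrightarrow>
      graph_spectral_radius G \<le> \<delta> * real n \<or>
      (graph_spectral_radius G)\<^sup>2 \<le> (1 - 1 / real r + \<delta>) * (2 * real (num_edges G))"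
    using spectral_radius_sq_le_edges[OF F r \<delta>] ..
  have "graph_spectral_radius G \<le> p * real n"
    if n: "max N1 N2 \<le> n" and G: "nvertex_graph n G" "free_of F G" for n G
  proof -
    have e: "2 * real (num_edges G) \<le> p * real n ^ 2" using N1 n G by (simp add: p_def)
    have "graph_spectral_radius G \<le> \<delta> * real n \<or>
      (graph_spectral_radius G)\<^sup>2 \<le> p * (2 * real (num_edges G))"
      using N2 n G by (simp add: p_def)
    then show ?thesis
    proof
      assume "graph_spectral_radius G \<le> \<delta> * real n"
      also have "\<dots> \<le> p * real n" using p by (intro mult_right_mono) auto
      finally show ?thesis .
    next
      assume a: "(graph_spectral_radius G)\<^sup>2 \<le> p * (2 * real (num_edges G))"
      have "p * (2 * real (num_edges G)) \<le> p * (p * real n ^ 2)"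
        using e p \<delta> by (intro mult_left_mono) auto
      moreover have "p * (p * real n ^ 2) = (p * real n)\<^sup>2"
        by (simp only: power_mult_distrib power2_eq_square[of p] mult.assoc)
      ultimately have "(graph_spectral_radius G)\<^sup>2 \<le> (p * real n)\<^sup>2" using a by linarith
      moreover have "0 \<le> p * real n" using p \<delta> by simp
      ultimately show ?thesis by (rule power2_le_imp_le)
    qed
  qed
  then show ?thesis unfolding p_def by blast
qed

section \<open>Stability\<close>

definition nbrs :: "'a graph \<Rightarrow> 'a \<Rightarrow> 'a set" where
  "nbrs G v = {u. adj G v u}"

lemma nbrs_nvertex: "nvertex_graph n G \<Longrightarrow> nbrs G v \<subseteq> {..<n}"
  using nvertexD(4)[of n G v] by (auto simp: nbrs_def)

lemma sum_adj_row:
  assumes "nvertex_graph n G"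
  shows "(\<Sum>u<n. of_bool (adj G v u) :: real) = real (card (nbrs G v))"
proof -
  have "{..<n} \<inter> {u. adj G v u} = nbrs G v" using nbrs_nvertex[OF assms] by (auto simp: nbrs_def)
  then show ?thesis by simp
qed

text \<open>Lowering the weight of the vertices of small degree by a factor \<open>1 - \<eta>\<close> would violate
  \<open>weighted_erdos_stone\<close> if there were many of them.\<close>

lemma few_low_degree:
  fixes F :: "'f graph"
  assumes F: "simple_graph F" "chromatic_number F = r + 1" and r: "r \<ge> 1" and \<eta>: "0 < \<eta>" "\<eta> \<le> 1 / 2"
  shows "\<exists>N. \<forall>n\<ge>N. \<forall>G. nvertex_graph n G \<and> free_of F G \<and>
      (1 - 1 / real r - \<eta> ^ 3 / 2) * real n ^ 2 \<le> 2 * real (num_edges G) \<longrightarrow>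
      real (card {v\<in>{..<n}. real (card (nbrs G v)) < (1 - 1 / real r - \<eta>) * real n}) \<le> \<eta> * real n"
proof -
  \<comment> \<open>The argument ends with \<eta>^2 l n \<le> 2 \<delta> n^2; this \<delta> turns it
    into l \<le> \<eta> n.\<close>
  define \<delta> where "\<delta> = \<eta> ^ 3 / 2"
  have \<delta>: "\<delta> > 0" using \<eta> by (simp add: \<delta>_def)
  \<comment> \<open>As \<eta> \<le> 1/2, lowering the weights loses at most half of the total, so
    the spread constant 2 suffices.\<close>
  have "(2::real) > 0" by simp
  from weighted_erdos_stone[OF F r \<delta> this]
  obtain N where N: "\<forall>n\<ge>N. \<forall>G y. nvertex_graph n G \<and> free_of F G \<and>
      (\<forall>v<n. 0 \<le> y v \<and> real n * y v \<le> 2 * sum y {..<n}) \<longrightarrow>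
      quad_form {..<n} (adj G) y \<le> (1 - 1 / real r + \<delta>) * (sum y {..<n})\<^sup>2" ..
  show ?thesis
  proof (intro exI[of _ "max N 1"] allI impI, elim conjE)
    fix n and G :: "nat graph"
    define p where "p = 1 - 1 / real r"
    assume n: "max N 1 \<le> n" and G: "nvertex_graph n G" "free_of F G"
      and "(1 - 1 / real r - \<eta> ^ 3 / 2) * real n ^ 2 \<le> 2 * real (num_edges G)"
    then have e: "(p - \<delta>) * real n ^ 2 \<le> 2 * real (num_edges G)" by (simp add: p_def \<delta>_def)
    have n0: "n > 0" "N \<le> n" using n by auto
    define L where "L = {v\<in>{..<n}. real (card (nbrs G v)) < (1 - 1 / real r - \<eta>) * real n}"
    define l where "l = real (card L)"
    have L: "L \<subseteq> {..<n}" "finite L" by (auto simp: L_def)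
    have ln: "l \<le> real n" unfolding l_def using card_mono[OF _ L(1)] by simp
    have l0: "0 \<le> l" by (simp add: l_def)
    have p: "0 \<le> p" "p \<le> 1" using r by (auto simp: p_def)
    define y where "y v = 1 - \<eta> * of_bool (v \<in> L)" for v
    have "{..<n} \<inter> L = L" using L by auto
    then have "(\<Sum>v<n. of_bool (v \<in> L) :: real) = l" by (simp add: l_def)
    then have sumy: "sum y {..<n} = real n - \<eta> * l"
      unfolding y_def by (simp only: sum_subtractf sum_distrib_left[symmetric]) simp
    have yb: "0 \<le> y v" "y v \<le> 1" for v using \<eta> by (auto simp: y_def)
    have "\<eta> * l \<le> 1 / 2 * real n" using \<eta> ln l0 by (intro mult_mono) auto
    then have half: "real n \<le> 2 * sum y {..<n}" by (simp add: sumy)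
    have "real n * y v \<le> real n" for v using yb by (simp add: mult_left_le)
    then have "0 \<le> y v \<and> real n * y v \<le> 2 * sum y {..<n}" for v using half yb order_trans by blast
    then have up: "quad_form {..<n} (adj G) y \<le> (p + \<delta>) * (real n - \<eta> * l)\<^sup>2"
      using N[rule_format, OF n0(2), of G y] G by (simp add: sumy p_def)
    let ?a = "\<lambda>u v. of_bool (adj G u v) :: real"
    let ?b = "\<lambda>v. of_bool (v \<in> L) :: real"
    define D where "D = (\<Sum>u\<in>L. real (card (nbrs G u)))"
    have D1: "(\<Sum>u<n. \<Sum>v<n. ?a u v * ?b u) = D"
    proof -
      have "(\<Sum>u<n. \<Sum>v<n. ?a u v * ?b u) = (\<Sum>u<n. ?b u * real (card (nbrs G u)))"
        by (intro sum.cong refl, subst sum_distrib_right[symmetric]) (simp only: sum_adj_row[OF G(1)] mult.commute)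
      also have "\<dots> = D"
        unfolding D_def using L(1) by (intro sum.mono_neutral_cong_right) auto
      finally show ?thesis .
    qed
    have D2: "(\<Sum>u<n. \<Sum>v<n. ?a u v * ?b v) = D"
      unfolding D1[symmetric] by (subst sum.swap) (simp only: insert_commute)
    have "2 * real (num_edges G) - 2 * \<eta> * D
        = quad_form {..<n} (adj G) (\<lambda>_. 1) - \<eta> * (\<Sum>u<n. \<Sum>v<n. ?a u v * ?b u) - \<eta> * (\<Sum>u<n. \<Sum>v<n. ?a u v * ?b v)"
      by (simp only: quad_form_one[OF G(1)] D1 D2)
    also have "\<dots> = (\<Sum>u<n. \<Sum>v<n. ?a u v * 1 * 1 - \<eta> * (?a u v * ?b u) - \<eta> * (?a u v * ?b v))"
      by (simp only: quad_form_def sum_distrib_left sum_subtractf)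
    also have "\<dots> \<le> quad_form {..<n} (adj G) y"
      unfolding quad_form_def
    proof (intro sum_mono)
      fix u v
      \<comment> \<open>The product term of (1 - a)(1 - b) is nonnegative and is dropped, leaving
        sums that are degree sums over L.\<close>
      have "1 - \<eta> * ?b u - \<eta> * ?b v \<le> y u * y v"
        using \<eta> by (auto simp: y_def of_bool_def algebra_simps)
      then have "?a u v * (1 - \<eta> * ?b u - \<eta> * ?b v) \<le> ?a u v * (y u * y v)"
        by (intro mult_left_mono) auto
      then show "?a u v * 1 * 1 - \<eta> * (?a u v * ?b u) - \<eta> * (?a u v * ?b v) \<le> ?a u v * y u * y v"
        by (simp only: algebra_simps)
    qed
    finally have low: "2 * real (num_edges G) - 2 * \<eta> * D \<le> (p + \<delta>) * (real n - \<eta> * l)\<^sup>2"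
      using up by linarith
    have "D \<le> (\<Sum>u\<in>L. (p - \<eta>) * real n)"
      unfolding D_def by (intro sum_mono) (simp add: L_def p_def less_imp_le)
    then have "D \<le> l * ((p - \<eta>) * real n)" by (simp add: l_def)
    then have "2 * \<eta> * D \<le> 2 * \<eta> * (l * ((p - \<eta>) * real n))" using \<eta> by (intro mult_left_mono) auto
    then have "(p - \<delta>) * real n ^ 2 - 2 * \<eta> * (l * ((p - \<eta>) * real n)) \<le> (p + \<delta>) * (real n - \<eta> * l)\<^sup>2"
      using low e by linarith
    \<comment> \<open>The terms p n^2 and 2 p \<eta> l n cancel. Half of the gain 2 \<eta>^2 l n
      absorbs p \<eta>^2 l^2; the other half is bounded by the errors carrying \<delta>.\<close>
    then have main: "2 * (\<eta>\<^sup>2 * (l * real n)) + 2 * (\<delta> * (\<eta> * (l * real n)))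
        \<le> 2 * \<delta> * real n ^ 2 + p * (\<eta>\<^sup>2 * (l * l)) + \<delta> * (\<eta>\<^sup>2 * (l * l))"
      by (simp add: power2_eq_square algebra_simps)
    have ll: "l * l \<le> l * real n" using ln l0 by (intro mult_left_mono)
    have "p * (\<eta>\<^sup>2 * (l * l)) \<le> 1 * (\<eta>\<^sup>2 * (l * real n))"
      using p ll l0 ln by (intro mult_mono) (auto intro: mult_left_mono)
    moreover have "\<delta> * (\<eta>\<^sup>2 * (l * l)) \<le> \<delta> * (\<eta> * (l * real n))"
      using \<eta> ll l0 ln \<delta> by (intro mult_left_mono mult_mono) (auto simp: power2_eq_square)
    moreover have "0 \<le> \<delta> * (\<eta> * (l * real n))" using \<eta> l0 \<delta> by simp
    ultimately have "\<eta>\<^sup>2 * (l * real n) \<le> 2 * \<delta> * real n ^ 2" using main by linarith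
    also have "\<dots> = \<eta>\<^sup>2 * ((\<eta> * real n) * real n)" by (simp add: \<delta>_def power2_eq_square power3_eq_cube)
    finally have "l * real n \<le> (\<eta> * real n) * real n" using \<eta> by simp
    then show "real (card {v\<in>{..<n}. real (card (nbrs G v)) < (1 - 1 / real r - \<eta>) * real n}) \<le> \<eta> * real n"
      using n0 by (simp add: l_def L_def)
  qed
qed

section \<open>Double counting around r-cliques\<close>

lemma sorted_wrt_remove_nth:
  assumes "sorted_wrt P xs" "i < length xs"
  shows "sorted_wrt P (take i xs @ drop (Suc i) xs)"
proof -
  have "sorted_wrt P (take i xs @ xs ! i # drop (Suc i) xs)"
    using assms by (simp add: id_take_nth_drop[symmetric])
  then show ?thesis by (auto simp: sorted_wrt_append)
qed

lemma set_remove_nth: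
  assumes "i < length xs"
  shows "set (take i xs @ drop (Suc i) xs) = {xs ! j | j. j < length xs \<and> j \<noteq> i}"
proof (rule subset_antisym; rule subsetI)
  fix x assume "x \<in> set (take i xs @ drop (Suc i) xs)"
  then consider j where "j < i" "x = xs ! j" | j where "j < length xs - Suc i" "x = xs ! (Suc i + j)"
    using assms by (auto simp: in_set_conv_nth)
  then show "x \<in> {xs ! j | j. j < length xs \<and> j \<noteq> i}"
  proof cases
    case 1 then show ?thesis using assms by auto
  next
    case 2 then show ?thesis by (intro CollectI exI[of _ "Suc i + j"]) auto
  qed
next
  fix x assume "x \<in> {xs ! j | j. j < length xs \<and> j \<noteq> i}"
  then obtain j where j: "x = xs ! j" "j < length xs" "j \<noteq> i" by auto
  show "x \<in> set (take i xs @ drop (Suc i) xs)"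
  proof (cases "j < i")
    case True
    then have "x = take i xs ! j" "j < length (take i xs)" using j by auto
    then show ?thesis by (metis Un_iff nth_mem set_append)
  next
    case False
    then have "x = drop (Suc i) xs ! (j - Suc i)" "j - Suc i < length (drop (Suc i) xs)" using j assms by auto
    then show ?thesis by (metis Un_iff nth_mem set_append)
  qed
qed

text \<open>Adjacency to entry i is left open: u and v together with the other r - 1 entries form an
  (r + 1)-clique, and every edge inside the part belonging to entry i occurs here. Pairs are
  ordered.\<close>

definition joint_pairs :: "nat graph \<Rightarrow> nat \<Rightarrow> nat list \<Rightarrow> nat \<Rightarrow> (nat \<times> nat) set" where
  "joint_pairs G n xs i = {(u, v). u < n \<and> v < n \<and> adj G u v \<and>
     (\<forall>j<length xs. j \<noteq> i \<longrightarrow> adj G u (xs ! j) \<and> adj G v (xs ! j))}"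

lemma finite_joint_pairs: "finite (joint_pairs G n xs i)"
  by (rule finite_subset[of _ "{..<n} \<times> {..<n}"]) (auto simp: joint_pairs_def)

text \<open>Trading entry i for u and v gives an (r + 1)-clique. The triple (\<open>xs\<close>, u,
  v) is recovered from that clique and the traded vertex, for which there are at most n
  choices.\<close>

lemma sum_joint_pairs_le:
  assumes S: "S \<subseteq> {..<n}" and i: "i < r"
  shows "(\<Sum>xs\<in>clique_lists (adj G) S r. card (joint_pairs G n xs i))
     \<le> n * card (clique_lists (adj G) {..<n} (r + 1))"
proof -
  let ?Q = "clique_lists (adj G) S r"
  let ?K = "clique_lists (adj G) {..<n} (r + 1)"
  let ?rm = "\<lambda>xs. take i xs @ drop (Suc i) xs"
  have fS: "finite S" using finite_subset[OF S] by simp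
  let ?f = "\<lambda>(xs, u, v). (xs ! i, u # v # ?rm xs)"
  have "inj_on ?f (SIGMA xs : ?Q. joint_pairs G n xs i)"
  proof (rule inj_onI)
    fix p q assume pq: "p \<in> (SIGMA xs : ?Q. joint_pairs G n xs i)" "q \<in> (SIGMA xs : ?Q. joint_pairs G n xs i)"
      "?f p = ?f q"
    obtain xs u v ys u' v' where p: "p = (xs, u, v)" and q: "q = (ys, u', v')"
      using prod_cases3 by metis
    have xs: "xs \<in> ?Q" and ys: "ys \<in> ?Q"
      and eq: "xs ! i = ys ! i" "take i xs @ drop (Suc i) xs = take i ys @ drop (Suc i) ys"
      and uv: "u = u'" "v = v'"
      using pq by (auto simp: p q)
    have len: "length xs = r" "length ys = r" using xs ys by (auto simp: clique_lists_def)
    then have "take i xs = take i ys \<and> drop (Suc i) xs = drop (Suc i) ys"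
      using eq(2) by (intro append_eq_append_conv[THEN iffD1]) auto
    then have "xs = ys"
      using eq(1) len i by (metis id_take_nth_drop)
    then show "p = q" using p q uv by simp
  qed
  moreover have "?f ` (SIGMA xs : ?Q. joint_pairs G n xs i) \<subseteq> {..<n} \<times> ?K"
  proof (rule image_subsetI)
    fix p assume "p \<in> (SIGMA xs : ?Q. joint_pairs G n xs i)"
    then obtain xs u v where p: "p = (xs, u, v)" and xs: "xs \<in> ?Q" and uv: "(u, v) \<in> joint_pairs G n xs i"
      by (cases p) auto
    have len: "length xs = r" and st: "set xs \<subseteq> S" and sw: "sorted_wrt (adj G) xs"
      using xs by (auto simp: clique_lists_def)
    have "xs ! i < n" using len st S i by (metis lessThan_iff nth_mem subsetD)
    moreover have "u # v # ?rm xs \<in> ?K"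
    proof -
      have "set (?rm xs) \<subseteq> {..<n}" using st S by (auto dest: in_set_takeD in_set_dropD)
      moreover have "\<forall>x\<in>set (?rm xs). adj G u x \<and> adj G v x"
        using uv len i by (subst set_remove_nth) (auto simp: joint_pairs_def)
      moreover have "sorted_wrt (adj G) (?rm xs)"
        using sw len i by (intro sorted_wrt_remove_nth) auto
      ultimately show ?thesis
        using uv len i by (auto simp: clique_lists_def joint_pairs_def)
    qed
    ultimately show "?f p \<in> {..<n} \<times> ?K" by (simp add: p)
  qed
  moreover have "finite ({..<n} \<times> ?K)" using finite_clique_lists by blast
  ultimately have "card (SIGMA xs : ?Q. joint_pairs G n xs i) \<le> card ({..<n} \<times> ?K)"
    by (rule card_inj_on_le)
  moreover have "card (SIGMA xs : ?Q. joint_pairs G n xs i) = (\<Sum>xs\<in>?Q. card (joint_pairs G n xs i))"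
    by (rule card_SigmaI) (use finite_clique_lists[OF fS] finite_joint_pairs in auto)
  ultimately show ?thesis by (simp add: card_cartesian_product)
qed

text \<open>Consing a common neighbour onto an r-clique is injective and gives an (r +
  1)-clique.\<close>

lemma sum_common_nbrs_le:
  fixes G :: "nat graph"
  assumes S: "S \<subseteq> {..<n}"
  shows "(\<Sum>xs\<in>clique_lists (adj G) S r. card {v\<in>{..<n}. \<forall>x\<in>set xs. adj G v x})
     \<le> card (clique_lists (adj G) {..<n} (r + 1))"
proof -
  let ?Q = "clique_lists (adj G) S r"
  let ?X = "\<lambda>xs. {v\<in>{..<n}. \<forall>x\<in>set xs. adj G v x}"
  have fS: "finite S" using finite_subset[OF S] by simp
  have "card (SIGMA xs : ?Q. ?X xs) \<le> card (clique_lists (adj G) {..<n} (r + 1))"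
  proof (rule card_inj_on_le[of "\<lambda>(xs, v). v # xs"])
    show "(\<lambda>(xs, v). v # xs) ` (SIGMA xs : ?Q. ?X xs) \<subseteq> clique_lists (adj G) {..<n} (r + 1)"
      using S by (auto simp: clique_lists_def)
    show "finite (clique_lists (adj G) {..<n} (r + 1))" by (rule finite_clique_lists) simp
  qed (auto simp: inj_on_def)
  moreover have "card (SIGMA xs : ?Q. ?X xs) = (\<Sum>xs\<in>?Q. card (?X xs))"
    by (rule card_SigmaI) (use finite_clique_lists[OF fS] in auto)
  ultimately show ?thesis by simp
qed

text \<open>Fewer than r vertices, each with at most (1/r + \<eta>) n non-neighbours, and at most
  \<eta> n vertices outside S leave (1/r - r \<eta>) n; the bound on r \<eta> makes this at least
  half of n/r. It is the greedy step that produces many r-cliques inside S.\<close>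

lemma common_nbrs_ge:
  assumes G: "nvertex_graph n G" and r: "r \<ge> 1" and S: "S \<subseteq> {..<n}"
    and \<eta>: "\<eta> > 0" "real r * \<eta> \<le> 1 / (2 * real r)"
    and S_card: "real (card ({..<n} - S)) \<le> \<eta> * real n"
    and deg: "\<And>v. v \<in> S \<Longrightarrow> (1 - 1 / real r - \<eta>) * real n \<le> real (card (nbrs G v))"
    and xs: "set xs \<subseteq> S" "length xs < r"
  shows "real n / (2 * real r) \<le> real (card {v\<in>S. \<forall>x\<in>set xs. adj G v x})"
proof -
  define X where "X = {v\<in>S. \<forall>x\<in>set xs. adj G v x}"
  define c where "c = (1 / real r + \<eta>) * real n"
  have fX: "finite X" using S finite_subset[of X "{..<n}"] by (auto simp: X_def)
  have c0: "0 \<le> c" using \<eta> by (simp add: c_def)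
  have non: "real (card ({..<n} - nbrs G x)) \<le> c" if "x \<in> S" for x
  proof -
    have "card ({..<n} - nbrs G x) = n - card (nbrs G x)"
      using nbrs_nvertex[OF G, of x] finite_subset[OF nbrs_nvertex[OF G, of x]] by (simp add: card_Diff_subset)
    moreover have "card (nbrs G x) \<le> n" using card_mono[OF _ nbrs_nvertex[OF G, of x]] by simp
    ultimately show ?thesis using deg[OF that] by (simp add: c_def algebra_simps of_nat_diff)
  qed
  have "{..<n} \<subseteq> X \<union> ({..<n} - S) \<union> (\<Union>x\<in>set xs. {..<n} - nbrs G x)"
    by (auto simp: X_def nbrs_def insert_commute)
  then have "card {..<n} \<le> card (X \<union> ({..<n} - S) \<union> (\<Union>x\<in>set xs. {..<n} - nbrs G x))"
    using fX by (intro card_mono) auto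
  also have "\<dots> \<le> card X + card ({..<n} - S) + card (\<Union>x\<in>set xs. {..<n} - nbrs G x)"
    by (meson add_mono card_Un_le order_trans order_refl)
  also have "card (\<Union>x\<in>set xs. {..<n} - nbrs G x) \<le> (\<Sum>x\<in>set xs. card ({..<n} - nbrs G x))"
    by (rule card_UN_le) simp
  finally have "n \<le> card X + card ({..<n} - S) + (\<Sum>x\<in>set xs. card ({..<n} - nbrs G x))" by simp
  then have "real n \<le> real (card X + card ({..<n} - S) + (\<Sum>x\<in>set xs. card ({..<n} - nbrs G x)))"
    by (simp only: of_nat_le_iff)
  then have "real n \<le> real (card X) + real (card ({..<n} - S)) + (\<Sum>x\<in>set xs. real (card ({..<n} - nbrs G x)))"
    by simp
  also have "(\<Sum>x\<in>set xs. real (card ({..<n} - nbrs G x))) \<le> (\<Sum>x\<in>set xs. c)"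
    using non xs by (intro sum_mono) auto
  also have "(\<Sum>x\<in>set xs. c) \<le> (real r - 1) * c"
  proof -
    have "card (set xs) \<le> r - 1" using card_length[of xs] xs(2) by linarith
    then have "real (card (set xs)) \<le> real r - 1" using r by linarith
    then show ?thesis using c0 by (simp add: mult_right_mono)
  qed
  finally have "real n - \<eta> * real n - (real r - 1) * c \<le> real (card X)" using S_card by linarith
  moreover have "real n - \<eta> * real n - (real r - 1) * c = (1 / real r - real r * \<eta>) * real n"
    using r by (simp add: c_def field_simps)
  moreover have "1 / (2 * real r) \<le> 1 / real r - real r * \<eta>" using \<eta>(2) r by (simp add: field_simps)
  then have "1 / (2 * real r) * real n \<le> (1 / real r - real r * \<eta>) * real n"
    by (rule mult_right_mono) simp
  ultimately show ?thesis by (simp add: X_def)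
qed

text \<open>For a typical \<open>r\<close>-clique \<open>x\<^sub>0, \<dots>, x\<^bsub>r-1\<^esub>\<close> of vertices of large degree, almost every vertex is
  adjacent to all but exactly one of the \<open>x\<^sub>i\<close>; an edge between two vertices missing the same
  \<open>x\<^sub>i\<close> completes the remaining \<open>x\<^sub>j\<close> to one of the few \<open>(r + 1)\<close>-cliques.\<close>

lemma near_multipartite:
  assumes G: "nvertex_graph n G" and n: "n > 0" and r: "r \<ge> 1" and S: "S \<subseteq> {..<n}"
    and \<eta>: "\<eta> > 0" "real r * \<eta> \<le> 1 / (2 * real r)"
    and S_card: "real (card ({..<n} - S)) \<le> \<eta> * real n"
    and deg: "\<And>v. v \<in> S \<Longrightarrow> (1 - 1 / real r - \<eta>) * real n \<le> real (card (nbrs G v))"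
    and few: "(real r + 1) * real (card (clique_lists (adj G) {..<n} (r + 1)))
        \<le> \<eta> * (1 / (2 * real r)) ^ r * real n ^ (r + 1)"
  shows "\<exists>V :: nat \<Rightarrow> nat set. (\<forall>i<r. V i \<subseteq> {..<n} \<and> real (card (V i)) \<le> (1 / real r + \<eta>) * real n) \<and>
    (\<forall>i<r. \<forall>j<r. i \<noteq> j \<longrightarrow> V i \<inter> V j = {}) \<and>
    real (card ({..<n} - (\<Union>i<r. V i))) \<le> (real r + 2) * \<eta> * real n \<and>
    (\<Sum>i<r. real (card {(u, v). u \<in> V i \<and> v \<in> V i \<and> adj G u v})) \<le> \<eta> * real n ^ 2"
proof -
  define Q where "Q = clique_lists (adj G) S r"
  define K where "K = card (clique_lists (adj G) {..<n} (r + 1))"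
  define N where "N xs = card {v\<in>{..<n}. \<forall>x\<in>set xs. adj G v x}" for xs
  \<comment> \<open>One clique has to be good for r + 1 quantities at once; adding them lets a
    single average do. The factor n lifts the number of common neighbours to the n^2 scale of the
    pair counts. Each summand totals at most n K over Q, whence the factor r + 1 in
    \<open>few\<close>.\<close>
  define cost where "cost xs = real n * real (N xs) + (\<Sum>i<r. real (card (joint_pairs G n xs i)))" for xs
  have fS: "finite S" using finite_subset[OF S] by simp
  have "(real n / (2 * real r)) ^ r \<le> real (card Q)"
    unfolding Q_def
  proof (rule card_clique_lists_ge[OF fS])
    fix s xs assume "s < r" "xs \<in> clique_lists (adj G) S s"
    then have "set xs \<subseteq> S" "length xs < r" by (auto simp: clique_lists_def)
    from common_nbrs_ge[OF G r S \<eta> S_card deg this]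
    show "real n / (2 * real r) \<le> real (card {v\<in>S. \<forall>x\<in>set xs. adj G v x})" .
  qed simp
  then have Qc: "(1 / (2 * real r)) ^ r * real n ^ r \<le> real (card Q)"
    by (simp add: power_divide)
  have "0 < (1 / (2 * real r)) ^ r * real n ^ r" using n r by simp
  then have "0 < real (card Q)" using Qc by linarith
  then have Q0: "Q \<noteq> {}" "finite Q" by (auto simp: card_gt_0_iff)
  have "(\<Sum>xs\<in>Q. N xs) \<le> K"
    using sum_common_nbrs_le[OF S, of G r] by (simp only: Q_def N_def K_def)
  then have "real (\<Sum>xs\<in>Q. N xs) \<le> real K" by (rule of_nat_mono)
  then have N_sum: "(\<Sum>xs\<in>Q. real (N xs)) \<le> real K" by (simp only: of_nat_sum)
  have P_sum: "(\<Sum>xs\<in>Q. real (card (joint_pairs G n xs i))) \<le> real n * real K" if "i < r" for i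
  proof -
    have "(\<Sum>xs\<in>Q. card (joint_pairs G n xs i)) \<le> n * K"
      using sum_joint_pairs_le[OF S that, of G] by (simp only: Q_def K_def)
    then have "real (\<Sum>xs\<in>Q. card (joint_pairs G n xs i)) \<le> real (n * K)" by (rule of_nat_mono)
    then show ?thesis by (simp only: of_nat_sum of_nat_mult)
  qed
  have "sum cost Q = real n * (\<Sum>xs\<in>Q. real (N xs)) + (\<Sum>i<r. \<Sum>xs\<in>Q. real (card (joint_pairs G n xs i)))"
    unfolding cost_def by (subst sum.swap) (simp add: sum.distrib sum_distrib_left)
  also have "\<dots> \<le> real n * real K + (\<Sum>i<r. real n * real K)"
    using N_sum P_sum by (intro add_mono mult_left_mono sum_mono) auto
  also have "\<dots> = real n * ((real r + 1) * real K)" by (simp add: algebra_simps)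
  also have "\<dots> \<le> real n * (\<eta> * (1 / (2 * real r)) ^ r * real n ^ (r + 1))"
    using few by (intro mult_left_mono) (auto simp: K_def)
  also have "\<dots> = \<eta> * real n ^ 2 * ((1 / (2 * real r)) ^ r * real n ^ r)"
    by (simp add: power2_eq_square)
  also have "\<dots> \<le> \<eta> * real n ^ 2 * real (card Q)"
    using Qc \<eta> by (intro mult_left_mono) auto
  finally have avg: "sum cost Q \<le> \<eta> * real n ^ 2 * real (card Q)" .
  have "\<exists>xs\<in>Q. cost xs \<le> \<eta> * real n ^ 2"
  proof (rule ccontr)
    assume "\<not> ?thesis"
    then have "(\<Sum>xs\<in>Q. \<eta> * real n ^ 2) < sum cost Q"
      using Q0 by (intro sum_strict_mono) auto
    then show False using avg by (simp add: mult.commute)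
  qed
  then obtain xs where xs: "xs \<in> Q" and cost: "cost xs \<le> \<eta> * real n ^ 2" by blast
  have len: "length xs = r" and xsS: "xs ! j \<in> S" if "j < r" for j
    using xs that by (auto simp: Q_def clique_lists_def)
  have lenr: "length xs = r" using xs by (simp add: Q_def clique_lists_def)
  have pairs0: "0 \<le> (\<Sum>i<r. real (card (joint_pairs G n xs i)))" by (intro sum_nonneg) simp
  have "real n * real (N xs) \<le> real n * (\<eta> * real n)"
    using cost pairs0 by (simp add: cost_def power2_eq_square mult_ac)
  then have Nxs: "real (N xs) \<le> \<eta> * real n" using n by simp
  define V where "V i = {u\<in>{..<n}. (\<forall>j<r. j \<noteq> i \<longrightarrow> adj G u (xs ! j)) \<and> \<not> adj G u (xs ! i)}" for i
  have non: "real (card {u\<in>{..<n}. \<not> adj G u (xs ! j)}) \<le> (1 / real r + \<eta>) * real n" if "j < r" for j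
  proof -
    let ?x = "xs ! j"
    have eq: "{u\<in>{..<n}. \<not> adj G u ?x} = {..<n} - nbrs G ?x" by (auto simp: nbrs_def insert_commute)
    have "card ({..<n} - nbrs G ?x) = n - card (nbrs G ?x)"
      using nbrs_nvertex[OF G, of ?x] finite_subset[OF nbrs_nvertex[OF G, of ?x]] by (simp add: card_Diff_subset)
    moreover have "card (nbrs G ?x) \<le> n" using card_mono[OF _ nbrs_nvertex[OF G, of ?x]] by simp
    ultimately show ?thesis
      unfolding eq using deg[OF xsS[OF that]] by (simp add: algebra_simps of_nat_diff)
  qed
  have V_card: "real (card (V i)) \<le> (1 / real r + \<eta>) * real n" if "i < r" for i
  proof -
    have "card (V i) \<le> card {u\<in>{..<n}. \<not> adj G u (xs ! i)}"
      by (rule card_mono) (auto simp: V_def)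
    then show ?thesis using non[OF that] by linarith
  qed
  define U where "U = {..<n} - (\<Union>i<r. V i)"
  have U_card: "real (card U) \<le> (real r + 2) * \<eta> * real n"
  proof -
    define N0 where "N0 = {v\<in>{..<n}. \<forall>x\<in>set xs. adj G v x}"
    define m where "m u = card {j\<in>{..<r}. \<not> adj G u (xs ! j)}" for u
    \<comment> \<open>A vertex outside U misses exactly one entry of \<open>xs\<close>; a vertex of
      U misses none or at least two. Those missing none form the small set \<open>N0\<close> and are
      charged 2. Since the non-neighbourhoods have total size at most (1 + r \<eta>) n, the excess
      over n bounds |U|.\<close>
    have pt: "1 + of_bool (u \<in> U) \<le> m u + 2 * of_bool (u \<in> N0)" if u: "u < n" for u
    proof -
      consider "m u = 0" | "m u = 1" | "m u \<ge> 2" by linarith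
      then show ?thesis
      proof cases
        case 1
        then have "\<forall>j<r. adj G u (xs ! j)" by (auto simp: m_def)
        then have "u \<in> N0" using u lenr by (auto simp: N0_def in_set_conv_nth)
        then show ?thesis by simp
      next
        case 2
        then obtain i where i: "{j\<in>{..<r}. \<not> adj G u (xs ! j)} = {i}" by (auto simp: m_def card_1_singleton_iff)
        then have "i < r" "\<not> adj G u (xs ! i)" by blast+
        moreover have "adj G u (xs ! j)" if "j < r" "j \<noteq> i" for j using i that by blast
        ultimately have "u \<in> (\<Union>i<r. V i)" using u by (auto simp: V_def)
        then show ?thesis using 2 by (simp add: U_def)
      next
        case 3
        then show ?thesis by (simp add: of_bool_def)
      qed
    qed
    have U_eq: "{..<n} \<inter> U = U" and N0_eq: "{..<n} \<inter> N0 = N0" by (auto simp: U_def N0_def)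
    have "(\<Sum>u<n. 1 + of_bool (u \<in> U)) \<le> (\<Sum>u<n. m u + 2 * of_bool (u \<in> N0))"
      using pt by (intro sum_mono) auto
    moreover have "(\<Sum>u<n. 1 + of_bool (u \<in> U)) = n + card U"
      unfolding sum.distrib using U_eq by simp
    moreover have "(\<Sum>u<n. m u + 2 * of_bool (u \<in> N0)) = (\<Sum>u<n. m u) + 2 * N xs"
    proof -
      have "(\<Sum>u<n. of_bool (u \<in> N0)) = card N0" using N0_eq by simp
      then show ?thesis unfolding sum.distrib sum_distrib_left[symmetric] by (simp add: N_def N0_def)
    qed
    ultimately have "n + card U \<le> (\<Sum>u<n. m u) + 2 * N xs" by simp
    moreover have "(\<Sum>u<n. m u) = (\<Sum>j<r. card {u\<in>{..<n}. \<not> adj G u (xs ! j)})"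
    proof -
      have "(\<Sum>u<n. m u) = (\<Sum>u<n. \<Sum>j<r. of_bool (\<not> adj G u (xs ! j)))"
        by (simp add: m_def Int_def)
      also have "\<dots> = (\<Sum>j<r. \<Sum>u<n. of_bool (\<not> adj G u (xs ! j)))" by (rule sum.swap)
      finally show ?thesis by (simp add: Int_def)
    qed
    ultimately have "n + card U \<le> (\<Sum>j<r. card {u\<in>{..<n}. \<not> adj G u (xs ! j)}) + 2 * N xs"
      by (simp only:)
    then have "real (n + card U) \<le> real ((\<Sum>j<r. card {u\<in>{..<n}. \<not> adj G u (xs ! j)}) + 2 * N xs)"
      by (rule of_nat_mono)
    then have "real n + real (card U) \<le> (\<Sum>j<r. real (card {u\<in>{..<n}. \<not> adj G u (xs ! j)})) + 2 * real (N xs)"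
      by (simp only: of_nat_add of_nat_sum of_nat_mult of_nat_numeral)
    also have "\<dots> \<le> (\<Sum>j<r. (1 / real r + \<eta>) * real n) + 2 * (\<eta> * real n)"
      using non Nxs by (intro add_mono sum_mono mult_left_mono) auto
    also have "\<dots> = real n + (real r + 2) * \<eta> * real n" using r by (simp add: field_simps)
    finally show ?thesis by simp
  qed
  show ?thesis
  proof (intro exI[of _ V] conjI allI impI)
    show "V i \<subseteq> {..<n}" for i by (auto simp: V_def)
    show "real (card (V i)) \<le> (1 / real r + \<eta>) * real n" if "i < r" for i by (rule V_card[OF that])
    show "V i \<inter> V j = {}" if "i < r" "j < r" "i \<noteq> j" for i j using that by (auto simp: V_def)
    show "real (card ({..<n} - (\<Union>i<r. V i))) \<le> (real r + 2) * \<eta> * real n"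
      using U_card by (simp only: U_def)
    show "(\<Sum>i<r. real (card {(u, v). u \<in> V i \<and> v \<in> V i \<and> adj G u v})) \<le> \<eta> * real n ^ 2"
    proof -
      have "card {(u, v). u \<in> V i \<and> v \<in> V i \<and> adj G u v} \<le> card (joint_pairs G n xs i)" for i
        by (rule card_mono[OF finite_joint_pairs]) (auto simp: V_def joint_pairs_def lenr)
      then have "(\<Sum>i<r. real (card {(u, v). u \<in> V i \<and> v \<in> V i \<and> adj G u v}))
          \<le> (\<Sum>i<r. real (card (joint_pairs G n xs i)))" by (intro sum_mono) simp
      also have "\<dots> \<le> cost xs" by (simp add: cost_def)
      finally show ?thesis using cost by simp
    qed
  qed
qed

section \<open>The Turan graph and the edit distance to it\<close>

lemma nvertex_turan: "nvertex_graph n (turan_graph n r)"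
  by (auto simp: nvertex_graph_def simple_graph_def turan_graph_def finite_subset[of _ "Pow {..<n}"] card_2_iff)

lemma adj_turan: "adj (turan_graph n r) x y \<longleftrightarrow> x < n \<and> y < n \<and> x mod r \<noteq> y mod r"
  by (auto simp: turan_graph_def doubleton_eq_iff)

lemma card_residue_class:
  fixes n r i :: nat
  assumes "i < r"
  shows "n div r \<le> card {x. x < n \<and> x mod r = i}" "card {x. x < n \<and> x mod r = i} \<le> n div r + 1"
proof -
  have inj: "inj_on (\<lambda>q. i + r * q) A" for A using assms by (auto simp: inj_on_def)
  have "(\<lambda>q. i + r * q) ` {..<n div r} \<subseteq> {x. x < n \<and> x mod r = i}"
  proof clarify
    fix q assume "q < n div r"
    then have "q + 1 \<le> n div r" by simp
    then have "r * (q + 1) \<le> r * (n div r)" by (rule mult_le_mono2)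
    also have "\<dots> \<le> n" by simp
    finally show "i + r * q < n \<and> (i + r * q) mod r = i" using assms by simp
  qed
  then have "card ((\<lambda>q. i + r * q) ` {..<n div r}) \<le> card {x. x < n \<and> x mod r = i}"
    by (intro card_mono) auto
  then show "n div r \<le> card {x. x < n \<and> x mod r = i}" by (simp add: card_image[OF inj])
  have "{x. x < n \<and> x mod r = i} \<subseteq> (\<lambda>q. i + r * q) ` {..n div r}"
  proof
    fix x assume x: "x \<in> {x. x < n \<and> x mod r = i}"
    then have "x = i + r * (x div r)" using mod_mult_div_eq[of x r] by simp
    moreover have "x div r \<le> n div r" using x by (intro div_le_mono) simp
    ultimately show "x \<in> (\<lambda>q. i + r * q) ` {..n div r}" by blast
  qed
  then have "card {x. x < n \<and> x mod r = i} \<le> card ((\<lambda>q. i + r * q) ` {..n div r})"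
    by (intro card_mono) auto
  also have "\<dots> = n div r + 1" by (simp add: card_image[OF inj])
  finally show "card {x. x < n \<and> x mod r = i} \<le> n div r + 1" .
qed

lemma turan_degree:
  assumes "v < n"
  shows "card (nbrs (turan_graph n r) v) = n - card {x. x < n \<and> x mod r = v mod r}"
proof -
  have "nbrs (turan_graph n r) v = {..<n} - {x. x < n \<and> x mod r = v mod r}"
    using assms by (auto simp: nbrs_def adj_turan)
  then show ?thesis by (simp add: card_Diff_subset subset_iff)
qed

lemma free_of_turan:
  assumes "simple_graph F" "chromatic_number F = r + 1" "r \<ge> 1"
  shows "free_of F (turan_graph n r)"
  unfolding free_of_def
proof
  assume "contains_copy (turan_graph n r) F"
  then obtain f where f: "\<forall>e\<in>edges F. f ` e \<in> edges (turan_graph n r)" by (auto simp: contains_copy_def)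
  have "proper_colouring F r (\<lambda>v. f v mod r)"
    unfolding proper_colouring_def
  proof (intro conjI allI impI)
    fix x y assume "{x, y} \<in> edges F"
    then have "{f x, f y} \<in> edges (turan_graph n r)" using f by fastforce
    then show "f x mod r \<noteq> f y mod r" by (simp add: adj_turan)
  qed (use assms(3) in auto)
  then have "chromatic_number F \<le> r" by (rule chromatic_number_le)
  then show False using assms(2) by simp
qed

lemma turan_edges_lower:
  assumes r: "r \<ge> 1"
  shows "(1 - 1 / real r) * real n ^ 2 - real n \<le> 2 * real (turan_number n r)"
proof -
  let ?T = "turan_graph n r"
  have "(\<Sum>v<n. (1 - 1 / real r) * real n - 1) \<le> (\<Sum>v<n. real (card (nbrs ?T v)))"
  proof (rule sum_mono)
    fix v assume v: "v \<in> {..<n}"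
    have "card {x. x < n \<and> x mod r = v mod r} \<le> n div r + 1"
      using r by (intro card_residue_class) auto
    moreover have "real (n div r) \<le> real n / real r" by (rule of_nat_div_le_of_nat)
    ultimately have "real (card {x. x < n \<and> x mod r = v mod r}) \<le> real n / real r + 1" by linarith
    moreover have "real n - real (card {x. x < n \<and> x mod r = v mod r}) \<le> real (card (nbrs ?T v))"
      using turan_degree[of v n r] v by simp
    ultimately show "(1 - 1 / real r) * real n - 1 \<le> real (card (nbrs ?T v))"
      by (simp add: algebra_simps)
  qed
  also have "\<dots> = quad_form {..<n} (adj ?T) (\<lambda>_. 1)"
    unfolding quad_form_def sum_adj_row[OF nvertex_turan, symmetric] by simp
  also have "\<dots> = 2 * real (turan_number n r)"
    unfolding turan_number_def by (rule quad_form_one[OF nvertex_turan])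
  finally show ?thesis by (simp add: power2_eq_square algebra_simps)
qed

text \<open>The maps over which \<open>edit_dist\<close> minimises are unconstrained outside the
  vertex set and may be infinitely many. Their costs are bounded by e(G) + e(H), so the
  \<open>Min\<close> is taken over a finite set of values.\<close>

lemma edit_dist_le:
  assumes "finite (edges G)" "finite (edges H)" "bij_betw \<phi> (verts H) (verts G)"
  shows "edit_dist G H \<le> card ((edges G - (`) \<phi> ` edges H) \<union> ((`) \<phi> ` edges H - edges G))"
proof -
  let ?c = "\<lambda>\<phi>. card ((edges G - (`) \<phi> ` edges H) \<union> ((`) \<phi> ` edges H - edges G))"
  have "?c \<psi> \<le> card (edges G) + card (edges H)" for \<psi>
  proof -
    have "?c \<psi> \<le> card (edges G - (`) \<psi> ` edges H) + card ((`) \<psi> ` edges H - edges G)" by (rule card_Un_le)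
    also have "\<dots> \<le> card (edges G) + card ((`) \<psi> ` edges H)"
      using assms by (intro add_mono card_mono) auto
    also have "\<dots> \<le> card (edges G) + card (edges H)" using card_image_le[OF assms(2)] by simp
    finally show ?thesis .
  qed
  then have "?c ` {\<phi>. bij_betw \<phi> (verts H) (verts G)} \<subseteq> {..card (edges G) + card (edges H)}" by blast
  then have "finite (?c ` {\<phi>. bij_betw \<phi> (verts H) (verts G)})" by (rule finite_subset) simp
  then show ?thesis unfolding edit_dist_def using assms(3) by (intro Min_le) auto
qed

lemma extend_inj_to_bij:
  assumes A: "finite A" and D: "D \<subseteq> A" "inj_on h D" "h ` D \<subseteq> A"
  obtains \<psi> where "bij_betw \<psi> A A" "\<And>x. x \<in> D \<Longrightarrow> \<psi> x = h x"
proof -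
  have "finite D" using A D finite_subset by blast
  then have "card (A - D) = card (A - h ` D)"
    using A D by (simp add: card_Diff_subset card_image)
  then obtain g where g: "bij_betw g (A - D) (A - h ` D)"
    using A by (metis finite_Diff finite_same_card_bij)
  define \<psi> where "\<psi> x = (if x \<in> D then h x else g x)" for x
  have "bij_betw \<psi> D (h ` D)" using D(2) by (auto simp: bij_betw_def \<psi>_def inj_on_def)
  moreover have "bij_betw \<psi> (A - D) (A - h ` D)"
    using g by (subst bij_betw_cong[of _ _ g]) (auto simp: \<psi>_def)
  ultimately have "bij_betw \<psi> (D \<union> (A - D)) (h ` D \<union> (A - h ` D))"
    by (rule bij_betw_combine) auto
  moreover have "D \<union> (A - D) = A" "h ` D \<union> (A - h ` D) = A" using D by auto
  ultimately have "bij_betw \<psi> A A" by simp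
  then show thesis by (rule that) (simp add: \<psi>_def)
qed

text \<open>Every residue class has at least n div r elements, so each part fits into its class; the
  vertices outside the parts fill the remaining places arbitrarily.\<close>

lemma bijection_to_residue_classes:
  fixes V :: "nat \<Rightarrow> nat set"
  assumes V: "\<And>i. i < r \<Longrightarrow> V i \<subseteq> {..<n}" "\<And>i j. i < r \<Longrightarrow> j < r \<Longrightarrow> i \<noteq> j \<Longrightarrow> V i \<inter> V j = {}"
    and size: "\<And>i. i < r \<Longrightarrow> card (V i) \<le> n div r"
  shows "\<exists>\<psi>. bij_betw \<psi> {..<n} {..<n} \<and> (\<forall>i<r. \<forall>x\<in>V i. \<psi> x mod r = i)"
proof -
  have "\<exists>g. inj_on g (V i) \<and> g ` V i \<subseteq> {x. x < n \<and> x mod r = i}" if i: "i < r" for i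
  proof -
    have "finite (V i)" using finite_subset[OF V(1)[OF i]] by simp
    moreover have "finite {x. x < n \<and> x mod r = i}" by simp
    moreover have "card (V i) \<le> card {x. x < n \<and> x mod r = i}"
      using size[OF i] card_residue_class(1)[OF i, of n] by linarith
    ultimately have "\<exists>g. g ` V i \<subseteq> {x. x < n \<and> x mod r = i} \<and> inj_on g (V i)" by (rule card_le_inj)
    then show ?thesis by (simp only: conj_commute)
  qed
  then obtain g where g: "\<And>i. i < r \<Longrightarrow> inj_on (g i) (V i) \<and> g i ` V i \<subseteq> {x. x < n \<and> x mod r = i}"
    by metis
  define c where "c x = (SOME i. i < r \<and> x \<in> V i)" for x
  have c: "c x = i" if "i < r" "x \<in> V i" for i x
  proof -
    have "c x < r \<and> x \<in> V (c x)" unfolding c_def using that by (rule_tac someI[of _ i]) simp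
    then show ?thesis using V(2)[of "c x" i] that by blast
  qed
  define h where "h x = g (c x) x" for x
  have h: "h x < n \<and> h x mod r = i \<and> h x = g i x" if "i < r" "x \<in> V i" for i x
    using g[OF that(1)] that(2) by (auto simp: h_def c[OF that])
  define D where "D = (\<Union>i<r. V i)"
  have "D \<subseteq> {..<n}" using V(1) by (auto simp: D_def)
  moreover have "inj_on h D"
  proof (rule inj_onI)
    fix x y assume xy: "x \<in> D" "y \<in> D" "h x = h y"
    then obtain i j where ij: "i < r" "x \<in> V i" "j < r" "y \<in> V j" by (auto simp: D_def)
    then have "h x mod r = i" "h y mod r = j" using h by blast+
    then have "i = j" using xy(3) by simp
    have "g i x = g i y" using \<open>i = j\<close> h[OF ij(1,2)] h[OF ij(3,4)] xy(3) by simp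
    then show "x = y" using g[OF ij(1)] ij \<open>i = j\<close> by (auto dest: inj_onD)
  qed
  moreover have "h ` D \<subseteq> {..<n}" using h by (auto simp: D_def)
  ultimately obtain \<psi> where \<psi>: "bij_betw \<psi> {..<n} {..<n}" "\<And>x. x \<in> D \<Longrightarrow> \<psi> x = h x"
    using extend_inj_to_bij[of "{..<n}" D h] by blast
  have "\<psi> x mod r = i" if "i < r" "x \<in> V i" for i x
  proof -
    have "x \<in> D" using that by (auto simp: D_def)
    then have "\<psi> x = h x" by (rule \<psi>(2))
    then show ?thesis using h[OF that] by metis
  qed
  with \<psi>(1) show ?thesis by blast
qed

text \<open>Only surplus edges are located: an edge of G inside a residue class meets the leftover
  set or lies within some part. The number of missing edges then follows by counting, as at most
  t(n,r) - e(G) plus the number of surplus edges. Hence the factor 2.\<close>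

lemma edit_dist_turan_le:
  assumes G: "nvertex_graph n G"
    and \<psi>: "bij_betw \<psi> {..<n} {..<n}" "\<And>i x. i < r \<Longrightarrow> x \<in> V i \<Longrightarrow> \<psi> x mod r = i"
    and V: "\<And>i. i < r \<Longrightarrow> V i \<subseteq> {..<n}"
  shows "real (edit_dist G (turan_graph n r)) \<le>
    2 * (real (card ({..<n} - (\<Union>i<r. V i))) * real n + (\<Sum>i<r. real (card {(u, v). u \<in> V i \<and> v \<in> V i \<and> adj G u v})))
    + real (turan_number n r) - real (num_edges G)"
proof -
  let ?T = "turan_graph n r"
  \<comment> \<open>\<psi> places G into the Turan graph, whereas \<open>edit_dist\<close> takes
    maps in the opposite direction.\<close>
  define \<phi> where "\<phi> = inv_into {..<n} \<psi>"
  have \<phi>: "bij_betw \<phi> {..<n} {..<n}" unfolding \<phi>_def by (rule bij_betw_inv_into[OF \<psi>(1)])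
  have inv: "\<phi> (\<psi> x) = x" "\<psi> x < n" if "x < n" for x
    using \<psi>(1) that by (auto simp: \<phi>_def bij_betw_def inv_into_f_f)
  define A where "A = edges G"
  define B where "B = (`) \<phi> ` edges ?T"
  define U where "U = {..<n} - (\<Union>i<r. V i)"
  let ?W = "\<lambda>i. {(u, v). u \<in> V i \<and> v \<in> V i \<and> adj G u v}"
  define P where "P = U \<times> {..<n} \<union> (\<Union>i<r. ?W i)"
  have fA: "finite A" unfolding A_def by (rule nvertexD(2)[OF G])
  have fB: "finite B" unfolding B_def by (intro finite_imageI nvertexD(2)[OF nvertex_turan])
  have fW: "finite (?W i)" for i
    by (rule finite_subset[of _ "{..<n} \<times> {..<n}"]) (auto dest: nvertexD(4)[OF G])
  have fP: "finite P" unfolding P_def U_def using fW by auto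
  have "A - B \<subseteq> (\<lambda>(u, v). {u, v}) ` P"
  proof
    fix e assume e: "e \<in> A - B"
    then obtain u v where uv: "e = {u, v}" using nvertexD(3)[OF G, of e] by (auto simp: A_def card_2_iff)
    have ad: "adj G u v" using e uv by (simp add: A_def)
    then have un: "u < n" "v < n" using nvertexD(4)[OF G] by blast+
    have "\<psi> u mod r = \<psi> v mod r"
    proof (rule ccontr)
      assume "\<psi> u mod r \<noteq> \<psi> v mod r"
      then have "{\<psi> u, \<psi> v} \<in> edges ?T" using inv un by (simp add: adj_turan)
      then have "\<phi> ` {\<psi> u, \<psi> v} \<in> B" unfolding B_def by (rule imageI)
      then show False using e uv un inv by simp
    qed
    then have "(u, v) \<in> P \<or> (v, u) \<in> P"
    proof (cases "u \<in> U \<or> v \<in> U")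
      case True then show ?thesis using un by (auto simp: P_def)
    next
      case False
      then obtain i j where ij: "i < r" "u \<in> V i" "j < r" "v \<in> V j" using un by (auto simp: U_def)
      then have "i = j" using \<psi>(2) \<open>\<psi> u mod r = \<psi> v mod r\<close> by metis
      then show ?thesis using ij ad by (auto simp: P_def)
    qed
    then show "e \<in> (\<lambda>(u, v). {u, v}) ` P" using uv by (auto simp: image_iff insert_commute)
  qed
  then have "card (A - B) \<le> card ((\<lambda>(u, v). {u, v}) ` P)" using fP by (intro card_mono) auto
  also have "\<dots> \<le> card P" by (rule card_image_le[OF fP])
  also have "\<dots> \<le> card (U \<times> {..<n}) + card (\<Union>i<r. ?W i)" unfolding P_def by (rule card_Un_le)
  also have "card (\<Union>i<r. ?W i) \<le> (\<Sum>i<r. card (?W i))" by (rule card_UN_le) simp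
  finally have "card (A - B) \<le> card U * n + (\<Sum>i<r. card (?W i))" by (simp add: card_cartesian_product)
  then have "real (card (A - B)) \<le> real (card U * n + (\<Sum>i<r. card (?W i)))" by (rule of_nat_mono)
  then have AB: "real (card (A - B)) \<le> real (card U) * real n + (\<Sum>i<r. real (card (?W i)))" by simp
  have "card B \<le> turan_number n r"
    unfolding B_def turan_number_def num_edges_def by (rule card_image_le[OF nvertexD(2)[OF nvertex_turan]])
  moreover have "card B = card (B - A) + card (A \<inter> B)"
    using card_Diff_subset_Int[of B A] fB card_mono[of B "B \<inter> A"] by (simp add: Int_commute)
  moreover have "card A = card (A - B) + card (A \<inter> B)"
    using card_Diff_subset_Int[of A B] fA card_mono[of A "A \<inter> B"] by simp
  ultimately have BA: "real (card (B - A)) \<le> real (turan_number n r) - real (num_edges G) + real (card (A - B))"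
    by (simp add: num_edges_def A_def)
  have "edit_dist G ?T \<le> card ((A - B) \<union> (B - A))"
    unfolding A_def B_def
    by (rule edit_dist_le) (use \<phi> nvertexD(1,2)[OF G] nvertexD(1,2)[OF nvertex_turan[of n r]] in auto)
  also have "\<dots> \<le> card (A - B) + card (B - A)" by (rule card_Un_le)
  finally have "real (edit_dist G ?T) \<le> real (card (A - B)) + real (card (B - A))" by linarith
  then show ?thesis using AB BA by (simp add: U_def)
qed

text \<open>Parts must shrink to n div r to fit into every residue class. As n/r \<le> n div r + 1,
  trimming costs at most c + 1 vertices per part.\<close>

lemma shrink_parts:
  fixes V :: "nat \<Rightarrow> nat set"
  assumes r: "r \<ge> 1" and V: "\<And>i. i < r \<Longrightarrow> V i \<subseteq> {..<n}"
    and size: "\<And>i. i < r \<Longrightarrow> real (card (V i)) \<le> real n / real r + c" and c: "0 \<le> c"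
  shows "\<exists>V'. (\<forall>i<r. V' i \<subseteq> V i \<and> card (V' i) \<le> n div r) \<and>
    real (card ({..<n} - (\<Union>i<r. V' i))) \<le> real (card ({..<n} - (\<Union>i<r. V i))) + real r * (c + 1)"
proof -
  have fin: "finite (V i)" if "i < r" for i using finite_subset[OF V[OF that]] by simp
  have "\<exists>W. W \<subseteq> V i \<and> card W = min (card (V i)) (n div r)" if "i < r" for i
    by (meson min.cobounded1 obtain_subset_with_card_n)
  then obtain V' where V': "\<And>i. i < r \<Longrightarrow> V' i \<subseteq> V i \<and> card (V' i) = min (card (V i)) (n div r)"
    by metis
  have "n = r * (n div r) + n mod r" by simp
  moreover have "n mod r < r" using r by simp
  ultimately have "n \<le> r * (n div r) + r" by linarith
  then have "real n \<le> real (r * (n div r) + r)" by (rule of_nat_mono)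
  then have "real n / real r \<le> real (n div r) + 1" using r by (simp add: field_simps)
  then have loss: "real (card (V i - V' i)) \<le> c + 1" if "i < r" for i
  proof -
    have "finite (V' i)" using fin[OF that] V'[OF that] finite_subset by blast
    then have "card (V i - V' i) = card (V i) - card (V' i)" using V'[OF that] by (simp add: card_Diff_subset)
    then show ?thesis
      using V'[OF that] size[OF that] c \<open>real n / real r \<le> real (n div r) + 1\<close> by (simp add: min_def of_nat_diff)
  qed
  have "card ({..<n} - (\<Union>i<r. V' i)) \<le> card (({..<n} - (\<Union>i<r. V i)) \<union> (\<Union>i<r. V i - V' i))"
    using fin by (intro card_mono) auto
  also have "\<dots> \<le> card ({..<n} - (\<Union>i<r. V i)) + card (\<Union>i<r. V i - V' i)" by (rule card_Un_le)
  also have "card (\<Union>i<r. V i - V' i) \<le> (\<Sum>i<r. card (V i - V' i))" by (rule card_UN_le) simp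
  finally have "card ({..<n} - (\<Union>i<r. V' i)) \<le> card ({..<n} - (\<Union>i<r. V i)) + (\<Sum>i<r. card (V i - V' i))"
    by simp
  then have "real (card ({..<n} - (\<Union>i<r. V' i))) \<le> real (card ({..<n} - (\<Union>i<r. V i)) + (\<Sum>i<r. card (V i - V' i)))"
    by (rule of_nat_mono)
  also have "\<dots> = real (card ({..<n} - (\<Union>i<r. V i))) + (\<Sum>i<r. real (card (V i - V' i)))" by simp
  also have "(\<Sum>i<r. real (card (V i - V' i))) \<le> (\<Sum>i<r. c + 1)" using loss by (intro sum_mono) auto
  finally have "real (card ({..<n} - (\<Union>i<r. V' i))) \<le> real (card ({..<n} - (\<Union>i<r. V i))) + real r * (c + 1)"
    by simp
  with V' show ?thesis by (intro exI[of _ V']) simp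
qed

lemma stability:
  fixes F :: "'f graph"
  assumes F: "simple_graph F" "chromatic_number F = r + 1" and r: "r \<ge> 1" and \<gamma>: "\<gamma> > 0"
  shows "\<exists>\<epsilon>>0. \<exists>N. \<forall>n\<ge>N. \<forall>G. nvertex_graph n G \<and> free_of F G \<and>
      (1 - 1 / real r - \<epsilon>) * real n ^ 2 \<le> 2 * real (num_edges G) \<longrightarrow>
      real (edit_dist G (turan_graph n r)) \<le> \<gamma> * real n ^ 2"
proof -
  \<comment> \<open>The first bound gives \<eta> \<le> 1/2 and the condition on r \<eta> in
    \<open>near_multipartite\<close>. The second gives (4 r + 6) \<eta> \<le> \<gamma>/3: the
    leftover fraction (r + 2) \<eta> grows by r \<eta> on trimming, the inner edges add \<eta>, and
    the edit distance doubles the sum.\<close>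
  define \<eta> where "\<eta> = min (1 / (2 * real r ^ 2)) (\<gamma> / (3 * (4 * real r + 6)))"
  have \<eta>0: "\<eta> > 0" using r \<gamma> by (simp add: \<eta>_def)
  have "1 / (2 * real r ^ 2) \<le> 1 / 2" using r by (simp add: field_simps)
  then have \<eta>1: "\<eta> \<le> 1 / 2" unfolding \<eta>_def by linarith
  have "real r * \<eta> \<le> real r * (1 / (2 * real r ^ 2))" unfolding \<eta>_def by (intro mult_left_mono) auto
  also have "\<dots> = 1 / (2 * real r)" using r by (simp add: power2_eq_square)
  finally have \<eta>2: "real r * \<eta> \<le> 1 / (2 * real r)" .
  have "(4 * real r + 6) * \<eta> \<le> (4 * real r + 6) * (\<gamma> / (3 * (4 * real r + 6)))"
    unfolding \<eta>_def by (intro mult_left_mono) auto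
  also have "\<dots> = \<gamma> / 3" using r by (simp add: field_simps)
  finally have \<eta>3: "(4 * real r + 6) * \<eta> \<le> \<gamma> / 3" .
  \<comment> \<open>\<eta>^3/2 is the deficit that \<open>few_low_degree\<close> tolerates;
    \<gamma>/3 keeps t(n,r) - e(G) within \<gamma> n^2 / 3.\<close>
  define \<epsilon> where "\<epsilon> = min (\<eta> ^ 3 / 2) (\<gamma> / 3)"
  have \<epsilon>: "\<epsilon> > 0" "\<epsilon> \<le> \<eta> ^ 3 / 2" "\<epsilon> \<le> \<gamma> / 3" using \<eta>0 \<gamma> by (auto simp: \<epsilon>_def)
  \<comment> \<open>Solves the hypothesis \<open>few\<close> of \<open>near_multipartite\<close> for
    the clique density.\<close>
  define \<beta> where "\<beta> = \<eta> * (1 / (2 * real r)) ^ r / (real r + 1)"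
  have \<beta>: "\<beta> > 0" using \<eta>0 r by (simp add: \<beta>_def)
  have \<gamma>3: "\<gamma> / 3 > 0" using \<gamma> by simp
  obtain N1 where N1: "\<forall>n\<ge>N1. \<forall>G. nvertex_graph n G \<and> free_of F G \<and>
      (1 - 1 / real r - \<eta> ^ 3 / 2) * real n ^ 2 \<le> 2 * real (num_edges G) \<longrightarrow>
      real (card {v\<in>{..<n}. real (card (nbrs G v)) < (1 - 1 / real r - \<eta>) * real n}) \<le> \<eta> * real n"
    using few_low_degree[OF F r \<eta>0 \<eta>1] ..
  obtain N2 where N2: "\<forall>n\<ge>N2. \<forall>G. nvertex_graph n G \<and> free_of F G \<longrightarrow>
    real (card (clique_lists (adj G) {..<n} (r + 1))) < \<beta> * real n ^ (r + 1)"
    using few_cliques[OF F \<beta>] ..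
  obtain N3 where N3: "\<forall>n\<ge>N3. \<forall>G. nvertex_graph n G \<and> free_of F G \<longrightarrow>
      2 * real (num_edges G) \<le> (1 - 1 / real r + \<gamma> / 3) * real n ^ 2"
    using edges_upper[OF F r \<gamma>3] ..
  \<comment> \<open>The last bound absorbs the up to r vertices lost to rounding when parts are
    trimmed: 2 r n \<le> \<gamma> n^2 / 3.\<close>
  define N where "N = max (max N1 N2) (max N3 (nat \<lceil>6 * real r / \<gamma>\<rceil> + 1))"
  have "real (edit_dist G (turan_graph n r)) \<le> \<gamma> * real n ^ 2"
    if n: "N \<le> n" and G: "nvertex_graph n G" "free_of F G"
      and e: "(1 - 1 / real r - \<epsilon>) * real n ^ 2 \<le> 2 * real (num_edges G)" for n G
  proof -
    have nN: "N1 \<le> n" "N2 \<le> n" "N3 \<le> n" "nat \<lceil>6 * real r / \<gamma>\<rceil> + 1 \<le> n" using n by (auto simp: N_def)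
    then have n0: "n > 0" and n6: "6 * real r / \<gamma> \<le> real n" by linarith+
    define S where "S = {v\<in>{..<n}. \<not> real (card (nbrs G v)) < (1 - 1 / real r - \<eta>) * real n}"
    have "(1 - 1 / real r - \<eta> ^ 3 / 2) * real n ^ 2 \<le> (1 - 1 / real r - \<epsilon>) * real n ^ 2"
      using \<epsilon> by (intro mult_right_mono) auto
    then have "(1 - 1 / real r - \<eta> ^ 3 / 2) * real n ^ 2 \<le> 2 * real (num_edges G)" using e by linarith
    then have "real (card {v\<in>{..<n}. real (card (nbrs G v)) < (1 - 1 / real r - \<eta>) * real n}) \<le> \<eta> * real n"
      using N1 nN(1) G by blast
    moreover have "{..<n} - S = {v\<in>{..<n}. real (card (nbrs G v)) < (1 - 1 / real r - \<eta>) * real n}"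
      by (auto simp: S_def)
    ultimately have S1: "real (card ({..<n} - S)) \<le> \<eta> * real n" by simp
    have S2: "(1 - 1 / real r - \<eta>) * real n \<le> real (card (nbrs G v))" if "v \<in> S" for v
      using that by (simp add: S_def)
    have S0: "S \<subseteq> {..<n}" by (auto simp: S_def)
    have "real (card (clique_lists (adj G) {..<n} (r + 1))) < \<beta> * real n ^ (r + 1)"
      using N2 nN(2) G by blast
    then have "(real r + 1) * real (card (clique_lists (adj G) {..<n} (r + 1))) \<le> (real r + 1) * (\<beta> * real n ^ (r + 1))"
      by (intro mult_left_mono) auto
    also have "\<dots> = \<eta> * (1 / (2 * real r)) ^ r * real n ^ (r + 1)"
      unfolding \<beta>_def by (simp del: power_Suc)
    finally have few: "(real r + 1) * real (card (clique_lists (adj G) {..<n} (r + 1)))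
        \<le> \<eta> * (1 / (2 * real r)) ^ r * real n ^ (r + 1)" .
    from near_multipartite[OF G(1) n0 r S0 \<eta>0 \<eta>2 S1 S2 few]
    obtain V where V0: "(\<forall>i<r. V i \<subseteq> {..<n} \<and> real (card (V i)) \<le> (1 / real r + \<eta>) * real n) \<and>
      (\<forall>i<r. \<forall>j<r. i \<noteq> j \<longrightarrow> V i \<inter> V j = {}) \<and>
      real (card ({..<n} - (\<Union>i<r. V i))) \<le> (real r + 2) * \<eta> * real n \<and>
      (\<Sum>i<r. real (card {(u, v). u \<in> V i \<and> v \<in> V i \<and> adj G u v})) \<le> \<eta> * real n ^ 2" ..
    then have V_rest: "real (card ({..<n} - (\<Union>i<r. V i))) \<le> (real r + 2) * \<eta> * real n"
      and V_inner: "(\<Sum>i<r. real (card {(u, v). u \<in> V i \<and> v \<in> V i \<and> adj G u v})) \<le> \<eta> * real n ^ 2"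
      by simp_all
    have Vn: "V i \<subseteq> {..<n}" if "i < r" for i using V0 that by blast
    have Vs: "real (card (V i)) \<le> real n / real r + \<eta> * real n" if "i < r" for i
    proof -
      have "real (card (V i)) \<le> (1 / real r + \<eta>) * real n" using V0 that by blast
      then show ?thesis by (simp add: distrib_right)
    qed
    have \<eta>n: "0 \<le> \<eta> * real n" using \<eta>0 by simp
    from shrink_parts[OF r Vn Vs \<eta>n]
    obtain V' where V'0: "(\<forall>i<r. V' i \<subseteq> V i \<and> card (V' i) \<le> n div r) \<and>
      real (card ({..<n} - (\<Union>i<r. V' i))) \<le> real (card ({..<n} - (\<Union>i<r. V i))) + real r * (\<eta> * real n + 1)" ..
    have V'V: "V' i \<subseteq> V i" and V's: "card (V' i) \<le> n div r" if "i < r" for i using V'0 that by blast+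
    have V'n: "V' i \<subseteq> {..<n}" if "i < r" for i using Vn[OF that] V'V[OF that] by blast
    have V'd: "V' i \<inter> V' j = {}" if "i < r" "j < r" "i \<noteq> j" for i j
    proof -
      have "V i \<inter> V j = {}" using V0 that by blast
      then show ?thesis using V'V[OF that(1)] V'V[OF that(2)] by blast
    qed
    from bijection_to_residue_classes[OF V'n V'd V's]
    obtain \<psi> where "bij_betw \<psi> {..<n} {..<n} \<and> (\<forall>i<r. \<forall>x\<in>V' i. \<psi> x mod r = i)" ..
    then have \<psi>: "bij_betw \<psi> {..<n} {..<n}" "\<And>i x. i < r \<Longrightarrow> x \<in> V' i \<Longrightarrow> \<psi> x mod r = i"
      by blast+
    define U where "U = real (card ({..<n} - (\<Union>i<r. V' i)))"
    define I where "I = (\<Sum>i<r. real (card {(u, v). u \<in> V' i \<and> v \<in> V' i \<and> adj G u v}))"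
    have "I \<le> (\<Sum>i<r. real (card {(u, v). u \<in> V i \<and> v \<in> V i \<and> adj G u v}))"
      unfolding I_def
    proof (intro sum_mono of_nat_mono card_mono)
      fix i assume "i \<in> {..<r}"
      then show "{(u, v). u \<in> V' i \<and> v \<in> V' i \<and> adj G u v} \<subseteq> {(u, v). u \<in> V i \<and> v \<in> V i \<and> adj G u v}"
        using V'V by blast
      show "finite {(u, v). u \<in> V i \<and> v \<in> V i \<and> adj G u v}"
        by (rule finite_subset[of _ "{..<n} \<times> {..<n}"]) (auto dest: nvertexD(4)[OF G(1)])
    qed
    then have I: "I \<le> \<eta> * real n ^ 2" using V_inner by linarith
    have "U \<le> (2 * real r + 2) * \<eta> * real n + real r"
      using V'0 V_rest by (simp add: U_def algebra_simps)
    then have "U * real n \<le> ((2 * real r + 2) * \<eta> * real n + real r) * real n"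
      by (intro mult_right_mono) auto
    then have U: "U * real n \<le> (2 * real r + 2) * \<eta> * real n ^ 2 + real r * real n"
      by (simp add: power2_eq_square algebra_simps)
    \<comment> \<open>The Turan graph is itself \<open>F\<close>-free, so the general edge bound
      supplies the upper estimate for t(n,r).\<close>
    have "2 * real (turan_number n r) \<le> (1 - 1 / real r + \<gamma> / 3) * real n ^ 2"
      using N3 nN(3) nvertex_turan free_of_turan[OF F r] unfolding turan_number_def by blast
    moreover have "(1 - 1 / real r + \<gamma> / 3) * real n ^ 2 - (1 - 1 / real r - \<epsilon>) * real n ^ 2 = (\<gamma> / 3 + \<epsilon>) * real n ^ 2"
      by (simp add: algebra_simps)
    moreover have "(\<gamma> / 3 + \<epsilon>) * real n ^ 2 \<le> (2 * (\<gamma> / 3)) * real n ^ 2"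
      using \<epsilon> by (intro mult_right_mono) auto
    ultimately have T: "real (turan_number n r) - real (num_edges G) \<le> \<gamma> / 3 * real n ^ 2"
      using e by linarith
    have "6 * real r \<le> \<gamma> * real n" using n6 \<gamma> by (simp add: field_simps)
    then have "6 * real r * real n \<le> \<gamma> * real n * real n" by (intro mult_right_mono) auto
    then have rn: "2 * (real r * real n) \<le> \<gamma> / 3 * real n ^ 2" by (simp add: power2_eq_square)
    define a b g where "a = (2 * real r + 2) * \<eta> * real n ^ 2" and "b = \<eta> * real n ^ 2"
      and "g = \<gamma> / 3 * real n ^ 2"
    have "2 * a + 2 * b = (4 * real r + 6) * \<eta> * real n ^ 2"
      by (simp add: a_def b_def algebra_simps)
    also have "\<dots> \<le> g" unfolding g_def using \<eta>3 by (intro mult_right_mono) auto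
    finally have ab: "2 * a + 2 * b \<le> g" .
    define t where "t = real (turan_number n r) - real (num_edges G)"
    define m where "m = real r * real n"
    have "real (edit_dist G (turan_graph n r)) \<le> 2 * (U * real n + I) + real (turan_number n r) - real (num_edges G)"
      unfolding U_def I_def by (rule edit_dist_turan_le[OF G(1) \<psi> V'n])
    then have "real (edit_dist G (turan_graph n r)) \<le> 2 * (U * real n) + 2 * I + t" by (simp add: t_def)
    moreover have "U * real n \<le> a + m" using U by (simp only: a_def m_def)
    moreover have "I \<le> b" using I by (simp only: b_def)
    moreover have "t \<le> g" "2 * m \<le> g" using T rn by (simp_all only: g_def t_def m_def)
    ultimately have "real (edit_dist G (turan_graph n r)) \<le> 3 * g" using ab by linarith
    then show ?thesis by (simp add: g_def)
  qed
  then show ?thesis using \<epsilon>(1) by blast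
qed

text \<open>Turns bounds whose threshold N does not depend on the parameter x into one function g of
  n alone: the maximum over the finitely many parameters. Inserting 0 keeps \<open>Max\<close>
  meaningful when \<open>S n\<close> is empty and makes g nonnegative.\<close>

lemma smallo_envelope:
  fixes q :: "nat \<Rightarrow> 'a \<Rightarrow> real"
  assumes fin: "\<And>n. finite (S n)" and f: "\<And>n. f n \<ge> (0::real)"
    and bd: "\<And>c. c > 0 \<Longrightarrow> \<exists>N. \<forall>n\<ge>N. \<forall>x\<in>S n. q n x \<le> c * f n"
  shows "\<exists>g. g \<in> o(f) \<and> (\<forall>n. \<forall>x\<in>S n. q n x \<le> g n)"
proof -
  define g where "g n = Max (insert 0 (q n ` S n))" for n
  have fin': "finite (insert 0 (q n ` S n))" for n using fin by simp
  have "g \<in> o(f)"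
  proof (rule landau_o.smallI)
    fix c :: real assume c: "c > 0"
    then obtain N where N: "\<forall>n\<ge>N. \<forall>x\<in>S n. q n x \<le> c * f n" using bd by blast
    show "\<forall>\<^sub>F n in sequentially. norm (g n) \<le> c * norm (f n)"
    proof (rule eventually_sequentiallyI[of N])
      fix n assume n: "N \<le> n"
      have "0 \<le> g n" unfolding g_def using fin' by (intro Max_ge) auto
      moreover have "g n \<le> c * f n"
        unfolding g_def using fin' n N c f by (intro Max.boundedI) auto
      ultimately show "norm (g n) \<le> c * norm (f n)" using f[of n] by simp
    qed
  qed
  moreover have "q n x \<le> g n" if "x \<in> S n" for n x
    unfolding g_def using fin' that by (intro Max_ge) auto
  ultimately show ?thesis by blast
qed

section \<open>A star inside a part of the Turan graph\<close>

lemma vdegree_eq: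
  assumes G: "nvertex_graph n G"
  shows "vdegree G v = card (nbrs G v)"
proof -
  have "{e \<in> edges G. v \<in> e} = (\<lambda>u. {v, u}) ` nbrs G v"
  proof (rule subset_antisym; rule subsetI)
    fix e assume e: "e \<in> {e \<in> edges G. v \<in> e}"
    then obtain a b where "e = {a, b}" using nvertexD(3)[OF G, of e] by (auto simp: card_2_iff)
    then have "e = {v, a} \<or> e = {v, b}" using e by auto
    then show "e \<in> (\<lambda>u. {v, u}) ` nbrs G v" using e by (auto simp: nbrs_def)
  qed (auto simp: nbrs_def)
  moreover have "inj_on (\<lambda>u. {v, u}) (nbrs G v)" by (auto simp: inj_on_def doubleton_eq_iff)
  ultimately show ?thesis by (simp add: vdegree_def card_image)
qed

lemma spectral_radius_ge_average_degree:
  assumes G: "nvertex_graph n G" and n: "n > 0"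
  shows "2 * real (num_edges G) / real n \<le> graph_spectral_radius G"
proof -
  let ?s = "1 / sqrt (real n)"
  have "quad_form {..<n} (adj G) (\<lambda>v. ?s * 1) \<le> graph_spectral_radius G"
    by (rule quad_form_le_spectral_radius[OF G]) (use n in \<open>simp add: power_divide\<close>)
  then show ?thesis unfolding quad_form_scale quad_form_one[OF G] by (simp add: power_divide)
qed

text \<open>The centre is the last vertex because deleting it leaves
  \<open>turan_graph (n - 1) r\<close> without relabelling.\<close>

definition starred_turan :: "nat \<Rightarrow> nat \<Rightarrow> nat set \<Rightarrow> nat graph" where
  "starred_turan n r Y = Graph {..<n} (edges (turan_graph n r) \<union> (\<lambda>y. {n - 1, y}) ` Y)"

locale star_in_turan =
  fixes n r :: nat and Y :: "nat set"
  assumes n: "n > 0" and r: "r \<ge> 1"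
    and Y: "Y \<subseteq> {x. x < n \<and> x mod r = (n - 1) mod r} - {n - 1}"
begin

abbreviation "T \<equiv> turan_graph n r"
abbreviation "J \<equiv> starred_turan n r Y"
abbreviation "z \<equiv> n - 1"

lemma Y': "y < n" "y mod r = z mod r" "y \<noteq> z" if "y \<in> Y" for y
  using Y that by auto

lemma finite_Y: "finite Y"
  by (rule finite_subset[of _ "{..<n}"]) (use Y' in auto)

lemma nvertex_J: "nvertex_graph n J"
proof -
  have "\<And>e. e \<in> edges T \<Longrightarrow> e \<subseteq> {..<n} \<and> card e = 2" by (rule nvertexD(3)[OF nvertex_turan])
  moreover have "{z, y} \<subseteq> {..<n}" "card {z, y} = 2" if "y \<in> Y" for y
    using Y'(1)[OF that] not_sym[OF Y'(3)[OF that]] n by simp_all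
  ultimately show ?thesis
    unfolding nvertex_graph_def simple_graph_def starred_turan_def by auto
qed

lemma edges_J: "edges J = edges T \<union> (\<lambda>y. {z, y}) ` Y"
  by (simp add: starred_turan_def)

lemma adj_J: "adj J u v \<longleftrightarrow> adj T u v \<or> u = z \<and> v \<in> Y \<or> v = z \<and> u \<in> Y"
  by (auto simp: edges_J doubleton_eq_iff)

text \<open>\<open>card Y\<close> is what the centre lacks: its Turan degree is n - |W| for its
  class W. The truncated subtraction is exact because \<Delta> \<ge> n - n div r \<ge> n - |W|.
  Vertices that are neither centre nor leaf keep their Turan degree, at most n - n div r.\<close>

lemma J_in_family:
  assumes t: "t \<ge> 1" and Delta: "n - n div r \<le> \<Delta>" "\<Delta> \<le> n - 1"
    and card_Y: "card Y = \<Delta> - (n - card {x. x < n \<and> x mod r = z mod r})"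
  shows "J \<in> J_family_eq t n \<Delta> r"
proof -
  define W where "W = {x. x < n \<and> x mod r = z mod r}"
  have W: "n div r \<le> card W" unfolding W_def using r by (intro card_residue_class) simp
  have "z \<in> W" using n by (simp add: W_def)
  have degT: "card (nbrs T v) \<le> n - n div r" if "v < n" for v
    using turan_degree[OF that, of r] card_residue_class(1)[of "v mod r" r n] r by simp
  have fT: "finite (nbrs T v)" for v by (rule finite_subset[OF nbrs_nvertex[OF nvertex_turan]]) simp
  have "nbrs J z = nbrs T z \<union> Y" using Y' by (auto simp: nbrs_def adj_J)
  moreover have "nbrs T z \<inter> Y = {}" using Y' by (auto simp: nbrs_def adj_turan)
  ultimately have "card (nbrs J z) = card (nbrs T z) + card Y"
    using fT finite_Y by (simp add: card_Un_disjoint)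
  also have "card (nbrs T z) = n - card W" using turan_degree[of z n r] n by (simp add: W_def)
  finally have degz: "card (nbrs J z) = \<Delta>" using card_Y Delta W by (simp add: W_def)
  have deg: "card (nbrs J v) \<le> \<Delta>" if v: "v < n" for v
  proof -
    consider "v = z" | "v \<in> Y" | "v \<noteq> z" "v \<notin> Y" by blast
    then show ?thesis
    proof cases
      case 1 then show ?thesis using degz by simp
    next
      case 2
      have "card (nbrs J v) \<le> card (nbrs T v \<union> {z})"
        using 2 Y' fT by (intro card_mono) (auto simp: nbrs_def adj_J)
      also have "\<dots> \<le> card (nbrs T v) + 1" using card_Un_le[of "nbrs T v" "{z}"] by simp
      also have "card (nbrs T v) = n - card W"
        using turan_degree[OF v, of r] Y'[OF 2] by (simp add: W_def)
      also have "n - card W + 1 \<le> \<Delta>"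
      proof -
        \<comment> \<open>A leaf gains one edge, and the existence of a leaf means \<Delta> > n -
          |W|, which pays for it.\<close>
        have "0 < card Y" using 2 finite_Y by (auto simp: card_gt_0_iff)
        then show ?thesis using card_Y by (simp add: W_def)
      qed
      finally show ?thesis .
    next
      case 3
      then have "nbrs J v = nbrs T v" by (auto simp: nbrs_def adj_J)
      then show ?thesis using degT[OF v] Delta by simp
    qed
  qed
  have vJ: "verts J = {..<n}" by (simp add: starred_turan_def)
  have maxd: "max_degree J = \<Delta>"
    unfolding max_degree_def vJ vdegree_eq[OF nvertex_J]
  proof (rule Max_eqI)
    show "\<Delta> \<in> (\<lambda>v. card (nbrs J v)) ` {..<n}" using degz n by (intro image_eqI[of _ _ z]) auto
  qed (use deg in auto)
  have ind: "independent_set J {z}"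
    unfolding independent_set_def
  proof (intro conjI ballI notI)
    fix e assume "e \<in> edges J" "e \<subseteq> {z}"
    then have "card e = 2" "card e \<le> card {z}"
      using nvertexD(3)[OF nvertex_J, of e] card_mono[of "{z}" e] by auto
    then show False by simp
  qed (use n in \<open>simp add: vJ\<close>)
  have "edges (delete_verts J {z}) = edges (turan_graph (n - 1) r)"
  proof -
    have "edges (delete_verts J {z}) = {e \<in> edges T. z \<notin> e}" by (auto simp: delete_verts_def edges_J)
    also have "\<dots> = edges (turan_graph (n - 1) r)"
    proof (rule subset_antisym; rule subsetI)
      fix e assume e: "e \<in> {e \<in> edges T. z \<notin> e}"
      then obtain x y where xy: "e = {x, y}" "x < n" "y < n" "x mod r \<noteq> y mod r" by (auto simp: turan_graph_def)
      then have "x < n - 1" "y < n - 1" using e by auto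
      then show "e \<in> edges (turan_graph (n - 1) r)" using xy by (auto simp: turan_graph_def)
    next
      fix e assume "e \<in> edges (turan_graph (n - 1) r)"
      then obtain x y where "e = {x, y}" "x < n - 1" "y < n - 1" "x mod r \<noteq> y mod r" by (auto simp: turan_graph_def)
      then show "e \<in> {e \<in> edges T. z \<notin> e}" by (auto simp: adj_turan)
    qed
    finally show ?thesis .
  qed
  moreover have "verts (delete_verts J {z}) = verts (turan_graph (n - 1) r)"
    using n by (auto simp: delete_verts_def vJ turan_graph_def)
  ultimately have "graph_iso (delete_verts J {z}) (turan_graph (n - card {z}) r)"
    unfolding graph_iso_def by (intro exI[of _ id]) (simp add: bij_betw_def)
  then have "J \<in> J_family t n \<Delta> r"
    unfolding J_family_def using ind t maxd nvertex_J by (intro CollectI conjI exI[of _ "{z}"]) auto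
  then show ?thesis using maxd by (simp add: J_family_eq_def)
qed

lemma J_free:
  assumes F: "simple_graph F" "chromatic_number F = r + 1" and a: "a_param F > 1"
  shows "free_of F J"
  unfolding free_of_def
proof
  assume "contains_copy J F"
  then obtain f where f: "inj_on f (verts F)" "\<And>e. e \<in> edges F \<Longrightarrow> f ` e \<in> edges J"
    by (auto simp: contains_copy_def)
  have finF: "finite (verts F)" using F by (simp add: simple_graph_def)
  \<comment> \<open>\<open>I\<close> is empty if the copy avoids the centre and a singleton
    otherwise; either way it is independent and |I| < a(F).\<close>
  define I where "I = {v\<in>verts F. f v = z}"
  have I1: "card I \<le> 1"
  proof -
    have "inj_on f I" using f(1) by (rule inj_on_subset) (auto simp: I_def)
    moreover have "f ` I \<subseteq> {z}" by (auto simp: I_def)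
    ultimately show ?thesis using card_inj_on_le[of f I "{z}"] by simp
  qed
  have "independent_set F I"
    unfolding independent_set_def
  proof (intro conjI ballI notI)
    fix e assume e: "e \<in> edges F" "e \<subseteq> I"
    have "finite I" using finF by (simp add: I_def)
    then have "card e \<le> card I" using e by (intro card_mono)
    moreover have "card e = 2" using F e by (auto simp: simple_graph_def)
    ultimately show False using I1 by simp
  qed (auto simp: I_def)
  moreover have "proper_colouring (delete_verts F I) r (\<lambda>v. f v mod r)"
    unfolding proper_colouring_def
  proof (intro conjI allI impI)
    fix x y assume "{x, y} \<in> edges (delete_verts F I)"
    then have xy: "{x, y} \<in> edges F" "x \<notin> I" "y \<notin> I" by (auto simp: delete_verts_def)
    have "{x, y} \<subseteq> verts F" using F xy(1) unfolding simple_graph_def by blast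
    then have "f x \<noteq> z" "f y \<noteq> z" using xy by (auto simp: I_def)
    moreover have "adj J (f x) (f y)" using f(2)[OF xy(1)] by simp
    ultimately show "f x mod r \<noteq> f y mod r" by (auto simp: adj_J adj_turan)
  qed (use r in auto)
  then have "chromatic_number (delete_verts F I) \<le> chromatic_number F - 1"
    using chromatic_number_le F(2) by fastforce
  ultimately have "card I \<in> card ` {I. independent_set F I \<and>
     chromatic_number (delete_verts F I) \<le> chromatic_number F - 1}" by blast
  moreover have "finite (card ` {I. independent_set F I \<and>
     chromatic_number (delete_verts F I) \<le> chromatic_number F - 1})"
    by (rule finite_imageI, rule finite_subset[of _ "Pow (verts F)"])
      (use finF in \<open>auto simp: independent_set_def\<close>)
  ultimately have "a_param F \<le> card I" unfolding a_param_def by (rule Min_le[rotated])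
  then show False using a I1 by simp
qed

lemma card_Y_le: "card Y \<le> n"
  using card_mono[of "{..<n}" Y] Y' by auto

lemma finite_edges: "finite (edges T)" "finite (edges J)"
  by (rule nvertexD(2)[OF nvertex_turan], rule nvertexD(2)[OF nvertex_J])

lemma num_edges_J: "num_edges T \<le> num_edges J" "num_edges J \<le> num_edges T + n"
proof -
  show "num_edges T \<le> num_edges J"
    unfolding num_edges_def by (intro card_mono finite_edges) (auto simp: edges_J)
  have "card (edges J) \<le> card (edges T) + card ((\<lambda>y. {z, y}) ` Y)"
    unfolding edges_J by (rule card_Un_le)
  also have "\<dots> \<le> card (edges T) + n" using card_image_le[OF finite_Y] card_Y_le order_trans by fastforce
  finally show "num_edges J \<le> num_edges T + n" by (simp add: num_edges_def)
qed

lemma edit_dist_J: "edit_dist J T \<le> n"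
proof -
  have "edit_dist J T \<le> card ((edges J - (`) id ` edges T) \<union> ((`) id ` edges T - edges J))"
    by (rule edit_dist_le) (use finite_edges in \<open>auto simp: starred_turan_def turan_graph_def\<close>)
  also have "\<dots> \<le> card ((\<lambda>y. {z, y}) ` Y)"
    using finite_Y by (intro card_mono) (auto simp: edges_J)
  also have "\<dots> \<le> card Y" by (rule card_image_le[OF finite_Y])
  finally show ?thesis using card_Y_le by simp
qed

lemma spectral_radius_T_le_J: "graph_spectral_radius T \<le> graph_spectral_radius J"
proof -
  obtain x where x: "\<And>i. x i \<ge> (0::real)" "(\<Sum>i<n. (x i)\<^sup>2) = 1"
    "\<And>i. i < n \<Longrightarrow> graph_spectral_radius T * x i \<le> (\<Sum>j<n. of_bool (adj T i j) * x j)"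
    "graph_spectral_radius T \<le> quad_form {..<n} (adj T) x"
    by (rule spectral_radius_le_quad_form[OF nvertex_turan n]) blast
  note x(4)
  also have "quad_form {..<n} (adj T) x \<le> quad_form {..<n} (adj J) x"
    unfolding quad_form_def by (intro sum_mono mult_right_mono) (auto simp: x(1) adj_J)
  also have "\<dots> \<le> graph_spectral_radius J" by (rule quad_form_le_spectral_radius[OF nvertex_J x(2)])
  finally show ?thesis .
qed

text \<open>A vector optimal for the starred graph is tested on the Turan graph. The star adds at
  most twice x_z times the sum of x over Y, and by Cauchy-Schwarz for a unit vector that sum is at
  most the square root of |Y|.\<close>

lemma spectral_radius_J_le: "graph_spectral_radius J \<le> graph_spectral_radius T + 2 * sqrt (real n)"
proof -
  obtain x where x: "\<And>i. x i \<ge> (0::real)" "(\<Sum>i<n. (x i)\<^sup>2) = 1"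
    "\<And>i. i < n \<Longrightarrow> graph_spectral_radius J * x i \<le> (\<Sum>j<n. of_bool (adj J i j) * x j)"
    "graph_spectral_radius J \<le> quad_form {..<n} (adj J) x"
    by (rule spectral_radius_le_quad_form[OF nvertex_J n]) blast
  let ?b = "\<lambda>u v. of_bool (u = z) * x u * (of_bool (v \<in> Y) * x v)"
  have Yn: "{..<n} \<inter> Y = Y" using Y' by auto
  have "quad_form {..<n} (adj J) x
      \<le> (\<Sum>u<n. \<Sum>v<n. of_bool (adj T u v) * x u * x v + ?b u v + ?b v u)"
    unfolding quad_form_def by (intro sum_mono) (auto simp: x(1) adj_J)
  also have "\<dots> = quad_form {..<n} (adj T) x + (\<Sum>u<n. \<Sum>v<n. ?b u v) + (\<Sum>u<n. \<Sum>v<n. ?b v u)"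
    by (simp only: sum.distrib quad_form_def)
  also have "(\<Sum>u<n. \<Sum>v<n. ?b v u) = (\<Sum>u<n. \<Sum>v<n. ?b u v)" by (rule sum.swap)
  also have "(\<Sum>u<n. \<Sum>v<n. ?b u v) = x z * sum x Y"
  proof -
    have "(\<Sum>u<n. \<Sum>v<n. ?b u v) = (\<Sum>u<n. of_bool (u = z) * x u) * (\<Sum>v<n. of_bool (v \<in> Y) * x v)"
      by (rule sum_product[symmetric])
    also have "(\<Sum>u<n. of_bool (u = z) * x u) = x z"
    proof -
      have "{..<n} \<inter> {u. u = z} = {z}" using n by auto
      then show ?thesis by simp
    qed
    also have "(\<Sum>v<n. of_bool (v \<in> Y) * x v) = sum x Y" using Yn by simp
    finally show ?thesis .
  qed
  finally have "quad_form {..<n} (adj J) x \<le> quad_form {..<n} (adj T) x + 2 * (x z * sum x Y)" by linarith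
  moreover have "quad_form {..<n} (adj T) x \<le> graph_spectral_radius T"
    by (rule quad_form_le_spectral_radius[OF nvertex_turan x(2)])
  moreover have "x z * sum x Y \<le> 1 * sqrt (real n)"
  proof (rule mult_mono)
    have "(x z)\<^sup>2 \<le> (\<Sum>i<n. (x i)\<^sup>2)" using n by (intro member_le_sum) auto
    then have "(x z)\<^sup>2 \<le> 1\<^sup>2" using x(2) by simp
    then show "x z \<le> 1" by (rule power2_le_imp_le) simp
    have "(\<Sum>v\<in>Y. 1 * x v)\<^sup>2 \<le> (\<Sum>v\<in>Y. 1\<^sup>2) * (\<Sum>v\<in>Y. (x v)\<^sup>2)" by (rule Cauchy_Schwarz_ineq_sum)
    also have "\<dots> \<le> real n * 1"
    proof (rule mult_mono)
      have "(\<Sum>v\<in>Y. (x v)\<^sup>2) \<le> (\<Sum>v<n. (x v)\<^sup>2)" using Y' by (intro sum_mono2) auto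
      then show "(\<Sum>v\<in>Y. (x v)\<^sup>2) \<le> 1" using x(2) by simp
    qed (use card_Y_le in \<open>auto intro: sum_nonneg\<close>)
    finally show "sum x Y \<le> sqrt (real n)" by (intro real_le_rsqrt) simp
  qed (use x(1) in \<open>auto intro: sum_nonneg\<close>)
  ultimately show ?thesis using x(4) by linarith
qed

end

lemma ex_J:
  fixes F :: "'f graph"
  assumes F: "simple_graph F" "chromatic_number F = r + 1" and r: "r \<ge> 1" and a: "a_param F > 1"
    and n: "n > 0" and Delta: "n - n div r \<le> \<Delta>" "\<Delta> \<le> n - 1"
  obtains J where "J \<in> J_family_eq (a_param F - 1) n \<Delta> r" "free_of F J"
    "edit_dist J (turan_graph n r) \<le> n"
    "turan_number n r \<le> num_edges J" "num_edges J \<le> turan_number n r + n"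
    "graph_spectral_radius (turan_graph n r) \<le> graph_spectral_radius J"
    "graph_spectral_radius J \<le> graph_spectral_radius (turan_graph n r) + 2 * sqrt (real n)"
proof -
  define W where "W = {x. x < n \<and> x mod r = (n - 1) mod r}"
  have "W \<subseteq> {..<n}" by (auto simp: W_def)
  then have W: "finite W" "card W \<le> n" using card_mono[of "{..<n}" W] by (auto simp: finite_subset)
  have "n - 1 \<in> W" using n by (simp add: W_def)
  then have "card (W - {n - 1}) = card W - 1" "0 < card W" using W by (auto simp: card_gt_0_iff)
  \<comment> \<open>Here \<Delta> \<le> n - 1 enters: the class of the centre has |W| - 1 other
    vertices to serve as leaves.\<close>
  then have "\<Delta> - (n - card W) \<le> card (W - {n - 1})" using Delta W n by simp
  then obtain Y where Y: "Y \<subseteq> W - {n - 1}" "card Y = \<Delta> - (n - card W)"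
    by (metis obtain_subset_with_card_n)
  note card_Y = Y(2)[unfolded W_def]
  interpret star_in_turan n r Y
    by unfold_locales (use n r Y in \<open>auto simp: W_def\<close>)
  show thesis
  proof (rule that[of J])
    show "J \<in> J_family_eq (a_param F - 1) n \<Delta> r"
      by (rule J_in_family) (use a Delta card_Y in simp_all)
  qed (use J_free[OF F a] edit_dist_J num_edges_J spectral_radius_T_le_J spectral_radius_J_le
      in \<open>auto simp: turan_number_def\<close>)
qed

section \<open>Extremal values\<close>

lemma finite_free_family: "finite (free_family F n \<Delta>)"
proof -
  have "free_family F n \<Delta> \<subseteq> Graph {..<n} ` Pow (Pow {..<n})"
  proof
    fix G assume "G \<in> free_family F n \<Delta>"
    then have G: "nvertex_graph n G" by (simp add: free_family_def)
    then have "G = Graph {..<n} (edges G)" by (metis graph.collapse nvertexD(1))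
    moreover have "edges G \<in> Pow (Pow {..<n})" using nvertexD(3)[OF G] by blast
    ultimately show "G \<in> Graph {..<n} ` Pow (Pow {..<n})" by blast
  qed
  then show ?thesis by (rule finite_subset) simp
qed

text \<open>\<open>n - n div r\<close> is the ceiling of (r - 1) n / r, for n \<ge> r the maximum
  degree of T(n,r), in a form suited to natural numbers.\<close>

definition admissible_degrees :: "nat \<Rightarrow> nat \<Rightarrow> nat set" where
  "admissible_degrees r n = {\<Delta>. n - n div r \<le> \<Delta> \<and> \<Delta> \<le> n - 1}"

lemma mem_admissible_degrees:
  assumes r: "r \<ge> 1"
    and D: "\<lceil>(real r - 1) / real r * real n\<rceil> \<le> int \<Delta> \<and> \<Delta> \<le> n - 1"
  shows "\<Delta> \<in> admissible_degrees r n"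
proof -
  have "(real r - 1) / real r * real n \<le> real \<Delta>" using D by linarith
  then have "(real r - 1) * real n \<le> real r * real \<Delta>" using r by (simp add: field_simps)
  then have "real r * real n \<le> real r * real \<Delta> + real n" by (simp add: algebra_simps)
  then have "real (r * n) \<le> real (r * \<Delta> + n)" by simp
  then have "r * n \<le> r * \<Delta> + n" by (simp only: of_nat_le_iff)
  moreover have "(n - \<Delta>) * r = r * n - r * \<Delta>" by (simp only: diff_mult_distrib mult.commute[of r])
  ultimately have "(n - \<Delta>) * r \<le> n" by linarith
  then have "n - \<Delta> \<le> n div r" using r by (simp add: less_eq_div_iff_mult_less_eq)
  then show ?thesis using D by (auto simp: admissible_degrees_def)
qed

text \<open>Graphs are paired with their \<Delta> so that one finite set per n carries both extremal
  problems for all admissible \<Delta>, as \<open>smallo_envelope\<close> requires.\<close>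

definition extremal :: "'f graph \<Rightarrow> nat \<Rightarrow> nat \<Rightarrow> (nat \<times> nat graph) set" where
  "extremal F r n = (SIGMA \<Delta> : admissible_degrees r n. {G \<in> free_family F n \<Delta>.
     num_edges G = ex_num F n \<Delta> \<or> graph_spectral_radius G = spex_num F n \<Delta>})"

context
  fixes F :: "'f graph" and r :: nat
  assumes F: "simple_graph F" "chromatic_number F = r + 1" and r: "r \<ge> 1" and a: "a_param F > 1"
begin

text \<open>The starred Turan graph lies in the family, so both \<open>Max\<close> range over
  nonempty finite sets and are attained.\<close>

lemma extremal_values:
  assumes n: "n > 0" and D: "\<Delta> \<in> admissible_degrees r n"
  shows "turan_number n r \<le> ex_num F n \<Delta>"
    "graph_spectral_radius (turan_graph n r) \<le> spex_num F n \<Delta>"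
    "\<exists>G\<in>free_family F n \<Delta>. num_edges G = ex_num F n \<Delta>"
    "\<exists>G\<in>free_family F n \<Delta>. graph_spectral_radius G = spex_num F n \<Delta>"
proof -
  have "n - n div r \<le> \<Delta>" "\<Delta> \<le> n - 1" using D by (auto simp: admissible_degrees_def)
  from ex_J[OF F r a n this] obtain J where J: "J \<in> J_family_eq (a_param F - 1) n \<Delta> r" "free_of F J"
    "turan_number n r \<le> num_edges J"
    "graph_spectral_radius (turan_graph n r) \<le> graph_spectral_radius J" by metis
  have J': "J \<in> free_family F n \<Delta>" using J(1,2) by (simp add: J_family_eq_def J_family_def free_family_def)
  note fin = finite_free_family[of F n \<Delta>]
  have "num_edges J \<le> ex_num F n \<Delta>" unfolding ex_num_def using fin J' by (intro Max_ge) auto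
  then show "turan_number n r \<le> ex_num F n \<Delta>" using J(3) by simp
  have "graph_spectral_radius J \<le> spex_num F n \<Delta>" unfolding spex_num_def using fin J' by (intro Max_ge) auto
  then show "graph_spectral_radius (turan_graph n r) \<le> spex_num F n \<Delta>" using J(4) by simp
  have "ex_num F n \<Delta> \<in> num_edges ` free_family F n \<Delta>" unfolding ex_num_def using fin J' by (intro Max_in) auto
  then show "\<exists>G\<in>free_family F n \<Delta>. num_edges G = ex_num F n \<Delta>" by auto
  have "spex_num F n \<Delta> \<in> graph_spectral_radius ` free_family F n \<Delta>" unfolding spex_num_def using fin J' by (intro Max_in) auto
  then show "\<exists>G\<in>free_family F n \<Delta>. graph_spectral_radius G = spex_num F n \<Delta>" by auto
qed

lemma spectral_radius_turan_ge:
  assumes n: "n > 0"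
  shows "(1 - 1 / real r) * real n - 1 \<le> graph_spectral_radius (turan_graph n r)"
proof -
  have "((1 - 1 / real r) * real n ^ 2 - real n) / real n \<le> 2 * real (turan_number n r) / real n"
    using turan_edges_lower[OF r] by (intro divide_right_mono) auto
  also have "\<dots> \<le> graph_spectral_radius (turan_graph n r)"
    unfolding turan_number_def by (rule spectral_radius_ge_average_degree[OF nvertex_turan n])
  finally show ?thesis using n by (simp add: power2_eq_square diff_divide_distrib)
qed

lemma ex_num_asymp:
  assumes c: "c > 0"
  shows "\<exists>N. \<forall>n\<ge>N. \<forall>\<Delta>\<in>admissible_degrees r n. \<bar>real (ex_num F n \<Delta>) - real (turan_number n r)\<bar> \<le> c * real n ^ 2"
proof -
  obtain N where N: "\<forall>n\<ge>N. \<forall>G. nvertex_graph n G \<and> free_of F G \<longrightarrow>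
      2 * real (num_edges G) \<le> (1 - 1 / real r + c) * real n ^ 2"
    using edges_upper[OF F r c] ..
  \<comment> \<open>Twice the difference is at most c n^2 + n, and n \<ge> 1/c makes the rounding
    error n at most c n^2.\<close>
  have "\<bar>real (ex_num F n \<Delta>) - real (turan_number n r)\<bar> \<le> c * real n ^ 2"
    if n: "max N (nat \<lceil>1 / c\<rceil> + 1) \<le> n" and D: "\<Delta> \<in> admissible_degrees r n" for n \<Delta>
  proof -
    have nN: "N \<le> n" "nat \<lceil>1 / c\<rceil> + 1 \<le> n" using n by auto
    then have n0: "n > 0" and nc: "1 / c \<le> real n" by linarith+
    obtain G where G: "G \<in> free_family F n \<Delta>" "num_edges G = ex_num F n \<Delta>"
      using extremal_values(3)[OF n0 D] by blast
    then have "2 * real (ex_num F n \<Delta>) \<le> (1 - 1 / real r + c) * real n ^ 2"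
      using N nN(1) by (metis (no_types, lifting) free_family_def mem_Collect_eq)
    moreover have "(1 - 1 / real r) * real n ^ 2 - real n \<le> 2 * real (turan_number n r)"
      by (rule turan_edges_lower[OF r])
    moreover have "(1 - 1 / real r + c) * real n ^ 2 = (1 - 1 / real r) * real n ^ 2 + c * real n ^ 2"
      by (rule distrib_right)
    moreover have "real n \<le> c * real n ^ 2"
    proof -
      have "1 * real n \<le> (c * real n) * real n" using nc c by (intro mult_right_mono) (auto simp: field_simps)
      then show ?thesis by (simp add: power2_eq_square)
    qed
    moreover have "real (turan_number n r) \<le> real (ex_num F n \<Delta>)" using extremal_values(1)[OF n0 D] by simp
    ultimately show ?thesis by linarith
  qed
  then show ?thesis by blast
qed

lemma spex_num_asymp:
  assumes c: "c > 0"
  shows "\<exists>N. \<forall>n\<ge>N. \<forall>\<Delta>\<in>admissible_degrees r n. \<bar>spex_num F n \<Delta> - graph_spectral_radius (turan_graph n r)\<bar> \<le> c * real n"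
proof -
  have c2: "c / 2 > 0" using c by simp
  obtain N where N: "\<forall>n\<ge>N. \<forall>G. nvertex_graph n G \<and> free_of F G \<longrightarrow>
      graph_spectral_radius G \<le> (1 - 1 / real r + c / 2) * real n"
    using spectral_radius_upper[OF F r c2] ..
  have "\<bar>spex_num F n \<Delta> - graph_spectral_radius (turan_graph n r)\<bar> \<le> c * real n"
    if n: "max N (nat \<lceil>2 / c\<rceil> + 1) \<le> n" and D: "\<Delta> \<in> admissible_degrees r n" for n \<Delta>
  proof -
    have nN: "N \<le> n" "nat \<lceil>2 / c\<rceil> + 1 \<le> n" using n by auto
    then have n0: "n > 0" and nc: "2 / c \<le> real n" by linarith+
    obtain G where G: "G \<in> free_family F n \<Delta>" "graph_spectral_radius G = spex_num F n \<Delta>"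
      using extremal_values(4)[OF n0 D] by blast
    then have "spex_num F n \<Delta> \<le> (1 - 1 / real r + c / 2) * real n"
      using N nN(1) by (metis (no_types, lifting) free_family_def mem_Collect_eq)
    moreover have "(1 - 1 / real r + c / 2) * real n = (1 - 1 / real r) * real n + c / 2 * real n"
      by (rule distrib_right)
    moreover have "1 \<le> c / 2 * real n" using nc c by (simp add: field_simps)
    ultimately show ?thesis
      using spectral_radius_turan_ge[OF n0] extremal_values(2)[OF n0 D] by linarith
  qed
  then show ?thesis by blast
qed

text \<open>Reads \<rho>^2 \<le> (p + \<delta>) 2e backwards: \<rho> \<ge> p n - 1 leaves no room
  for 2e below (p - \<epsilon>) n^2. This hands spectral extremal graphs to the edge stability
  theorem.\<close>

lemma dense_if_spectral:
  assumes r2: "r \<ge> 2" and \<epsilon>: "\<epsilon> > 0"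
  shows "\<exists>N. \<forall>n\<ge>N. \<forall>G. nvertex_graph n G \<and> free_of F G \<and>
      graph_spectral_radius (turan_graph n r) \<le> graph_spectral_radius G \<longrightarrow>
      (1 - 1 / real r - \<epsilon>) * real n ^ 2 \<le> 2 * real (num_edges G)"
proof -
  define p where "p = 1 - 1 / real r"
  have p: "1 / 2 \<le> p" using r2 by (simp add: p_def field_simps)
  \<comment> \<open>\<delta> \<le> \<epsilon>/2 gives (p + \<delta>)(p - \<epsilon>) \<le> p^2 - p
    \<epsilon> / 2. With \<delta> \<le> 1/4, p \<ge> 1/2 and n \<ge> 5, p n - 1 exceeds \<delta> n,
    which excludes the first alternative of \<open>N\<close>.\<close>
  define \<delta> where "\<delta> = min (\<epsilon> / 2) (1 / 4)"
  have \<delta>: "\<delta> > 0" "\<delta> \<le> \<epsilon> / 2" "\<delta> \<le> 1 / 4" using \<epsilon> by (auto simp: \<delta>_def)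
  obtain N where N: "\<forall>n\<ge>N. \<forall>G. nvertex_graph n G \<and> free_of F G \<longrightarrow>
      graph_spectral_radius G \<le> \<delta> * real n \<or>
      (graph_spectral_radius G)\<^sup>2 \<le> (1 - 1 / real r + \<delta>) * (2 * real (num_edges G))"
    using spectral_radius_sq_le_edges[OF F r \<delta>(1)] ..
  \<comment> \<open>n \<ge> 4/\<epsilon> lets the gain p \<epsilon> n^2 / 2 match the cross term 2 p
    n of (p n - 1)^2.\<close>
  have "(p - \<epsilon>) * real n ^ 2 \<le> 2 * real (num_edges G)"
    if n: "max (max N 5) (nat \<lceil>4 / \<epsilon>\<rceil> + 1) \<le> n" and G: "nvertex_graph n G" "free_of F G"
      "graph_spectral_radius (turan_graph n r) \<le> graph_spectral_radius G" for n G
  proof (rule ccontr)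
    assume "\<not> ?thesis"
    then have less: "2 * real (num_edges G) < (p - \<epsilon>) * real n ^ 2" by simp
    have nN: "N \<le> n" "5 \<le> n" "nat \<lceil>4 / \<epsilon>\<rceil> + 1 \<le> n" using n by auto
    then have n0: "n > 0" and n\<epsilon>: "4 / \<epsilon> \<le> real n" and n5: "5 \<le> real n" by linarith+
    have low: "p * real n - 1 \<le> graph_spectral_radius G"
      using spectral_radius_turan_ge[OF n0] G(3) unfolding p_def by linarith
    have pn: "1 / 2 * real n \<le> p * real n" using p by (intro mult_right_mono) auto
    have "\<delta> * real n \<le> 1 / 4 * real n" using \<delta>(3) by (intro mult_right_mono) auto
    then have "\<not> graph_spectral_radius G \<le> \<delta> * real n" using low pn n5 by linarith
    moreover have "graph_spectral_radius G \<le> \<delta> * real n \<or>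
      (graph_spectral_radius G)\<^sup>2 \<le> (p + \<delta>) * (2 * real (num_edges G))"
      unfolding p_def using N nN(1) G(1,2) by blast
    ultimately have "(graph_spectral_radius G)\<^sup>2 \<le> (p + \<delta>) * (2 * real (num_edges G))" by blast
    moreover have "0 \<le> p * real n - 1" using pn n5 by linarith
    then have "(p * real n - 1)\<^sup>2 \<le> (graph_spectral_radius G)\<^sup>2" by (rule power_mono[OF low])
    moreover have "(p + \<delta>) * (2 * real (num_edges G)) < (p + \<delta>) * ((p - \<epsilon>) * real n ^ 2)"
      using less p \<delta>(1) by (intro mult_strict_left_mono) auto
    ultimately have "(p * real n - 1)\<^sup>2 < (p + \<delta>) * ((p - \<epsilon>) * real n ^ 2)" by linarith
    moreover have "(p + \<delta>) * ((p - \<epsilon>) * real n ^ 2) \<le> (p * p - p * \<epsilon> / 2) * real n ^ 2"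
    proof -
      have "p * \<delta> \<le> p * (\<epsilon> / 2)" using p \<delta>(2) by (intro mult_left_mono) auto
      moreover have "0 \<le> \<delta> * \<epsilon>" using \<delta>(1) \<epsilon> by simp
      ultimately have "(p + \<delta>) * (p - \<epsilon>) \<le> p * p - p * \<epsilon> / 2" by (simp add: algebra_simps)
      then have "(p + \<delta>) * (p - \<epsilon>) * real n ^ 2 \<le> (p * p - p * \<epsilon> / 2) * real n ^ 2"
        by (rule mult_right_mono) simp
      then show ?thesis by (simp only: mult.assoc)
    qed
    ultimately have "(p * real n - 1)\<^sup>2 < (p * p - p * \<epsilon> / 2) * real n ^ 2" by linarith
    then have "1 + p * real n * (\<epsilon> / 2 * real n) < p * real n * 2"
      by (simp add: power2_eq_square algebra_simps)
    moreover have "p * real n * 2 \<le> p * real n * (\<epsilon> / 2 * real n)"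
      using p n\<epsilon> \<epsilon> by (intro mult_left_mono) (auto simp: field_simps)
    ultimately show False by linarith
  qed
  then show ?thesis unfolding p_def by blast
qed

lemma extremal_near_turan:
  assumes r2: "r \<ge> 2" and \<gamma>: "\<gamma> > 0"
  shows "\<exists>N. \<forall>n\<ge>N. \<forall>q\<in>extremal F r n. real (edit_dist (snd q) (turan_graph n r)) \<le> \<gamma> * real n ^ 2"
proof -
  obtain \<epsilon> where \<epsilon>: "\<epsilon> > 0" and "\<exists>N. \<forall>n\<ge>N. \<forall>G. nvertex_graph n G \<and> free_of F G \<and>
      (1 - 1 / real r - \<epsilon>) * real n ^ 2 \<le> 2 * real (num_edges G) \<longrightarrow>
      real (edit_dist G (turan_graph n r)) \<le> \<gamma> * real n ^ 2"
    using stability[OF F r \<gamma>] by blast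
  then obtain N1 where N1: "\<forall>n\<ge>N1. \<forall>G. nvertex_graph n G \<and> free_of F G \<and>
      (1 - 1 / real r - \<epsilon>) * real n ^ 2 \<le> 2 * real (num_edges G) \<longrightarrow>
      real (edit_dist G (turan_graph n r)) \<le> \<gamma> * real n ^ 2" by blast
  obtain N2 where N2: "\<forall>n\<ge>N2. \<forall>G. nvertex_graph n G \<and> free_of F G \<and>
      graph_spectral_radius (turan_graph n r) \<le> graph_spectral_radius G \<longrightarrow>
      (1 - 1 / real r - \<epsilon>) * real n ^ 2 \<le> 2 * real (num_edges G)"
    using dense_if_spectral[OF r2 \<epsilon>] ..
  have "real (edit_dist G (turan_graph n r)) \<le> \<gamma> * real n ^ 2"
    if n: "max (max N1 N2) (nat \<lceil>1 / \<epsilon>\<rceil> + 1) \<le> n" and q: "(\<Delta>, G) \<in> extremal F r n" for n \<Delta> G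
  proof -
    have nN: "N1 \<le> n" "N2 \<le> n" "nat \<lceil>1 / \<epsilon>\<rceil> + 1 \<le> n" using n by auto
    then have n0: "n > 0" and n\<epsilon>: "1 / \<epsilon> \<le> real n" by linarith+
    have D: "\<Delta> \<in> admissible_degrees r n" and G: "nvertex_graph n G" "free_of F G"
      and e: "num_edges G = ex_num F n \<Delta> \<or> graph_spectral_radius G = spex_num F n \<Delta>"
      using q by (auto simp: extremal_def free_family_def)
    from e have "(1 - 1 / real r - \<epsilon>) * real n ^ 2 \<le> 2 * real (num_edges G)"
    proof
      assume "num_edges G = ex_num F n \<Delta>"
      then have "real (turan_number n r) \<le> real (num_edges G)" using extremal_values(1)[OF n0 D] by simp
      moreover have "1 * real n \<le> (\<epsilon> * real n) * real n" using n\<epsilon> \<epsilon> by (intro mult_right_mono) (auto simp: field_simps)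
      then have "real n \<le> \<epsilon> * real n ^ 2" by (simp add: power2_eq_square)
      moreover have "(1 - 1 / real r - \<epsilon>) * real n ^ 2 = (1 - 1 / real r) * real n ^ 2 - \<epsilon> * real n ^ 2"
        by (rule left_diff_distrib)
      ultimately show ?thesis using turan_edges_lower[OF r, of n] by linarith
    next
      assume "graph_spectral_radius G = spex_num F n \<Delta>"
      then have "graph_spectral_radius (turan_graph n r) \<le> graph_spectral_radius G"
        using extremal_values(2)[OF n0 D] by simp
      then show ?thesis using N2 nN(2) G by blast
    qed
    then show ?thesis using N1 nN(1) G by blast
  qed
  then show ?thesis by (intro exI[of _ "max (max N1 N2) (nat \<lceil>1 / \<epsilon>\<rceil> + 1)"]) auto
qed

end

theorem proposition4p2:
  fixes F :: "'f graph" and r :: nat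
  assumes "simple_graph F"
    and "chromatic_number F = r + 1" and "r + 1 \<ge> 3"
    and "a_param F > 1"
  shows
    "(\<exists>C::real. \<forall>\<^sub>F n in sequentially. \<forall>\<Delta>::nat.
        \<lceil>(real r - 1) / real r * real n\<rceil> \<le> int \<Delta> \<and> \<Delta> \<le> n - 1 \<longrightarrow>
        (\<exists>J \<in> J_family_eq (a_param F - 1) n \<Delta> r. free_of F J \<and>
           real (edit_dist J (turan_graph n r)) \<le> C * real n \<and>
           \<bar>real (num_edges J) - real (turan_number n r)\<bar> \<le> C * real n \<and>
           \<bar>graph_spectral_radius J - graph_spectral_radius (turan_graph n r)\<bar> \<le> C * sqrt (real n)))
     \<and>
     (\<exists>g h :: nat \<Rightarrow> real. g \<in> o(\<lambda>n. real n ^ 2) \<and> h \<in> o(\<lambda>n. real n) \<and>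
        (\<forall>\<^sub>F n in sequentially. \<forall>\<Delta>::nat.
          \<lceil>(real r - 1) / real r * real n\<rceil> \<le> int \<Delta> \<and> \<Delta> \<le> n - 1 \<longrightarrow>
            \<bar>real (ex_num F n \<Delta>) - real (turan_number n r)\<bar> \<le> g n \<and>
            \<bar>spex_num F n \<Delta> - graph_spectral_radius (turan_graph n r)\<bar> \<le> h n))
     \<and>
     (\<exists>g :: nat \<Rightarrow> real. g \<in> o(\<lambda>n. real n ^ 2) \<and>
        (\<forall>\<^sub>F n in sequentially. \<forall>\<Delta>::nat.
          \<lceil>(real r - 1) / real r * real n\<rceil> \<le> int \<Delta> \<and> \<Delta> \<le> n - 1 \<longrightarrow>
            (\<forall>G \<in> free_family F n \<Delta>.
               num_edges G = ex_num F n \<Delta> \<or> graph_spectral_radius G = spex_num F n \<Delta> \<longrightarrow>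
               real (edit_dist G (turan_graph n r)) \<le> g n)))"
    (is "?P1 \<and> ?P2 \<and> ?P3")
proof (intro conjI)
  note F = assms(1,2)
  have r2: "r \<ge> 2" and r: "r \<ge> 1" using assms(3) by auto
  note a = assms(4)
  have fin: "finite (admissible_degrees r n)" for n
    by (rule finite_subset[of _ "{..n}"]) (auto simp: admissible_degrees_def)
  show ?P1
  \<comment> \<open>The constant 2 comes from the spectral radius, to which the star adds at most
    twice the square root of n; edit distance and edge count change by at most n.\<close>
  proof (intro exI[of _ 2] eventually_sequentiallyI[of 1] allI impI)
    fix n \<Delta> assume n: "1 \<le> (n :: nat)" and D: "\<lceil>(real r - 1) / real r * real n\<rceil> \<le> int \<Delta> \<and> \<Delta> \<le> n - 1"
    have "\<Delta> \<in> admissible_degrees r n" by (rule mem_admissible_degrees[OF r D])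
    then have D': "n - n div r \<le> \<Delta>" "\<Delta> \<le> n - 1" by (auto simp: admissible_degrees_def)
    have n0: "n > 0" using n by simp
    obtain J where J: "J \<in> J_family_eq (a_param F - 1) n \<Delta> r" "free_of F J"
      "edit_dist J (turan_graph n r) \<le> n"
      "turan_number n r \<le> num_edges J" "num_edges J \<le> turan_number n r + n"
      "graph_spectral_radius (turan_graph n r) \<le> graph_spectral_radius J"
      "graph_spectral_radius J \<le> graph_spectral_radius (turan_graph n r) + 2 * sqrt (real n)"
      using ex_J[OF F r a n0 D'] by blast
    have "real (edit_dist J (turan_graph n r)) \<le> 2 * real n" using J(3) by linarith
    moreover have "\<bar>real (num_edges J) - real (turan_number n r)\<bar> \<le> 2 * real n" using J(4,5) by linarith
    moreover have "\<bar>graph_spectral_radius J - graph_spectral_radius (turan_graph n r)\<bar> \<le> 2 * sqrt (real n)"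
      using J(6,7) by linarith
    ultimately show "\<exists>J \<in> J_family_eq (a_param F - 1) n \<Delta> r. free_of F J \<and>
           real (edit_dist J (turan_graph n r)) \<le> 2 * real n \<and>
           \<bar>real (num_edges J) - real (turan_number n r)\<bar> \<le> 2 * real n \<and>
           \<bar>graph_spectral_radius J - graph_spectral_radius (turan_graph n r)\<bar> \<le> 2 * sqrt (real n)"
      using J(1,2) by blast
  qed
  \<comment> \<open>The thresholds in the asymptotic bounds are common to all admissible \<Delta>,
    so maximising over \<Delta> yields a single error function.\<close>
  have "\<exists>g. g \<in> o(\<lambda>n. real n ^ 2) \<and>
      (\<forall>n. \<forall>\<Delta>\<in>admissible_degrees r n. \<bar>real (ex_num F n \<Delta>) - real (turan_number n r)\<bar> \<le> g n)"
    by (rule smallo_envelope[OF fin _ ex_num_asymp[OF F r a]]) auto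
  then obtain g where g: "g \<in> o(\<lambda>n. real n ^ 2)"
    "\<forall>n. \<forall>\<Delta>\<in>admissible_degrees r n. \<bar>real (ex_num F n \<Delta>) - real (turan_number n r)\<bar> \<le> g n" by blast
  have "\<exists>h. h \<in> o(\<lambda>n. real n) \<and>
      (\<forall>n. \<forall>\<Delta>\<in>admissible_degrees r n. \<bar>spex_num F n \<Delta> - graph_spectral_radius (turan_graph n r)\<bar> \<le> h n)"
    by (rule smallo_envelope[OF fin _ spex_num_asymp[OF F r a]]) auto
  then obtain h where h: "h \<in> o(\<lambda>n. real n)"
    "\<forall>n. \<forall>\<Delta>\<in>admissible_degrees r n. \<bar>spex_num F n \<Delta> - graph_spectral_radius (turan_graph n r)\<bar> \<le> h n" by blast
  show ?P2
    using g h mem_admissible_degrees[OF r] by (intro exI[of _ g] exI[of _ h] conjI always_eventually allI impI) blast+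
  have fin': "finite (extremal F r n)" for n
    unfolding extremal_def by (intro finite_SigmaI fin finite_subset[OF _ finite_free_family]) auto
  have "\<exists>g. g \<in> o(\<lambda>n. real n ^ 2) \<and>
      (\<forall>n. \<forall>q\<in>extremal F r n. real (edit_dist (snd q) (turan_graph n r)) \<le> g n)"
    by (rule smallo_envelope[OF fin' _ extremal_near_turan[OF F r a r2]]) auto
  then obtain k where k: "k \<in> o(\<lambda>n. real n ^ 2)"
    "\<forall>n. \<forall>q\<in>extremal F r n. real (edit_dist (snd q) (turan_graph n r)) \<le> k n" by blast
  show ?P3
  proof (intro exI[of _ k] conjI k(1) always_eventually allI impI ballI)
    fix n \<Delta> G
    assume "\<lceil>(real r - 1) / real r * real n\<rceil> \<le> int \<Delta> \<and> \<Delta> \<le> n - 1" "G \<in> free_family F n \<Delta>"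
      "num_edges G = ex_num F n \<Delta> \<or> graph_spectral_radius G = spex_num F n \<Delta>"
    then have "(\<Delta>, G) \<in> extremal F r n" using mem_admissible_degrees[OF r] by (simp add: extremal_def)
    then show "real (edit_dist G (turan_graph n r)) \<le> k n" using k(2) by fastforce
  qed
qed

end
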